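(* Fix an integer $q \geq 3$ and a real number $\kappa < \kappa_q$, where $$\kappa_q = \left( \sqrt{\frac{\log (q/(q-1))}{\log q}} + \sqrt{\frac{\log q}{\log (q/(q-1))}} \right)^{-2}.$$ Then the following holds for all sufficiently large $m$ with $m \leq \kappa n^2$. Every $n$-vertex graph with $m$ edges which maximizes the number of proper $q$-colorings (among all $n$-vertex graphs with $m$ edges) is a semi-complete subgraph of some $K_{a,b}$ (and this semi-complete subgraph is correctly oriented if $q \geq 4$), plus isolated vertices, where $a = (1+o(1))\sqrt{m \cdot \log \frac{q}{q-1} / \log q}$ and $b = (1+o(1)) \sqrt{m \cdot \log q / \log \frac{q}{q-1}}$. Moreover, the corresponding (maximum) number of proper $q$-colorings is $q^n e^{(-c+o(1))\sqrt{m}}$, where $c = 2\sqrt{\log \frac{q}{q-1} \cdot \log q}$.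
   Context: All logarithms are natural. A proper $q$-coloring of a graph is an assignment of one of $q$ colors to each vertex such that adjacent vertices receive different colors. $o(1)$ denotes a quantity tending to $0$ as $m,n \to \infty$. Semi-complete subgraph: for positive integers $a \leq b$, a graph $G$ is a semi-complete subgraph of $K_{a,b}$ if $G$ is obtained from $K_{a,b}$ by deleting a set of fewer than $a$ edges which all share a common endpoint $v$ (i.e. the missing edges form a star with center $v$). If $v$ belongs to the larger side (the side of size $b$), $G$ is called correctly oriented. *)

theory Defs
  imports "HOL-Analysis.Analysis" "HOL-Library.Ramsey"
begin

text \<open>A finite simple graph is a finite vertex set \<open>V\<close> together with a set \<open>E\<close> of two-element
  subsets of \<open>V\<close>.\<close>

definition nm_graph :: "nat \<Rightarrow> nat \<Rightarrow> 'a set \<Rightarrow> 'a set set \<Rightarrow> bool" where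
  "nm_graph n m V E \<longleftrightarrow> finite V \<and> card V = n \<and> E \<subseteq> [V]\<^bsup>2\<^esup> \<and> card E = m"

definition proper_colorings :: "nat \<Rightarrow> 'a set \<Rightarrow> 'a set set \<Rightarrow> ('a \<Rightarrow> nat) set" where
  "proper_colorings q V E =
     {f \<in> V \<rightarrow>\<^sub>E {..<q}. \<forall>u v. {u, v} \<in> E \<longrightarrow> f u \<noteq> f v}"

definition num_colorings :: "nat \<Rightarrow> 'a set \<Rightarrow> 'a set set \<Rightarrow> nat" where
  "num_colorings q V E = card (proper_colorings q V E)"

text \<open>Vertices are natural numbers in the next two definitions; every finite graph is isomorphic
  to one of these.\<close>

definition maximizes_colorings :: "nat \<Rightarrow> nat \<Rightarrow> nat \<Rightarrow> nat set \<Rightarrow> nat set set \<Rightarrow> bool" where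
  "maximizes_colorings q n m V E \<longleftrightarrow> nm_graph n m V E \<and>
     (\<forall>(V' :: nat set) E'. nm_graph n m V' E' \<longrightarrow> num_colorings q V' E' \<le> num_colorings q V E)"

definition max_num_colorings :: "nat \<Rightarrow> nat \<Rightarrow> nat \<Rightarrow> nat" where
  "max_num_colorings q n m =
     Max {num_colorings q V E | (V :: nat set) E. nm_graph n m V E}"

definition complete_bipartite_edges :: "'a set \<Rightarrow> 'a set \<Rightarrow> 'a set set" where
  "complete_bipartite_edges A B = {{x, y} | x y. x \<in> A \<and> y \<in> B}"

text \<open>\<open>E\<close> arises from the edge set of a copy of \<open>K\<^bsub>a,b\<^esub>\<close> inside \<open>V\<close>, with sides \<open>A\<close> (size \<open>a\<close>)
  and \<open>B\<close> (size \<open>b\<close>), by deleting a set \<open>S\<close> of fewer than \<open>a\<close> edges through the common endpoint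
  \<open>v\<close>. The vertices in \<open>V - (A \<union> B)\<close> are isolated. If \<open>oriented\<close> holds, then \<open>v\<close> must lie in the
  side of size \<open>b\<close>.\<close>

definition semi_complete_plus_isolated ::
    "bool \<Rightarrow> nat \<Rightarrow> nat \<Rightarrow> 'a set \<Rightarrow> 'a set set \<Rightarrow> bool" where
  "semi_complete_plus_isolated oriented a b V E \<longleftrightarrow>
     0 < a \<and> a \<le> b \<and>
     (\<exists>A B S v. A \<subseteq> V \<and> B \<subseteq> V \<and> A \<inter> B = {} \<and>
        finite A \<and> finite B \<and> card A = a \<and> card B = b \<and>
        S \<subseteq> complete_bipartite_edges A B \<and> card S < a \<and>
        v \<in> A \<union> B \<and> (\<forall>e\<in>S. v \<in> e) \<and> (oriented \<longrightarrow> v \<in> B) \<and>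
        E = complete_bipartite_edges A B - S)"

definition kappa :: "nat \<Rightarrow> real" where
  "kappa q = (sqrt (ln (real q / (real q - 1)) / ln (real q))
            + sqrt (ln (real q) / ln (real q / (real q - 1)))) powi (-2)"

end

theory Submission
  imports Defs "HOL-Real_Asymp.Real_Asymp"
begin

text \<open>By a container argument, \<open>e\<close> to the \<open>o(\<surd>m)\<close> many families \<open>\<Prod>v. \<Lambda> v\<close> of color lists
  cover all proper colorings of a graph with \<open>m\<close> edges, and within each family almost all edges
  join vertices with disjoint lists. Giving a list of size \<open>k\<close> the weight \<open>ln (q / k)\<close>, a family of
  total weight \<open>W\<close> has \<open>q^n e^(-W)\<close> members. The product of the weights of two disjoint lists is at
  least \<open>K = ln q * ln (q / (q - 1))\<close>, whence \<open>W\<^sup>2 \<ge> 2 K d\<close>, where \<open>d\<close> is the number of ordered pairs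
  of vertices with disjoint lists, so \<open>d \<ge> (2 - o(1)) m\<close>. Near equality forces almost all lists to be
  \<open>{i}\<close>, the complement of \<open>{i}\<close>, or everything, for a single color \<open>i\<close>.

  Every \<open>a, b\<close> with \<open>m \<le> a b\<close> and \<open>a + b \<le> n\<close> gives the lower bound \<open>q (q - 1)^b q^(n - a - b)\<close> for the
  maximum. Hence in a maximizer there is a set \<open>A\<close> which is monochromatic in almost all colorings. Let
  \<open>B\<close> be its neighbourhood. An edge that does not join \<open>A\<close> and \<open>B\<close> costs a constant factor, which
  contradicts the lower bound for a slightly larger complete bipartite graph; for a single such edge
  this uses that \<open>ln q / ln (q / (q - 1))\<close> is not an integer. The lower bound also gives
  \<open>a b - m < a\<close> for \<open>a = |A|\<close>, \<open>b = |B|\<close>.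

  Finally, the colorings of \<open>K\<^sub>a\<^sub>,\<^sub>b\<close> without a set \<open>M\<close> of pairs are sorted by the subset of \<open>M\<close> that is
  monochromatic. Apart from a negligible number of colorings, this subset is a biclique \<open>X \<times> Y\<close>, and
  contributes in proportion to \<open>(q - 2)^(b - |Y|)\<close>. The total is largest if every nonempty subset of
  \<open>M\<close> is a biclique with \<open>|Y| = 1\<close>, that is, if \<open>M\<close> is a star centered in \<open>B\<close>. For \<open>q = 3\<close> the
  size of \<open>Y\<close> is irrelevant.\<close>

section \<open>List colorings and near-complete bipartite graphs\<close>

text \<open>The factor \<open>2\<close> in \<open>W^2 >= 2 * K * d\<close> is what the weights have
  to overcome. Expand \<open>W^2\<close> over ordered pairs of lists, with \<open>y S\<close> the
  total weight of the vertices with list \<open>S\<close>. For complementary \<open>S\<close> and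
  \<open>T\<close> the diagonal helps, since \<open>y S ^ 2 + y T ^ 2 >= 2 * y S * y T\<close>, so a
  weight product of \<open>K\<close> is enough. But this uses up the diagonal: disjoint lists that
  are not complementary need weight product \<open>2 * K\<close> by themselves. Hence the numerical
  inequalities come in two strengths.

  Different containers might single out different sets. Two almost complete bipartite pictures of
  one graph share most edges, and since \<open>sa < 1\<close>, swapping the sides accounts for at
  most about \<open>sa^2 * m < m\<close> of them. So the large sides nearly agree, and
  \<open>A\<close> can be read off from degrees into one of them.

  The end game compares numbers of colorings up to a factor close to \<open>1\<close>, not just up
  to \<open>exp (o (sqrt m))\<close>. It succeeds because the lower bound and the count of colorings
  constant on \<open>A\<close> carry the same factor \<open>q\<close>, for the color of
  \<open>A\<close>; a defect is excluded as soon as it costs a fixed constant factor.\<close>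

definition list_colorings :: "'a set \<Rightarrow> 'a set set \<Rightarrow> ('a \<Rightarrow> nat set) \<Rightarrow> ('a \<Rightarrow> nat) set" where
  "list_colorings V E \<Lambda> = {f \<in> Pi\<^sub>E V \<Lambda>. \<forall>u\<in>V. \<forall>v\<in>V. {u, v} \<in> E \<longrightarrow> f u \<noteq> f v}"

definition forced_lists :: "nat \<Rightarrow> nat \<Rightarrow> 'a set \<Rightarrow> 'a set \<Rightarrow> 'a \<Rightarrow> nat set" where
  "forced_lists q i A B v = (if v \<in> A then {i} else if v \<in> B then {..<q} - {i} else {..<q})"

lemma proper_colorings_eq:
  assumes "E \<subseteq> [V]\<^bsup>2\<^esup>"
  shows "proper_colorings q V E = list_colorings V E (\<lambda>_. {..<q})"
proof -
  have "u \<in> V \<and> v \<in> V" if "{u, v} \<in> E" for u v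
    using assms that by (auto simp: nsets_def)
  then show ?thesis
    unfolding proper_colorings_def list_colorings_def by blast
qed

lemma finite_proper_colorings: "finite V \<Longrightarrow> finite (proper_colorings q V E)"
  unfolding proper_colorings_def by (rule finite_subset[of _ "V \<rightarrow>\<^sub>E {..<q}"]) (auto intro: finite_PiE)

lemma finite_list_colorings:
  "finite V \<Longrightarrow> (\<And>v. v \<in> V \<Longrightarrow> finite (\<Lambda> v)) \<Longrightarrow> finite (list_colorings V E \<Lambda>)"
  unfolding list_colorings_def by (rule finite_subset[of _ "Pi\<^sub>E V \<Lambda>"]) (auto intro: finite_PiE)

lemma card_list_colorings_le_prod:
  assumes "finite V" "\<And>v. v \<in> V \<Longrightarrow> finite (\<Lambda> v)"
  shows "card (list_colorings V E \<Lambda>) \<le> (\<Prod>v\<in>V. card (\<Lambda> v))"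
proof -
  have "card (list_colorings V E \<Lambda>) \<le> card (Pi\<^sub>E V \<Lambda>)"
    using assms by (intro card_mono finite_PiE) (auto simp: list_colorings_def)
  with assms show ?thesis by (simp add: card_PiE)
qed

text \<open>A function is determined by its restrictions to \<open>V - X\<close> and to
  \<open>X\<close>. The admissible values \<open>R g x\<close> may depend on the coloring
  \<open>g\<close> of the rest, which lets vertices be deleted at the price of \<open>k x\<close>
  choices each.\<close>

lemma card_le_card_extensions:
  assumes "finite X" "X \<subseteq> V" "F \<subseteq> extensional V" "finite G"
    and restr: "\<And>f. f \<in> F \<Longrightarrow> restrict f (V - X) \<in> G"
    and val: "\<And>f x. f \<in> F \<Longrightarrow> x \<in> X \<Longrightarrow> f x \<in> R (restrict f (V - X)) x"
    and R: "\<And>g x. g \<in> G \<Longrightarrow> x \<in> X \<Longrightarrow> finite (R g x) \<and> card (R g x) \<le> k x"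
  shows "card F \<le> card G * (\<Prod>x\<in>X. k x)"
proof -
  let ?h = "\<lambda>f. (restrict f (V - X), restrict f X)"
  have inj: "inj_on ?h F"
  proof (rule inj_onI)
    fix f g assume fg: "f \<in> F" "g \<in> F" "?h f = ?h g"
    have "f x = g x" for x
    proof (cases "x \<in> V")
      case True
      from fg(3) have e: "restrict f (V - X) = restrict g (V - X)" "restrict f X = restrict g X" by auto
      show ?thesis
        using fun_cong[OF e(1), of x] fun_cong[OF e(2), of x] True by (cases "x \<in> X") auto
    next
      case False
      then show ?thesis using fg(1,2) assms(3) by (metis extensional_arb subsetD)
    qed
    then show "f = g" by blast
  qed
  have sub: "?h ` F \<subseteq> (SIGMA g:G. Pi\<^sub>E X (R g))"
    using restr val by fastforce
  have fin: "finite (SIGMA g:G. Pi\<^sub>E X (R g))"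
    using assms(1,4) R by (intro finite_SigmaI finite_PiE) auto
  have "card F = card (?h ` F)" using inj by (simp add: card_image)
  also have "\<dots> \<le> card (SIGMA g:G. Pi\<^sub>E X (R g))" by (rule card_mono[OF fin sub])
  also have "\<dots> = (\<Sum>g\<in>G. card (Pi\<^sub>E X (R g)))"
    using assms(1,4) R by (intro card_SigmaI) (auto intro!: finite_PiE)
  also have "\<dots> = (\<Sum>g\<in>G. \<Prod>x\<in>X. card (R g x))" using assms(1) by (simp add: card_PiE)
  also have "\<dots> \<le> (\<Sum>g\<in>G. \<Prod>x\<in>X. k x)" using R by (intro sum_mono prod_mono) auto
  finally show ?thesis by simp
qed

text \<open>The color of \<open>w x\<close> is settled before that of \<open>x\<close>, so
  \<open>x\<close> loses this color from its list. Edges inside \<open>X\<close> are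
  ignored.\<close>

lemma card_list_colorings_delete:
  assumes "finite V" "\<And>v. v \<in> V \<Longrightarrow> finite (\<Lambda> v)" "X \<subseteq> V"
    and w: "\<And>x. x \<in> X \<Longrightarrow> w x \<in> V - X \<and> {x, w x} \<in> E"
    and k: "\<And>x c. x \<in> X \<Longrightarrow> c \<in> \<Lambda> (w x) \<Longrightarrow> card (\<Lambda> x - {c}) \<le> k x"
  shows "card (list_colorings V E \<Lambda>) \<le> card (list_colorings (V - X) E \<Lambda>) * (\<Prod>x\<in>X. k x)"
proof (rule card_le_card_extensions[where V = V and R = "\<lambda>g x. \<Lambda> x - {g (w x)}"])
  show "finite X" using assms finite_subset by blast
  show "finite (list_colorings (V - X) E \<Lambda>)" using assms by (intro finite_list_colorings) auto
  show "list_colorings V E \<Lambda> \<subseteq> extensional V" by (auto simp: list_colorings_def PiE_def)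
next
  fix f assume "f \<in> list_colorings V E \<Lambda>"
  then show "restrict f (V - X) \<in> list_colorings (V - X) E \<Lambda>"
    by (auto simp: list_colorings_def)
next
  fix f x assume "f \<in> list_colorings V E \<Lambda>" "x \<in> X"
  then show "f x \<in> \<Lambda> x - {restrict f (V - X) (w x)}"
    using w[of x] \<open>X \<subseteq> V\<close> by (auto simp: list_colorings_def)
next
  fix g x assume "g \<in> list_colorings (V - X) E \<Lambda>" "x \<in> X"
  then show "finite (\<Lambda> x - {g (w x)}) \<and> card (\<Lambda> x - {g (w x)}) \<le> k x"
    using w[of x] k[of x] assms(2,3) by (auto simp: list_colorings_def)
qed (use assms in auto)

text \<open>Take a maximal independent subset of \<open>U\<close> or its complement, whichever is larger.\<close>

lemma half_with_outside_neighbours: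
  assumes "finite U" and nb: "\<And>u. u \<in> U \<Longrightarrow> \<exists>w. {u, w} \<in> E" and nl: "\<And>x. {x} \<notin> E"
  obtains X where "X \<subseteq> U" "card U \<le> 2 * card X" "\<And>x. x \<in> X \<Longrightarrow> \<exists>w. w \<notin> X \<and> {x, w} \<in> E"
proof -
  let ?I = "{Y. Y \<subseteq> U \<and> (\<forall>u\<in>Y. \<forall>v\<in>Y. {u, v} \<notin> E)}"
  have "finite ?I" by (rule finite_subset[of _ "Pow U"]) (use assms(1) in auto)
  moreover have "{} \<in> ?I" by simp
  then have "?I \<noteq> {}" by (rule ex_in_conv[THEN iffD1, OF exI])
  ultimately have "\<exists>Y\<in>?I. \<forall>Z\<in>?I. Y \<subseteq> Z \<longrightarrow> Y = Z" by (rule finite_has_maximal)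
  then obtain Y where Y: "Y \<in> ?I" and max: "\<And>Z. Z \<in> ?I \<Longrightarrow> Y \<subseteq> Z \<Longrightarrow> Y = Z"
    by (elim bexE) simp
  have finY: "finite Y" using Y assms(1) finite_subset by blast
  have Yn: "\<exists>w. w \<notin> Y \<and> {x, w} \<in> E" if "x \<in> Y" for x
    using that Y nb[of x] by blast
  \<comment> \<open>A vertex of \<open>U - Y\<close> whose neighbours all lie in
    \<open>U - Y\<close> has none in \<open>Y\<close> and could be added to \<open>Y\<close>,
    against maximality.\<close>
  have Cn: "\<exists>w. w \<notin> U - Y \<and> {x, w} \<in> E" if x: "x \<in> U - Y" for x
  proof (rule ccontr)
    assume neg: "\<not> ?thesis"
    have "insert x Y \<in> ?I"
    proof -
      have "{u, v} \<notin> E" if "u \<in> insert x Y" "v \<in> insert x Y" for u v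
        using that neg Y nl[of x] by (auto simp: insert_commute)
      then show ?thesis using x Y by auto
    qed
    from max[OF this] x show False by blast
  qed
  have "card U = card Y + card (U - Y)"
    using Y assms(1) card_Diff_subset[OF finY, of U] card_mono[of U Y] by auto
  then consider "card U \<le> 2 * card Y" | "card U \<le> 2 * card (U - Y)" by linarith
  then show thesis
  proof cases
    case 1
    then show thesis using that[of Y] Y Yn by blast
  next
    case 2
    then show thesis using that[of "U - Y"] Cn by blast
  qed
qed

lemma finite_forced_lists [simp]: "finite (forced_lists q i A B v)"
  by (simp add: forced_lists_def)

lemma prod_card_forced_lists:
  assumes "finite V" "A \<subseteq> V" "B \<subseteq> V" "A \<inter> B = {}" "i < q"
  shows "(\<Prod>v\<in>V. card (forced_lists q i A B v)) = (q - 1) ^ card B * q ^ (card V - card A - card B)"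
proof -
  have fin: "finite A" "finite B" using assms by (auto intro: finite_subset)
  have V: "V = A \<union> (B \<union> (V - A - B))" using assms by auto
  have "(\<Prod>v\<in>V. card (forced_lists q i A B v)) =
    (\<Prod>v\<in>A. card (forced_lists q i A B v)) * ((\<Prod>v\<in>B. card (forced_lists q i A B v)) *
     (\<Prod>v\<in>V-A-B. card (forced_lists q i A B v)))"
    apply (subst V)
    apply (subst prod.union_disjoint)
    using assms fin apply auto[3]
    apply (subst prod.union_disjoint)
    using assms fin by auto
  also have "(\<Prod>v\<in>A. card (forced_lists q i A B v)) = 1"
    by (rule prod.neutral) (auto simp: forced_lists_def)
  also have "(\<Prod>v\<in>B. card (forced_lists q i A B v)) = (q - 1) ^ card B"
    using assms by (subst prod_constant[symmetric], intro prod.cong) (auto simp: forced_lists_def)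
  also have "(\<Prod>v\<in>V-A-B. card (forced_lists q i A B v)) = q ^ card (V - A - B)"
    by (subst prod_constant[symmetric], intro prod.cong) (auto simp: forced_lists_def)
  also have "card (V - A - B) = card V - card A - card B"
  proof -
    have "B \<subseteq> V - A" using assms by auto
    with assms fin show ?thesis by (simp add: card_Diff_subset)
  qed
  finally show ?thesis using fin by (simp add: prod_constant)
qed

text \<open>Color \<open>A\<close> with a single color \<open>i\<close> and let \<open>B\<close>
  avoid it. Since \<open>A\<close> is nonempty, different \<open>i\<close> give disjoint families,
  which accounts for the factor \<open>q\<close>.\<close>

lemma num_colorings_bipartite_ge:
  fixes A B :: "'a set"
  assumes "finite V" "A \<subseteq> V" "B \<subseteq> V" "A \<inter> B = {}" "A \<noteq> {}" "E \<subseteq> complete_bipartite_edges A B"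
  shows "q * (q - 1) ^ card B * q ^ (card V - card A - card B) \<le> num_colorings q V E"
proof -
  let ?F = "\<lambda>i. Pi\<^sub>E V (forced_lists q i A B)"
  have fin: "finite (?F i)" for i using assms by (intro finite_PiE) auto
  have disj: "?F i \<inter> ?F j = {}" if "i \<noteq> j" for i j
  proof -
    obtain x where x: "x \<in> A" using assms by auto
    then have "x \<in> V" using assms by auto
    have "f x = k" if "f \<in> ?F k" for f k
      using PiE_mem[OF that \<open>x \<in> V\<close>] x by (simp add: forced_lists_def)
    with \<open>i \<noteq> j\<close> show ?thesis by blast
  qed
  have sub: "(\<Union>i<q. ?F i) \<subseteq> proper_colorings q V E"
  proof clarify
    fix f i assume i: "i < q" and f: "f \<in> ?F i"
    have mem: "f v \<in> forced_lists q i A B v" if "v \<in> V" for v using PiE_mem[OF f that] .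
    have "f \<in> V \<rightarrow>\<^sub>E {..<q}"
      using f i by (auto simp: PiE_iff forced_lists_def split: if_splits)
    moreover have "f x \<noteq> f y" if "x \<in> A" "y \<in> B" for x y
    proof -
      have "x \<in> V" "y \<in> V" "y \<notin> A" using that assms by auto
      then show ?thesis using mem[of x] mem[of y] that by (auto simp: forced_lists_def)
    qed
    then have "f u \<noteq> f v" if "{u, v} \<in> E" for u v
      using that assms(6) by (fastforce simp: complete_bipartite_edges_def doubleton_eq_iff)
    ultimately show "f \<in> proper_colorings q V E" by (auto simp: proper_colorings_def)
  qed
  have "card (\<Union>i<q. ?F i) = (\<Sum>i<q. card (?F i))"
    using fin disj by (intro card_UN_disjoint) auto
  also have "\<dots> = (\<Sum>i<q. (q - 1) ^ card B * q ^ (card V - card A - card B))"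
    using prod_card_forced_lists[OF assms(1-4)] assms(1) by (intro sum.cong refl) (simp add: card_PiE)
  also have "\<dots> = q * (q - 1) ^ card B * q ^ (card V - card A - card B)" by simp
  finally show ?thesis
    unfolding num_colorings_def using card_mono[OF finite_proper_colorings[OF assms(1)] sub] by simp
qed

lemma card_complete_bipartite_edges:
  assumes "A \<inter> B = {}"
  shows "card (complete_bipartite_edges A B) = card A * card B"
proof -
  have "complete_bipartite_edges A B = (\<lambda>(x, y). {x, y}) ` (A \<times> B)"
    by (auto simp: complete_bipartite_edges_def)
  moreover have "inj_on (\<lambda>(x, y). {x, y}) (A \<times> B)"
    using assms by (fastforce simp: inj_on_def doubleton_eq_iff)
  ultimately show ?thesis by (simp add: card_image card_cartesian_product)
qed

lemma complete_bipartite_edges_nsets: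
  "A \<subseteq> V \<Longrightarrow> B \<subseteq> V \<Longrightarrow> A \<inter> B = {} \<Longrightarrow> complete_bipartite_edges A B \<subseteq> [V]\<^bsup>2\<^esup>"
  by (auto simp: complete_bipartite_edges_def)

text \<open>Any \<open>m\<close> edges of a complete bipartite graph with sides \<open>a\<close> and
  \<open>b\<close> form a competitor, and the colorings counted for the complete graph are proper
  for it as well.\<close>

lemma maximizer_ge:
  assumes "maximizes_colorings q n m V E" "1 \<le> a" "m \<le> a * b" "a + b \<le> n"
  shows "q * (q - 1) ^ b * q ^ (n - a - b) \<le> num_colorings q V E"
proof -
  define A where "A = {..<a}"
  define B where "B = {a..<a + b}"
  have AB: "A \<subseteq> {..<n}" "B \<subseteq> {..<n}" "A \<inter> B = {}" "A \<noteq> {}" "card A = a" "card B = b"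
    using assms by (auto simp: A_def B_def lessThan_empty_iff)
  obtain E' where E': "E' \<subseteq> complete_bipartite_edges A B" "card E' = m"
    using obtain_subset_with_card_n[of m "complete_bipartite_edges A B"] card_complete_bipartite_edges[OF AB(3)] AB assms(3)
    by metis
  have "nm_graph n m {..<n} E'"
    using E' complete_bipartite_edges_nsets[OF AB(1-3)] by (auto simp: nm_graph_def)
  then have "num_colorings q {..<n} E' \<le> num_colorings q V E"
    using assms(1) by (auto simp: maximizes_colorings_def)
  with num_colorings_bipartite_ge[of "{..<n}" A B E' q] AB E' show ?thesis by simp
qed

section \<open>Containers\<close>

text \<open>Ordered pairs: every edge inside \<open>F\<close> counts twice.\<close>

definition adjacent_pairs :: "'a set set \<Rightarrow> 'a set \<Rightarrow> ('a \<times> 'a) set" where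
  "adjacent_pairs E F = {(u, v). u \<in> F \<and> v \<in> F \<and> {u, v} \<in> E}"

lemma finite_adjacent_pairs: "finite F \<Longrightarrow> finite (adjacent_pairs E F)"
  by (rule finite_subset[of _ "F \<times> F"]) (auto simp: adjacent_pairs_def)

lemma adjacent_pairs_insert:
  assumes "finite F" "{v} \<notin> E"
  shows "card (adjacent_pairs E (insert v F)) \<le> card (adjacent_pairs E F) + 2 * card F"
proof -
  have "adjacent_pairs E (insert v F) \<subseteq> adjacent_pairs E F \<union> (Pair v ` F \<union> (\<lambda>x. (x, v)) ` F)"
    using assms by (auto simp: adjacent_pairs_def)
  then have "card (adjacent_pairs E (insert v F)) \<le> card (adjacent_pairs E F \<union> (Pair v ` F \<union> (\<lambda>x. (x, v)) ` F))"
    by (rule card_mono[rotated]) (simp add: assms finite_adjacent_pairs)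
  also have "\<dots> \<le> card (adjacent_pairs E F) + (card (Pair v ` F) + card ((\<lambda>x. (x, v)) ` F))"
    by (meson card_Un_le add_left_mono le_trans)
  also have "\<dots> \<le> card (adjacent_pairs E F) + (card F + card F)"
    by (intro add_mono card_image_le assms order_refl)
  finally show ?thesis by simp
qed

text \<open>Kleitman--Winston: an independent set avoiding a vertex of degree at least \<open>D\<close> loses that
  vertex, and one containing it loses its \<open>D\<close> neighbours.\<close>

lemma graph_containers:
  assumes "finite W" "card W \<le> N" "1 \<le> D" "\<And>x. {x} \<notin> E"
  shows "\<exists>\<F>. finite \<F> \<and> card \<F> \<le> (card W + 1) ^ (card W div D) \<and>
    (\<forall>F\<in>\<F>. F \<subseteq> W \<and> card (adjacent_pairs E F) \<le> 2 * N * (card W div D) + card W * D) \<and>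
    (\<forall>I. I \<subseteq> W \<and> (\<forall>u\<in>I. \<forall>v\<in>I. {u, v} \<notin> E) \<longrightarrow> (\<exists>F\<in>\<F>. I \<subseteq> F))"
  using assms(1,2)
proof (induction W rule: finite_psubset_induct)
  case (psubset W)
  let ?N = "\<lambda>v. {u \<in> W. {v, u} \<in> E}"
  let ?P = "\<lambda>W \<F>. finite \<F> \<and> card \<F> \<le> (card W + 1) ^ (card W div D) \<and>
    (\<forall>F\<in>\<F>. F \<subseteq> W \<and> card (adjacent_pairs E F) \<le> 2 * N * (card W div D) + card W * D) \<and>
    (\<forall>I. I \<subseteq> W \<and> (\<forall>u\<in>I. \<forall>v\<in>I. {u, v} \<notin> E) \<longrightarrow> (\<exists>F\<in>\<F>. I \<subseteq> F))"
  show ?case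
  proof (cases "\<exists>v\<in>W. D \<le> card (?N v)")
    case False
    have "adjacent_pairs E W = (SIGMA u:W. ?N u)" by (auto simp: adjacent_pairs_def)
    then have "card (adjacent_pairs E W) = (\<Sum>u\<in>W. card (?N u))" using psubset.hyps by simp
    also have "\<dots> \<le> (\<Sum>u\<in>W. D)" using False by (intro sum_mono) (simp add: not_le less_imp_le)
    finally show ?thesis by (intro exI[of _ "{W}"]) auto
  next
    case True
    then obtain v where v: "v \<in> W" "D \<le> card (?N v)" by blast
    define W1 where "W1 = W - {v}"
    define W2 where "W2 = W - {v} - ?N v"
    have vN: "v \<notin> ?N v" using assms(4)[of v] by simp
    have sub: "W1 \<subset> W" "W2 \<subset> W" using v by (auto simp: W1_def W2_def)
    have fin: "finite W1" "finite W2" using psubset.hyps by (auto simp: W1_def W2_def)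
    have c1: "card W1 + 1 = card W" using card_Suc_Diff1[of W v] v psubset.hyps by (simp add: W1_def)
    have "insert v (?N v) \<union> W2 = W" "insert v (?N v) \<inter> W2 = {}" using v by (auto simp: W2_def)
    then have "card W = card (insert v (?N v)) + card W2"
      using card_Un_disjoint[of "insert v (?N v)" W2] fin psubset.hyps by simp
    then have c2: "card W2 + 1 + D \<le> card W" using v vN psubset.hyps by simp
    have "card W1 \<le> N" using c1 psubset.prems by simp
    from psubset.IH[OF sub(1) this] obtain F1 where IH1: "?P W1 F1" by (elim exE)
    have F1: "finite F1" "card F1 \<le> (card W1 + 1) ^ (card W1 div D)" "\<And>F. F \<in> F1 \<Longrightarrow> F \<subseteq> W1 \<and> card (adjacent_pairs E F) \<le> 2 * N * (card W1 div D) + card W1 * D"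
      "\<And>I. I \<subseteq> W1 \<Longrightarrow> (\<forall>u\<in>I. \<forall>v\<in>I. {u, v} \<notin> E) \<Longrightarrow> (\<exists>F\<in>F1. I \<subseteq> F)"
      using IH1 by (elim conjE; simp)+
    have "card W2 \<le> N" using c2 psubset.prems by simp
    from psubset.IH[OF sub(2) this] obtain F2 where IH2: "?P W2 F2" by (elim exE)
    have F2: "finite F2" "card F2 \<le> (card W2 + 1) ^ (card W2 div D)" "\<And>F. F \<in> F2 \<Longrightarrow> F \<subseteq> W2 \<and> card (adjacent_pairs E F) \<le> 2 * N * (card W2 div D) + card W2 * D"
      "\<And>I. I \<subseteq> W2 \<Longrightarrow> (\<forall>u\<in>I. \<forall>v\<in>I. {u, v} \<notin> E) \<Longrightarrow> (\<exists>F\<in>F2. I \<subseteq> F)"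
      using IH2 by (elim conjE; simp)+
    define k where "k = (card W - D) div D"
    have k: "card W div D = k + 1" using c2 assms(3) by (simp add: k_def le_div_geq)
    have k2: "card W2 div D \<le> k" unfolding k_def using c2 by (intro div_le_mono) simp
    have k1: "card W1 div D \<le> k + 1" unfolding k[symmetric] using c1 by (intro div_le_mono) simp
    have w0: "1 \<le> card W" using c1 by simp
    \<comment> \<open>With \<open>w = card W\<close>, the two branches contribute at most
      \<open>w ^ (k + 1)\<close> and \<open>w ^ k\<close>, and
      \<open>w ^ (k + 1) + w ^ k <= (w + 1) ^ (k + 1)\<close> closes the induction.\<close>
    have "card (F1 \<union> insert v ` F2) \<le> card F1 + card F2"
      by (rule order.trans[OF card_Un_le]) (simp add: card_image_le F2(1))
    also have "card F1 \<le> card W ^ (k + 1)"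
    proof -
      have "(card W1 + 1) ^ (card W1 div D) \<le> card W ^ (k + 1)"
        unfolding c1 using k1 w0 by (intro power_increasing)
      then show ?thesis using F1(2) by (rule le_trans[rotated])
    qed
    also have "card F2 \<le> card W ^ k"
    proof -
      have "(card W2 + 1) ^ (card W2 div D) \<le> card W ^ (card W2 div D)"
        using c2 by (intro power_mono) auto
      also have "\<dots> \<le> card W ^ k" using k2 w0 by (intro power_increasing)
      finally show ?thesis using F2(2) by simp
    qed
    also have "card W ^ (k + 1) + card W ^ k = (card W + 1) * card W ^ k" by (simp add: algebra_simps)
    also have "\<dots> \<le> (card W + 1) * (card W + 1) ^ k" by (intro mult_left_mono power_mono) auto
    finally have card: "card (F1 \<union> insert v ` F2) \<le> (card W + 1) ^ (card W div D)"
      by (simp add: k)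
    have edges: "F \<subseteq> W \<and> card (adjacent_pairs E F) \<le> 2 * N * (card W div D) + card W * D"
      if "F \<in> F1 \<union> insert v ` F2" for F
      using that
    proof
      assume "F \<in> F1"
      from F1(3)[OF this] have "F \<subseteq> W1" "card (adjacent_pairs E F) \<le> 2 * N * (card W1 div D) + card W1 * D"
        by auto
      moreover have "2 * N * (card W1 div D) + card W1 * D \<le> 2 * N * (card W div D) + card W * D"
        using c1 by (intro add_mono mult_mono div_le_mono) auto
      ultimately show ?thesis using sub by auto
    next
      assume "F \<in> insert v ` F2"
      then obtain F' where F': "F = insert v F'" "F' \<in> F2" by blast
      from F2(3)[OF F'(2)] have a: "F' \<subseteq> W2" "card (adjacent_pairs E F') \<le> 2 * N * (card W2 div D) + card W2 * D"
        by auto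
      have "card F' \<le> card W2" using a fin by (intro card_mono)
      then have "card F' \<le> N" using c2 psubset.prems by simp
      \<comment> \<open>Putting \<open>v\<close> back costs at most \<open>2 * N\<close> ordered
        pairs. This is paid for by the quotient \<open>card W div D\<close>, which has dropped by at
        least one for \<open>W2\<close>.\<close>
      have "card (adjacent_pairs E F) \<le> card (adjacent_pairs E F') + 2 * card F'"
        unfolding F'(1) using a fin assms(4) by (intro adjacent_pairs_insert) (auto intro: finite_subset)
      also have "\<dots> \<le> (2 * N * k + card W * D) + 2 * N"
      proof -
        have "2 * N * (card W2 div D) + card W2 * D \<le> 2 * N * k + card W * D"
          using c2 k2 by (intro add_mono mult_mono) auto
        then show ?thesis using a \<open>card F' \<le> N\<close> by linarith
      qed
      finally have "card (adjacent_pairs E F) \<le> 2 * N * (card W div D) + card W * D"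
        by (simp add: k algebra_simps)
      then show ?thesis using a sub v F' by auto
    qed
    have cover: "\<exists>F\<in>F1 \<union> insert v ` F2. I \<subseteq> F" if I: "I \<subseteq> W" "\<forall>u\<in>I. \<forall>v\<in>I. {u, v} \<notin> E" for I
    proof (cases "v \<in> I")
      case False
      then show ?thesis using F1(4)[of I] I by (auto simp: W1_def)
    next
      case True
      then have "I - {v} \<subseteq> W2" using I by (auto simp: W2_def)
      then obtain F where "F \<in> F2" "I - {v} \<subseteq> F" using F2(4)[of "I - {v}"] I by auto
      then show ?thesis by (intro bexI[of _ "insert v F"]) auto
    qed
    show ?thesis
      using card edges cover F1(1) F2(1)
      by (intro exI[of _ "F1 \<union> insert v ` F2"] conjI ballI allI impI) simp_all
  qed
qed

text \<open>Every color class is independent, so it lies in a container; choose one for each of the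
  \<open>q\<close> colors. The list of a vertex consists of the colors whose container holds it. If
  adjacent vertices share a color \<open>i\<close> in their lists, they form an adjacent pair inside
  the container of \<open>i\<close>, and there are few of those.\<close>

lemma colorings_covered_by_labellings:
  assumes "finite V" "E \<subseteq> [V]\<^bsup>2\<^esup>" "1 \<le> D"
  defines "u \<equiv> card (\<Union>E)"
  shows "\<exists>\<L>. finite \<L> \<and> card \<L> \<le> ((u + 1) ^ (u div D)) ^ q \<and>
    (\<forall>f\<in>proper_colorings q V E. \<exists>\<Lambda>\<in>\<L>. f \<in> Pi\<^sub>E V \<Lambda>) \<and>
    (\<forall>\<Lambda>\<in>\<L>. (\<forall>v\<in>V. \<Lambda> v \<noteq> {} \<and> \<Lambda> v \<subseteq> {..<q}) \<and>
       card {(x, y). {x, y} \<in> E \<and> \<Lambda> x \<inter> \<Lambda> y \<noteq> {}} \<le> q * (2 * u * (u div D) + u * D))"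
proof -
  define U where "U = \<Union>E"
  have "U \<subseteq> V" using assms(2) by (auto simp: U_def nsets_def)
  then have finU: "finite U" using assms(1) finite_subset by blast
  have loop: "{x} \<notin> E" for x using assms(2) by (auto simp: nsets_def)
  obtain \<F> where \<F>: "finite \<F>" "card \<F> \<le> (card U + 1) ^ (card U div D)"
    "\<And>F. F \<in> \<F> \<Longrightarrow> F \<subseteq> U \<and> card (adjacent_pairs E F) \<le> 2 * u * (card U div D) + card U * D"
    "\<And>I. I \<subseteq> U \<Longrightarrow> (\<forall>u\<in>I. \<forall>v\<in>I. {u, v} \<notin> E) \<Longrightarrow> (\<exists>F\<in>\<F>. I \<subseteq> F)"
    using graph_containers[OF finU _ assms(3) loop, of u] by (auto simp: u_def U_def)
  \<comment> \<open>Isolated vertices keep the full list, so the bounds involve the number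
    \<open>u\<close> of nonisolated vertices and not the number of all vertices.\<close>
  define lab where "lab = (\<lambda>\<sigma> v. if v \<in> U then {i. i < q \<and> v \<in> \<sigma> i} else {..<q})"
  \<comment> \<open>A choice of containers that leaves some vertex without a color covers no
    coloring and is discarded; this makes all lists nonempty.\<close>
  define \<L> where "\<L> = {\<Lambda> \<in> lab ` ({..<q} \<rightarrow>\<^sub>E \<F>). \<forall>v\<in>V. \<Lambda> v \<noteq> {}}"
  have finP: "finite ({..<q} \<rightarrow>\<^sub>E \<F>)" using \<F>(1) by (intro finite_PiE) auto
  have finL: "finite \<L>" using finP by (simp add: \<L>_def)
  have "card \<L> \<le> card (lab ` ({..<q} \<rightarrow>\<^sub>E \<F>))"
    unfolding \<L>_def using finP by (intro card_mono) auto
  also have "\<dots> \<le> card ({..<q} \<rightarrow>\<^sub>E \<F>)" by (intro card_image_le finP)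
  also have "\<dots> = card \<F> ^ q" by (simp add: card_PiE)
  also have "\<dots> \<le> ((u + 1) ^ (u div D)) ^ q" using \<F>(2) by (intro power_mono) (auto simp: u_def U_def)
  finally have 1: "card \<L> \<le> ((u + 1) ^ (u div D)) ^ q" .
  have 2: "\<exists>\<Lambda>\<in>\<L>. f \<in> Pi\<^sub>E V \<Lambda>" if f: "f \<in> proper_colorings q V E" for f
  proof -
    have "\<exists>F\<in>\<F>. {v \<in> U. f v = i} \<subseteq> F" for i
    proof (rule \<F>(4))
      have "f u \<noteq> f v" if "{u, v} \<in> E" for u v using f that by (simp add: proper_colorings_def)
      then show "\<forall>u\<in>{v \<in> U. f v = i}. \<forall>v\<in>{v \<in> U. f v = i}. {u, v} \<notin> E" by fastforce
    qed auto
    then obtain s where s: "\<And>i. s i \<in> \<F> \<and> {v \<in> U. f v = i} \<subseteq> s i" by metis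
    define \<sigma> where "\<sigma> = restrict s {..<q}"
    have "\<sigma> \<in> {..<q} \<rightarrow>\<^sub>E \<F>" using s by (auto simp: \<sigma>_def)
    moreover have mem: "f v \<in> lab \<sigma> v" if "v \<in> V" for v
      using s[of "f v"] f that by (auto simp: lab_def \<sigma>_def proper_colorings_def)
    ultimately have "lab \<sigma> \<in> \<L>" by (auto simp: \<L>_def)
    moreover have "f \<in> Pi\<^sub>E V (lab \<sigma>)" using mem f by (auto simp: proper_colorings_def PiE_iff)
    ultimately show ?thesis by blast
  qed
  have 3: "card {(x, y). {x, y} \<in> E \<and> \<Lambda> x \<inter> \<Lambda> y \<noteq> {}} \<le> q * (2 * u * (u div D) + u * D)"
    if "\<Lambda> \<in> \<L>" for \<Lambda>
  proof -
    obtain \<sigma> where \<sigma>: "\<sigma> \<in> {..<q} \<rightarrow>\<^sub>E \<F>" "\<Lambda> = lab \<sigma>"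
      using \<open>\<Lambda> \<in> \<L>\<close> unfolding \<L>_def by blast
    then have s: "\<sigma> i \<in> \<F>" if "i < q" for i using that by (auto simp: PiE_iff)
    have fin: "finite (adjacent_pairs E (\<sigma> i))" if "i < q" for i
      using \<F>(3)[OF s[OF that]] finU by (intro finite_adjacent_pairs) (auto intro: finite_subset)
    have "{(x, y). {x, y} \<in> E \<and> \<Lambda> x \<inter> \<Lambda> y \<noteq> {}} \<subseteq> (\<Union>i<q. adjacent_pairs E (\<sigma> i))"
    proof (clarsimp, goal_cases)
      case prems: (1 x y)
      from prems have "x \<in> U" "y \<in> U" by (auto simp: U_def)
      with prems show ?case by (fastforce simp: \<sigma> lab_def adjacent_pairs_def)
    qed
    then have "card {(x, y). {x, y} \<in> E \<and> \<Lambda> x \<inter> \<Lambda> y \<noteq> {}} \<le> card (\<Union>i<q. adjacent_pairs E (\<sigma> i))"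
      using fin by (intro card_mono) auto
    also have "\<dots> \<le> (\<Sum>i<q. card (adjacent_pairs E (\<sigma> i)))" by (rule card_UN_le) simp
    also have "\<dots> \<le> (\<Sum>i<q. 2 * u * (u div D) + u * D)"
      using \<F>(3)[OF s] by (intro sum_mono) (simp add: u_def U_def)
    finally show ?thesis by simp
  qed
  have 4: "\<Lambda> v \<noteq> {} \<and> \<Lambda> v \<subseteq> {..<q}" if "\<Lambda> \<in> \<L>" "v \<in> V" for \<Lambda> v
    using that by (auto simp: \<L>_def lab_def split: if_splits)
  show ?thesis using finL 1 2 3 4 by (intro exI[of _ \<L>] conjI ballI) simp_all
qed

text \<open>The degree threshold is \<open>D\<close> of order \<open>m ^ (1/4)\<close>. With
  \<open>u = O (sqrt m)\<close>, the number of labellings is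
  \<open>exp (O (m ^ (1/4) * ln m))\<close> and the number of exceptional pairs is
  \<open>O (m ^ (3/4))\<close>. Any exponent strictly between \<open>0\<close> and
  \<open>1/2\<close> would balance the two requirements.\<close>

lemma colorings_covered_asymp:
  fixes C \<epsilon> :: real and q :: nat
  assumes "C > 0" "\<epsilon> > 0"
  shows "\<exists>M. \<forall>m\<ge>M. \<forall>V (E::'a set set). finite V \<and> E \<subseteq> [V]\<^bsup>2\<^esup> \<and> card E = m \<and> card (\<Union>E) \<le> C * sqrt m \<longrightarrow>
   (\<exists>\<L>. finite \<L> \<and> card \<L> \<le> exp (\<epsilon> * sqrt m) \<and>
    (\<forall>f\<in>proper_colorings q V E. \<exists>\<Lambda>\<in>\<L>. f \<in> Pi\<^sub>E V \<Lambda>) \<and>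
    (\<forall>\<Lambda>\<in>\<L>. (\<forall>v\<in>V. \<Lambda> v \<noteq> {} \<and> \<Lambda> v \<subseteq> {..<q}) \<and>
       card {(x, y). {x, y} \<in> E \<and> \<Lambda> x \<inter> \<Lambda> y \<noteq> {}} \<le> \<epsilon> * m))"
proof -
  have "eventually (\<lambda>m::nat. real q * (C * real m powr (1/4)) * ln (C * sqrt m + 1) \<le> \<epsilon> * sqrt m) at_top"
    using assms by real_asymp
  moreover have "eventually (\<lambda>m::nat. real q * (2 * C * sqrt m * (C * real m powr (1/4)) + C * sqrt m * (real m powr (1/4) + 1)) \<le> \<epsilon> * real m) at_top"
    using assms by real_asymp
  ultimately have "eventually (\<lambda>m::nat. m \<ge> 1 \<and> real q * (C * real m powr (1/4)) * ln (C * sqrt m + 1) \<le> \<epsilon> * sqrt m \<and>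
    real q * (2 * C * sqrt m * (C * real m powr (1/4)) + C * sqrt m * (real m powr (1/4) + 1)) \<le> \<epsilon> * real m) at_top"
    using eventually_ge_at_top[of 1] by eventually_elim auto
  then obtain M where M: "\<And>m. m \<ge> M \<Longrightarrow> m \<ge> 1 \<and> real q * (C * real m powr (1/4)) * ln (C * sqrt m + 1) \<le> \<epsilon> * sqrt m \<and>
    real q * (2 * C * sqrt m * (C * real m powr (1/4)) + C * sqrt m * (real m powr (1/4) + 1)) \<le> \<epsilon> * real m"
    by (auto simp: eventually_at_top_linorder)
  show ?thesis
  proof (intro exI[of _ M] allI impI, elim conjE)
    fix m V and E :: "'a set set"
    assume "m \<ge> M" and VE: "finite V" "E \<subseteq> [V]\<^bsup>2\<^esup>" "card E = m" and u: "card (\<Union>E) \<le> C * sqrt m"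
    note m = M[OF \<open>m \<ge> M\<close>]
    define x where "x = real m powr (1/4)"
    have x: "x \<ge> 1" "x * x = sqrt m" using m by (auto simp: x_def powr_add[symmetric] powr_half_sqrt ge_one_powr_ge_zero)
    define D where "D = nat \<lceil>x\<rceil>"
    have D: "1 \<le> D" "x \<le> D" "D \<le> x + 1" using x by (auto simp: D_def) linarith+
    define u where "u = card (\<Union>E)"
    have ud: "real (u div D) \<le> C * x"
    proof -
      have "real (u div D) \<le> real u / D" by (rule of_nat_div_le_of_nat)
      also have "\<dots> \<le> (C * sqrt m) / x" using u x D assms by (intro frac_le) (auto simp: u_def)
      also have "\<dots> = C * x" using x by (simp add: field_simps)
      finally show ?thesis .
    qed
    have "1 \<le> D" by (rule D)
    from colorings_covered_by_labellings[OF VE(1,2) this, of q, folded u_def] obtain \<L>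
      where L': "finite \<L> \<and> card \<L> \<le> ((u + 1) ^ (u div D)) ^ q \<and>
      (\<forall>f\<in>proper_colorings q V E. \<exists>\<Lambda>\<in>\<L>. f \<in> Pi\<^sub>E V \<Lambda>) \<and>
      (\<forall>\<Lambda>\<in>\<L>. (\<forall>v\<in>V. \<Lambda> v \<noteq> {} \<and> \<Lambda> v \<subseteq> {..<q}) \<and>
       card {(x, y). {x, y} \<in> E \<and> \<Lambda> x \<inter> \<Lambda> y \<noteq> {}} \<le> q * (2 * u * (u div D) + u * D))" by (elim exE)
    have L: "finite \<L>" "card \<L> \<le> ((u + 1) ^ (u div D)) ^ q"
      "\<And>f. f\<in>proper_colorings q V E \<Longrightarrow> \<exists>\<Lambda>\<in>\<L>. f \<in> Pi\<^sub>E V \<Lambda>"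
      "\<And>\<Lambda>. \<Lambda>\<in>\<L> \<Longrightarrow> (\<forall>v\<in>V. \<Lambda> v \<noteq> {} \<and> \<Lambda> v \<subseteq> {..<q})"
      "\<And>\<Lambda>. \<Lambda>\<in>\<L> \<Longrightarrow> card {(x, y). {x, y} \<in> E \<and> \<Lambda> x \<inter> \<Lambda> y \<noteq> {}} \<le> q * (2 * u * (u div D) + u * D)"
      using L' by (elim conjE; simp)+
    have "real (card \<L>) \<le> real (((u + 1) ^ (u div D)) ^ q)" using L(2) by (rule of_nat_mono)
    also have "\<dots> = (real u + 1) ^ ((u div D) * q)" by (simp add: power_mult add.commute)
    also have "\<dots> = exp (real ((u div D) * q) * ln (real u + 1))"
      by (subst exp_of_nat_mult) simp
    also have "\<dots> \<le> exp (\<epsilon> * sqrt m)"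
    proof -
      have "real ((u div D) * q) \<le> real q * (C * x)"
        using mult_left_mono[OF ud, of "real q"] by (simp add: mult.commute)
      then have "real ((u div D) * q) * ln (real u + 1) \<le> (real q * (C * x)) * ln (C * sqrt m + 1)"
        by (rule mult_mono) (use u assms x in \<open>auto simp: u_def\<close>)
      then show ?thesis using m by (simp add: x_def)
    qed
    finally have c: "card \<L> \<le> exp (\<epsilon> * sqrt m)" .
    have e: "card {(x, y). {x, y} \<in> E \<and> \<Lambda> x \<inter> \<Lambda> y \<noteq> {}} \<le> \<epsilon> * m" if "\<Lambda> \<in> \<L>" for \<Lambda>
    proof -
      have "real (card {(x, y). {x, y} \<in> E \<and> \<Lambda> x \<inter> \<Lambda> y \<noteq> {}}) \<le> real (q * (2 * u * (u div D) + u * D))"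
        using L(5)[OF that] by (rule of_nat_mono)
      also have "\<dots> = real q * (2 * real u * real (u div D) + real u * real D)" by simp
      also have "\<dots> \<le> real q * (2 * (C * sqrt m) * (C * x) + (C * sqrt m) * (x + 1))"
        using ud u D assms x by (intro mult_left_mono add_mono mult_mono) (auto simp: u_def)
      also have "\<dots> \<le> \<epsilon> * m" using m by (simp add: x_def algebra_simps)
      finally show ?thesis .
    qed
    show "\<exists>\<L>. finite \<L> \<and> card \<L> \<le> exp (\<epsilon> * sqrt m) \<and>
    (\<forall>f\<in>proper_colorings q V E. \<exists>\<Lambda>\<in>\<L>. f \<in> Pi\<^sub>E V \<Lambda>) \<and>
    (\<forall>\<Lambda>\<in>\<L>. (\<forall>v\<in>V. \<Lambda> v \<noteq> {} \<and> \<Lambda> v \<subseteq> {..<q}) \<and>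
       card {(x, y). {x, y} \<in> E \<and> \<Lambda> x \<inter> \<Lambda> y \<noteq> {}} \<le> \<epsilon> * m)"
      using L c e by (intro exI[of _ \<L>] conjI ballI) simp_all
  qed
qed

section \<open>Optimal labellings and their stability\<close>

lemma Bernoulli_strict:
  fixes t :: real
  assumes "0 < t" "t < 1" "2 \<le> n"
  shows "1 - real n * t < (1 - t) ^ n"
  using assms(3)
proof (induction n rule: nat_induct_at_least)
  case base
  have "0 < t\<^sup>2" using assms by simp
  then show ?case by (simp add: power2_eq_square algebra_simps)
next
  case (Suc n)
  have "1 - real (Suc n) * t \<le> (1 - real n * t) * (1 - t)" using assms by (simp add: algebra_simps)
  also have "\<dots> < (1 - t) ^ n * (1 - t)" using Suc assms by (intro mult_strict_right_mono) auto
  finally show ?case by (simp add: mult.commute)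
qed

section \<open>Weights of lists and the inequalities for their products\<close>

locale colouring_params =
  fixes q :: nat
  assumes q3: "3 \<le> q"
begin

definition Lq :: real where "Lq = ln q"
definition lq :: real where "lq = ln (real q / (real q - 1))"
definition wt :: "nat \<Rightarrow> real" where "wt k = ln (real q / real k)"
definition Kq :: real where "Kq = Lq * lq"
text \<open>Minimizing \<open>a * Lq + b * lq\<close> subject to \<open>a * b = m\<close> gives
  \<open>a = sa * sqrt m\<close> and \<open>b = sb * sqrt m\<close>. At the optimum both summands
  equal \<open>cq / 2 * sqrt m\<close>.\<close>

definition cq :: real where "cq = 2 * sqrt Kq"
definition sa :: real where "sa = sqrt (lq / Lq)"
definition sb :: real where "sb = sqrt (Lq / lq)"

lemma Lq_pos: "0 < Lq" using q3 by (simp add: Lq_def)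

lemma lq_pos: "0 < lq" unfolding lq_def using q3 by (intro ln_gt_zero) (simp add: field_simps)

lemma lq_less_Lq: "lq < Lq"
proof -
  have "real q / (real q - 1) < real q" using q3 by (simp add: field_simps)
  then show ?thesis unfolding lq_def Lq_def using q3 by (intro ln_less_cancel_iff[THEN iffD2]) auto
qed

lemma Kq_pos: "0 < Kq" using Lq_pos lq_pos by (simp add: Kq_def)
lemma cq_pos: "0 < cq" using Kq_pos by (simp add: cq_def)
lemma cq_squared: "cq * cq = 4 * Kq" using Kq_pos by (simp add: cq_def)
lemma sa_pos: "0 < sa" using Lq_pos lq_pos by (simp add: sa_def)
lemma sb_pos: "0 < sb" using Lq_pos lq_pos by (simp add: sb_def)
lemma sa_sb: "sa * sb = 1" using Lq_pos lq_pos by (simp add: sa_def sb_def real_sqrt_mult[symmetric])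
lemma sa_less_1: "sa < 1" using Lq_pos lq_pos lq_less_Lq by (simp add: sa_def field_simps)
lemma sb_greater_1: "1 < sb" using Lq_pos lq_pos lq_less_Lq by (simp add: sb_def field_simps)

lemma sa_Lq: "Lq * sa = cq / 2"
proof -
  have "Lq * sa = sqrt (Lq * Lq) * sqrt (lq / Lq)" using Lq_pos by (simp add: sa_def)
  also have "\<dots> = sqrt (Lq * Lq * (lq / Lq))" by (rule real_sqrt_mult[symmetric])
  also have "Lq * Lq * (lq / Lq) = Kq" using Lq_pos by (simp add: Kq_def)
  finally show ?thesis by (simp add: cq_def)
qed

lemma sb_lq: "lq * sb = cq / 2"
proof -
  have "lq * sb = sqrt (lq * lq) * sqrt (Lq / lq)" using lq_pos by (simp add: sb_def)
  also have "\<dots> = sqrt (lq * lq * (Lq / lq))" by (rule real_sqrt_mult[symmetric])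
  also have "lq * lq * (Lq / lq) = Kq" using lq_pos by (simp add: Kq_def)
  finally show ?thesis by (simp add: cq_def)
qed

lemma wt_1: "wt 1 = Lq" by (simp add: wt_def Lq_def)
lemma wt_pred: "wt (q - 1) = lq" using q3 by (simp add: wt_def lq_def of_nat_diff)
lemma wt_q: "wt q = 0" using q3 by (simp add: wt_def)

lemma wt_eq: "1 \<le> k \<Longrightarrow> wt k = Lq - ln k"
  using q3 by (simp add: wt_def Lq_def ln_div)

lemma wt_antimono: "1 \<le> x \<Longrightarrow> x \<le> y \<Longrightarrow> wt y \<le> wt x"
  by (simp add: wt_eq)

lemma wt_ge_lq: "1 \<le> x \<Longrightarrow> x < q \<Longrightarrow> lq \<le> wt x"
  using wt_antimono[of x "q - 1"] wt_pred by simp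

lemma wt_le_Lq: "1 \<le> x \<Longrightarrow> wt x \<le> Lq"
  using wt_antimono[of 1 x] wt_1 by simp

lemma wt_pos: "1 \<le> x \<Longrightarrow> x < q \<Longrightarrow> 0 < wt x"
  using wt_ge_lq[of x] lq_pos by simp

lemma wt_nonneg: "1 \<le> x \<Longrightarrow> x \<le> q \<Longrightarrow> 0 \<le> wt x"
  using wt_pos[of x] wt_q by (cases "x = q") auto

lemma lq_alt: "lq = - ln (1 - 1 / real q)"
proof -
  have "1 - 1 / real q = (real q - 1) / real q" using q3 by (simp add: field_simps)
  then show ?thesis using q3 by (simp add: lq_def ln_div)
qed

lemma wt_diff_alt: "x < q \<Longrightarrow> wt (q - x) = - ln (1 - real x * (1 / real q))"
proof -
  assume x: "x < q"
  have "1 - real x * (1 / real q) = (real q - real x) / real q" using q3 by (simp add: field_simps)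
  then show ?thesis using x q3 by (simp add: wt_def ln_div of_nat_diff)
qed

text \<open>Bernoulli: \<open>(1 - 1 / q) ^ x >= 1 - x / q\<close>. In logarithms, giving up
  \<open>x\<close> colors costs at least \<open>x\<close> times as much as giving up one.\<close>

lemma wt_diff_ge:
  assumes "x < q"
  shows "real x * lq \<le> wt (q - x)"
proof -
  have "1 - real x * (1 / real q) \<le> (1 - 1 / real q) ^ x"
    using Bernoulli_inequality[of "- (1 / real q)" x] q3 by simp
  then have "ln (1 - real x * (1 / real q)) \<le> ln ((1 - 1 / real q) ^ x)"
    using assms q3 by (subst ln_le_cancel_iff) (auto simp: field_simps)
  also have "\<dots> = real x * ln (1 - 1 / real q)" by (rule ln_realpow)
  finally show ?thesis using wt_diff_alt[OF assms] lq_alt by simp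
qed

lemma wt_diff_gr:
  assumes "x < q" "2 \<le> x"
  shows "real x * lq < wt (q - x)"
proof -
  have "1 - real x * (1 / real q) < (1 - 1 / real q) ^ x"
    using Bernoulli_strict[of "1 / real q" x] q3 assms by simp
  then have "ln (1 - real x * (1 / real q)) < ln ((1 - 1 / real q) ^ x)"
    using assms q3 by (subst ln_less_cancel_iff) (auto simp: field_simps)
  also have "\<dots> = real x * ln (1 - 1 / real q)" by (rule ln_realpow)
  finally show ?thesis using wt_diff_alt[OF assms(1)] lq_alt by simp
qed

text \<open>From \<open>x <= 2 ^ (x - 1)\<close> and \<open>2 * x <= q\<close> follows
  \<open>x ^ x <= q ^ (x - 1)\<close>, which says \<open>Lq <= x * wt x\<close>. Multiplied with
  \<open>x * lq < wt (q - x)\<close>, the two factors \<open>x\<close> cancel.\<close>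

lemma wt_complementary_aux:
  assumes "2 \<le> x" "2 * x \<le> q"
  shows "Kq < wt x * wt (q - x)"
proof -
  have "x \<le> 2 ^ (x - 1)" using assms(1) by (metis One_nat_def Suc_leI Suc_diff_1 less_exp less_le_trans pos2)
  then have "x ^ (x - 1) * x \<le> x ^ (x - 1) * 2 ^ (x - 1)" by simp
  also have "\<dots> = (2 * x) ^ (x - 1)" by (simp add: power_mult_distrib)
  also have "\<dots> \<le> q ^ (x - 1)" using assms by (intro power_mono) auto
  finally have "x ^ x \<le> q ^ (x - 1)" using assms(1) by (metis One_nat_def Suc_diff_1 less_le_trans mult.commute pos2 power_Suc)
  then have "ln (real x ^ x) \<le> ln (real q ^ (x - 1))"
    using assms by (subst ln_le_cancel_iff) (auto simp flip: of_nat_power)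
  then have *: "real x * ln x \<le> (real x - 1) * Lq"
    using assms by (simp add: ln_realpow Lq_def of_nat_diff)
  have "0 < wt x" using assms by (intro wt_pos) auto
  have "Kq \<le> (real x * wt x) * lq"
    unfolding Kq_def using * lq_pos assms by (intro mult_right_mono) (auto simp: wt_eq algebra_simps)
  also have "\<dots> = wt x * (real x * lq)" by simp
  also have "\<dots> < wt x * wt (q - x)"
    using wt_diff_gr[of x] assms \<open>0 < wt x\<close> by (intro mult_strict_left_mono) auto
  finally show ?thesis .
qed

lemma wt_complementary_gr:
  assumes "2 \<le> x" "2 \<le> y" "x + y = q"
  shows "Kq < wt x * wt y"
proof (cases "x \<le> y")
  case True
  then show ?thesis using wt_complementary_aux[of x] assms by (metis add_diff_cancel_left' add_le_mono le_refl mult_2)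
next
  case False
  then show ?thesis using wt_complementary_aux[of y] assms
    by (metis add_diff_cancel_right' add_le_mono le_refl linear mult.commute mult_2)
qed

lemma wt_complementary_ge:
  assumes "1 \<le> x" "1 \<le> y" "x + y = q"
  shows "Kq \<le> wt x * wt y"
proof -
  consider "x = 1" | "y = 1" | "2 \<le> x" "2 \<le> y" using assms by linarith
  then show ?thesis
  proof cases
    case 1
    then have "y = q - 1" using assms by simp
    then show ?thesis using 1 wt_1 wt_pred by (simp add: Kq_def)
  next
    case 2
    then have "x = q - 1" using assms by simp
    then show ?thesis using 2 wt_1 wt_pred by (simp add: Kq_def)
  next
    case 3
    then show ?thesis using wt_complementary_gr[of x y] assms by simp
  qed
qed

text \<open>The auxiliary number \<open>k\<close> cancels in the product. It splits the inequality
  into one condition on \<open>x\<close> and one on \<open>y\<close>.\<close>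

lemma two_Kq_le:
  assumes "real k * lq \<le> 2 * wt y" "4 * Lq \<le> real k * wt x" "0 \<le> wt x"
  shows "2 * Kq \<le> wt x * wt y"
proof -
  have "4 * Lq * lq \<le> (real k * wt x) * lq" using assms lq_pos by (intro mult_right_mono) auto
  also have "\<dots> = wt x * (real k * lq)" by simp
  also have "\<dots> \<le> wt x * (2 * wt y)" using assms by (intro mult_left_mono)
  finally show ?thesis by (simp add: Kq_def)
qed

text \<open>The exponentiated form of the two conditions: for concrete numbers only rational
  arithmetic remains.\<close>

lemma two_Kq_le_powers:
  assumes "1 \<le> x" "1 \<le> y" "x \<le> q" "(real q / (real q - 1)) ^ k \<le> (real q / real y)\<^sup>2" "real q ^ 4 \<le> (real q / real x) ^ k"
  shows "2 * Kq \<le> wt x * wt y"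
proof (rule two_Kq_le)
  have "ln ((real q / (real q - 1)) ^ k) \<le> ln ((real q / real y)\<^sup>2)"
    using assms q3 by (subst ln_le_cancel_iff) auto
  then show "real k * lq \<le> 2 * wt y" using assms q3 by (simp add: ln_realpow lq_def wt_def)
  have "ln (real q ^ 4) \<le> ln ((real q / real x) ^ k)"
    using assms q3 by (subst ln_le_cancel_iff) auto
  then show "4 * Lq \<le> real k * wt x" using assms q3 by (simp add: ln_realpow Lq_def wt_def)
  show "0 \<le> wt x" using assms by (intro wt_nonneg)
qed

lemma square_le_two_power: "7 \<le> x \<Longrightarrow> x ^ 2 \<le> (2::nat) ^ (x - 1)"
proof (induction x rule: nat_induct_at_least)
  case (Suc n)
  have "Suc n ^ 2 \<le> 2 * n ^ 2"
  proof -
    have "7 * n \<le> n * n" using Suc by simp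
    then show ?thesis using Suc.hyps unfolding power2_eq_square mult_Suc mult_Suc_right by linarith
  qed
  also have "\<dots> \<le> 2 * 2 ^ (n - 1)" using Suc by simp
  also have "\<dots> = 2 ^ (Suc n - 1)" using Suc by (metis Suc_diff_1 diff_Suc_1 less_le_trans power_Suc zero_less_numeral)
  finally show ?case .
qed simp

text \<open>As \<open>y <= q - (x + 1)\<close>, Bernoulli gives \<open>(x + 1) * lq <= wt y\<close>.
  The choice \<open>k = 2 * (x + 1)\<close> then leaves the condition
  \<open>x ^ (x + 1) <= q ^ (x - 1)\<close>. Since \<open>q > 2 * x\<close>, it follows from
  \<open>x ^ 2 <= 2 ^ (x - 1)\<close> when \<open>x >= 7\<close>. For smaller \<open>x\<close> it
  fails for just eight pairs \<open>(x, q)\<close>, and these are checked with an explicit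
  \<open>k\<close> in \<open>exc\<close>.\<close>

lemma wt_noncomplementary_aux:
  assumes "1 \<le> x" "x \<le> y" "x + y < q"
  shows "2 * Kq \<le> wt x * wt y"
proof -
  have y: "y \<le> q - 1 - x" using assms by simp
  have wtx: "0 < wt x" using assms by (intro wt_pos) auto
  have main: ?thesis if "x ^ (x + 1) \<le> q ^ (x - 1)"
  proof (rule two_Kq_le[where k = "2 * (x + 1)"])
    have "real (x + 1) * lq \<le> wt (q - (x + 1))" using assms by (intro wt_diff_ge) simp
    also have "\<dots> \<le> wt y" using assms by (intro wt_antimono) auto
    finally show "real (2 * (x + 1)) * lq \<le> 2 * wt y" by (simp add: algebra_simps)
    have "real x ^ (x + 1) \<le> real q ^ (x - 1)" using that by (metis of_nat_power of_nat_le_iff)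
    then have "ln (real x ^ (x + 1)) \<le> ln (real q ^ (x - 1))"
      using assms by (subst ln_le_cancel_iff) auto
    then have "(real x + 1) * ln x \<le> (real x - 1) * Lq"
      unfolding ln_realpow using assms by (simp add: Lq_def of_nat_diff add.commute)
    then show "4 * Lq \<le> real (2 * (x + 1)) * wt x" using assms by (simp add: wt_eq algebra_simps)
    show "0 \<le> wt x" using wtx by simp
  qed
  have exc: ?thesis if "(real q / (real q - 1)) ^ k \<le> (real q / real (q - 1 - x))\<^sup>2" "real q ^ 4 \<le> (real q / real x) ^ k" for k
  proof -
    have "2 * Kq \<le> wt x * wt (q - 1 - x)" using that assms by (intro two_Kq_le_powers[of _ _ k]) auto
    also have "\<dots> \<le> wt x * wt y" using wtx assms by (intro mult_left_mono wt_antimono) auto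
    finally show ?thesis .
  qed
  consider (1) "x = 1" | (2) "x = 2" | (3) "x = 3" | (4) "x = 4" | (5) "x = 5" | (6) "x = 6" | (7) "7 \<le> x"
    using assms by linarith
  then show ?thesis
  proof cases
    case 1 then show ?thesis by (intro main) simp
  next
    case 2
    have "q = 5 \<or> q = 6 \<or> q = 7 \<or> q \<ge> 8" using assms 2 by presburger
    then show ?thesis
    proof (elim disjE)
      assume "q = 5"
      then show ?thesis using 2 by (intro exc[of 8]) (simp_all add: field_simps)
    next
      assume "q = 6"
      then show ?thesis using 2 by (intro exc[of 7]) (simp_all add: field_simps)
    next
      assume "q = 7"
      then show ?thesis using 2 by (intro exc[of 7]) (simp_all add: field_simps)
    next
      assume "q \<ge> 8"
      then have "8 ^ 1 \<le> q ^ 1" by (intro power_mono) auto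
      then show ?thesis using 2 by (intro main) simp
    qed
  next
    case 3
    have "q = 7 \<or> q = 8 \<or> q \<ge> 9" using assms 3 by presburger
    then show ?thesis
    proof (elim disjE)
      assume "q = 7"
      then show ?thesis using 3 by (intro exc[of 10]) (simp_all add: field_simps)
    next
      assume "q = 8"
      then show ?thesis using 3 by (intro exc[of 10]) (simp_all add: field_simps)
    next
      assume "q \<ge> 9"
      then have "9 ^ 2 \<le> q ^ 2" by (intro power_mono) auto
      then show ?thesis using 3 by (intro main) simp
    qed
  next
    case 4
    have "q = 9 \<or> q = 10 \<or> q \<ge> 11" using assms 4 by presburger
    then show ?thesis
    proof (elim disjE)
      assume "q = 9"
      then show ?thesis using 4 by (intro exc[of 12]) (simp_all add: field_simps)
    next
      assume "q = 10"
      then show ?thesis using 4 by (intro exc[of 12]) (simp_all add: field_simps)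
    next
      assume "q \<ge> 11"
      then have "11 ^ 3 \<le> q ^ 3" by (intro power_mono) auto
      then show ?thesis using 4 by (intro main) simp
    qed
  next
    case 5
    have "q = 11 \<or> q \<ge> 12" using assms 5 by presburger
    then show ?thesis
    proof (elim disjE)
      assume "q = 11"
      then show ?thesis using 5 by (intro exc[of 16]) (simp_all add: field_simps)
    next
      assume "q \<ge> 12"
      then have "12 ^ 4 \<le> q ^ 4" by (intro power_mono) auto
      then show ?thesis using 5 by (intro main) simp
    qed
  next
    case 6
    then have "13 ^ 5 \<le> q ^ 5" using assms by (intro power_mono) auto
    then show ?thesis using 6 by (intro main) simp
  next
    case 7
    have e: "x + 1 = (x - 1) + 2" using 7 by simp
    have "x ^ (x + 1) = x ^ (x - 1) * x ^ 2" by (subst e, rule power_add)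
    also have "\<dots> \<le> x ^ (x - 1) * 2 ^ (x - 1)" using square_le_two_power[OF 7] by simp
    also have "\<dots> = (2 * x) ^ (x - 1)" by (simp add: power_mult_distrib)
    also have "\<dots> \<le> q ^ (x - 1)" using assms by (intro power_mono) auto
    finally show ?thesis by (rule main)
  qed
qed

lemma wt_noncomplementary:
  assumes "1 \<le> x" "1 \<le> y" "x + y < q"
  shows "2 * Kq \<le> wt x * wt y"
  using wt_noncomplementary_aux[of x y] wt_noncomplementary_aux[of y x] assms
  by (cases "x \<le> y") (auto simp: mult.commute add.commute)

text \<open>Finitely many strict inequalities have a common margin. It is used to rule out optimal
  labellings whose two lists both have at least two colors.\<close>

lemma wt_gap:
  obtains \<gamma> where "0 < \<gamma>" "\<And>x y. 2 \<le> x \<Longrightarrow> 2 \<le> y \<Longrightarrow> x + y = q \<Longrightarrow> Kq + \<gamma> \<le> wt x * wt y"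
proof -
  let ?S = "(\<lambda>x. wt x * wt (q - x) - Kq) ` {2..q-2}"
  \<comment> \<open>For \<open>q = 3\<close> the range \<open>{2..q-2}\<close> is empty; the
    \<open>1\<close> keeps the minimum meaningful.\<close>
  let ?\<gamma> = "Min (insert 1 ?S)"
  have "0 < ?\<gamma>"
  proof (subst Min_gr_iff; clarsimp?)
    fix x assume "2 \<le> x" "x \<le> q - 2"
    then show "Kq < wt x * wt (q - x)" using wt_complementary_gr[of x "q - x"] q3 by simp
  qed
  moreover have "Kq + ?\<gamma> \<le> wt x * wt y" if "2 \<le> x" "2 \<le> y" "x + y = q" for x y
  proof -
    have "y = q - x" "x \<in> {2..q-2}" using that by auto
    then have "wt x * wt y - Kq \<in> insert 1 ?S" by blast
    then have "?\<gamma> \<le> wt x * wt y - Kq" by (intro Min_le) auto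
    then show ?thesis by simp
  qed
  ultimately show thesis by (rule that)
qed

text \<open>The empty list never occurs and the full list has weight \<open>0\<close>, so both are left out.\<close>

definition psets :: "nat set set" where
  "psets = {S. S \<subseteq> {..<q} \<and> S \<noteq> {} \<and> S \<noteq> {..<q}}"

abbreviation compl :: "nat set \<Rightarrow> nat set" where "compl S \<equiv> {..<q} - S"

lemma finite_psets [simp]: "finite psets"
  by (rule finite_subset[of _ "Pow {..<q}"]) (auto simp: psets_def)

lemma card_psets: "card psets \<le> 2 ^ q"
proof -
  have "card psets \<le> card (Pow {..<q})" by (rule card_mono) (auto simp: psets_def)
  then show ?thesis by (simp add: card_Pow)
qed

lemma psets_compl: "S \<in> psets \<Longrightarrow> compl S \<in> psets" "S \<in> psets \<Longrightarrow> compl (compl S) = S"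
  by (auto simp: psets_def)

lemma psets_card: "S \<in> psets \<Longrightarrow> 1 \<le> card S \<and> card S < q \<and> card (compl S) = q - card S"
proof -
  assume S: "S \<in> psets"
  then have fin: "finite S" using finite_subset[of S "{..<q}"] by (auto simp: psets_def)
  have "card S < card {..<q}" using S by (intro psubset_card_mono) (auto simp: psets_def)
  moreover have "0 < card S" using S fin by (auto simp: psets_def card_gt_0_iff)
  ultimately show ?thesis using S fin by (auto simp: psets_def card_Diff_subset)
qed

section \<open>Counting vertices by their lists\<close>

definition nlab :: "'a set \<Rightarrow> ('a \<Rightarrow> nat set) \<Rightarrow> nat set \<Rightarrow> real" where
  "nlab V \<Lambda> S = real (card {v \<in> V. \<Lambda> v = S})"

definition ylab :: "'a set \<Rightarrow> ('a \<Rightarrow> nat set) \<Rightarrow> nat set \<Rightarrow> real" where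
  "ylab V \<Lambda> S = nlab V \<Lambda> S * wt (card S)"

definition cost :: "'a set \<Rightarrow> ('a \<Rightarrow> nat set) \<Rightarrow> real" where
  "cost V \<Lambda> = (\<Sum>v\<in>V. wt (card (\<Lambda> v)))"

definition disjoint_pairs :: "'a set \<Rightarrow> ('a \<Rightarrow> nat set) \<Rightarrow> ('a \<times> 'a) set" where
  "disjoint_pairs V \<Lambda> = {(u, v). u \<in> V \<and> v \<in> V \<and> \<Lambda> u \<inter> \<Lambda> v = {}}"

lemma nlab_nonneg: "0 \<le> nlab V \<Lambda> S" by (simp add: nlab_def)

lemma ylab_nonneg: "S \<in> psets \<Longrightarrow> 0 \<le> ylab V \<Lambda> S"
  using psets_card[of S] wt_pos[of "card S"] by (simp add: ylab_def nlab_nonneg)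

text \<open>The full list meets every nonempty list, so vertices with full lists occur in no
  disjoint pair and \<open>psets\<close> suffices.\<close>

lemma card_disjoint_pairs:
  assumes "finite V" "\<And>v. v \<in> V \<Longrightarrow> \<Lambda> v \<subseteq> {..<q} \<and> \<Lambda> v \<noteq> {}"
  shows "real (card (disjoint_pairs V \<Lambda>)) =
    (\<Sum>S\<in>psets. \<Sum>T\<in>psets. if S \<inter> T = {} then nlab V \<Lambda> S * nlab V \<Lambda> T else 0)"
proof -
  let ?I = "{(S, T). S \<in> psets \<and> T \<in> psets \<and> S \<inter> T = {}}"
  let ?P = "\<lambda>(S, T). {u \<in> V. \<Lambda> u = S} \<times> {v \<in> V. \<Lambda> v = T}"
  have finI: "finite ?I" by (rule finite_subset[of _ "psets \<times> psets"]) auto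
  have "disjoint_pairs V \<Lambda> = (\<Union>p\<in>?I. ?P p)"
  proof (intro set_eqI iffI)
    fix p assume "p \<in> disjoint_pairs V \<Lambda>"
    then obtain u v where p: "p = (u, v)" "u \<in> V" "v \<in> V" "\<Lambda> u \<inter> \<Lambda> v = {}" by (auto simp: disjoint_pairs_def)
    then have "\<Lambda> u \<in> psets" "\<Lambda> v \<in> psets" using assms(2)[of u] assms(2)[of v] by (auto simp: psets_def)
    with p show "p \<in> (\<Union>p\<in>?I. ?P p)" by auto
  qed (auto simp: disjoint_pairs_def)
  moreover have "card (\<Union>p\<in>?I. ?P p) = (\<Sum>p\<in>?I. card (?P p))"
    using assms(1) finI by (intro card_UN_disjoint) auto
  ultimately have "real (card (disjoint_pairs V \<Lambda>)) = (\<Sum>p\<in>?I. nlab V \<Lambda> (fst p) * nlab V \<Lambda> (snd p))"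
    by (simp add: case_prod_unfold card_cartesian_product nlab_def)
  also have "\<dots> = (\<Sum>p\<in>psets\<times>psets. if fst p \<inter> snd p = {} then nlab V \<Lambda> (fst p) * nlab V \<Lambda> (snd p) else 0)"
    by (rule sum.mono_neutral_cong_left) auto
  also have "\<dots> = (\<Sum>S\<in>psets. \<Sum>T\<in>psets. if S \<inter> T = {} then nlab V \<Lambda> S * nlab V \<Lambda> T else 0)"
    by (simp add: sum.cartesian_product case_prod_unfold)
  finally show ?thesis .
qed

lemma cost_eq:
  assumes "finite V" "\<And>v. v \<in> V \<Longrightarrow> \<Lambda> v \<subseteq> {..<q} \<and> \<Lambda> v \<noteq> {}"
  shows "cost V \<Lambda> = (\<Sum>S\<in>psets. ylab V \<Lambda> S)"
proof -
  have "cost V \<Lambda> = (\<Sum>S\<in>insert {..<q} psets. \<Sum>v\<in>{v \<in> V. \<Lambda> v = S}. wt (card (\<Lambda> v)))"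
    unfolding cost_def using assms by (intro sum.group[symmetric]) (auto simp: psets_def)
  also have "\<dots> = (\<Sum>S\<in>insert {..<q} psets. ylab V \<Lambda> S)"
    by (intro sum.cong refl) (simp add: ylab_def nlab_def)
  also have "\<dots> = (\<Sum>S\<in>psets. ylab V \<Lambda> S)"
    by (subst sum.insert) (auto simp: ylab_def wt_q psets_def)
  finally show ?thesis .
qed

text \<open>The square of the cost minus \<open>2 * Kq\<close> times the number of disjoint pairs is bounded below by
  a sum of nonnegative terms, all of which vanish only for an essentially unique labelling.\<close>

lemma cost_squared_slack:
  assumes V: "finite V" "\<And>v. v \<in> V \<Longrightarrow> \<Lambda> v \<subseteq> {..<q} \<and> \<Lambda> v \<noteq> {}"
  defines "y \<equiv> ylab V \<Lambda>" and "n \<equiv> nlab V \<Lambda>"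
  shows "(\<Sum>S\<in>psets. (y S - y (compl S))\<^sup>2) / 2
      + (\<Sum>S\<in>psets. \<Sum>T\<in>psets. if S \<inter> T \<noteq> {} \<and> S \<noteq> T then y S * y T else 0)
      + (\<Sum>S\<in>psets. 2 * (wt (card S) * wt (card (compl S)) - Kq) * (n S * n (compl S)))
      \<le> (cost V \<Lambda>)\<^sup>2 - 2 * Kq * card (disjoint_pairs V \<Lambda>)"
proof -
  have n0: "0 \<le> n S" for S by (simp add: n_def nlab_nonneg)
  have ycompl: "(\<Sum>S\<in>psets. (y (compl S))\<^sup>2) = (\<Sum>S\<in>psets. (y S)\<^sup>2)"
    by (rule sum.reindex_bij_witness[of _ compl compl]) (auto simp: psets_compl)
  have diag: "(\<Sum>S\<in>psets. (y S - y (compl S))\<^sup>2) / 2 = (\<Sum>S\<in>psets. (y S)\<^sup>2) - (\<Sum>S\<in>psets. y S * y (compl S))"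
    using ycompl by (simp add: power2_diff sum.distrib sum_subtractf sum_distrib_left[symmetric] mult.assoc)
  have e1: "(\<Sum>S\<in>psets. (y S)\<^sup>2) = (\<Sum>S\<in>psets. \<Sum>T\<in>psets. if T = S then y S * y T else 0)"
    by (simp add: power2_eq_square)
  have e2: "(\<Sum>S\<in>psets. y S * y (compl S)) = (\<Sum>S\<in>psets. \<Sum>T\<in>psets. if T = compl S then y S * y T else 0)"
    by (intro sum.cong refl) (simp add: psets_compl)
  have e3: "(\<Sum>S\<in>psets. 2 * (wt (card S) * wt (card (compl S)) - Kq) * (n S * n (compl S)))
    = (\<Sum>S\<in>psets. \<Sum>T\<in>psets. if T = compl S then 2 * (wt (card S) * wt (card T) - Kq) * (n S * n T) else 0)"
    by (intro sum.cong refl) (simp add: psets_compl)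
  have W: "(cost V \<Lambda>)\<^sup>2 = (\<Sum>S\<in>psets. \<Sum>T\<in>psets. y S * y T)"
    by (simp add: cost_eq[of V \<Lambda>, OF V] y_def power2_eq_square sum_product)
  have D: "2 * Kq * card (disjoint_pairs V \<Lambda>)
    = (\<Sum>S\<in>psets. \<Sum>T\<in>psets. if S \<inter> T = {} then 2 * Kq * (n S * n T) else 0)"
  proof -
    have "real (card (disjoint_pairs V \<Lambda>)) = (\<Sum>S\<in>psets. \<Sum>T\<in>psets. if S \<inter> T = {} then n S * n T else 0)"
      unfolding n_def by (rule card_disjoint_pairs) (use V in auto)
    then have "2 * Kq * card (disjoint_pairs V \<Lambda>) = (\<Sum>S\<in>psets. \<Sum>T\<in>psets. 2 * Kq * (if S \<inter> T = {} then n S * n T else 0))"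
      by (simp add: sum_distrib_left)
    also have "\<dots> = (\<Sum>S\<in>psets. \<Sum>T\<in>psets. if S \<inter> T = {} then 2 * Kq * (n S * n T) else 0)"
      by (intro sum.cong refl) auto
    finally show ?thesis .
  qed
  \<comment> \<open>After rewriting everything as a double sum the inequality holds for each pair
    \<open>(S, T)\<close> separately. It is an equality unless \<open>S\<close> and \<open>T\<close>
    are disjoint but not complementary, and in that case it is
    \<open>wt_noncomplementary\<close>.\<close>
  have "(\<Sum>S\<in>psets. \<Sum>T\<in>psets. (if T = S then y S * y T else 0) - (if T = compl S then y S * y T else 0)
      + (if S \<inter> T \<noteq> {} \<and> S \<noteq> T then y S * y T else 0)
      + (if T = compl S then 2 * (wt (card S) * wt (card T) - Kq) * (n S * n T) else 0)
      + (if S \<inter> T = {} then 2 * Kq * (n S * n T) else 0))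
    \<le> (\<Sum>S\<in>psets. \<Sum>T\<in>psets. y S * y T)"
  proof (intro sum_mono)
    fix S T assume ST: "S \<in> psets" "T \<in> psets"
    have yy: "y S * y T = wt (card S) * wt (card T) * (n S * n T)"
      by (simp add: y_def n_def ylab_def)
    consider "T = S" | "T = compl S" | "S \<inter> T \<noteq> {}" "T \<noteq> S" "T \<noteq> compl S" | "S \<inter> T = {}" "T \<noteq> S" "T \<noteq> compl S"
      by blast
    then show "(if T = S then y S * y T else 0) - (if T = compl S then y S * y T else 0)
      + (if S \<inter> T \<noteq> {} \<and> S \<noteq> T then y S * y T else 0)
      + (if T = compl S then 2 * (wt (card S) * wt (card T) - Kq) * (n S * n T) else 0)
      + (if S \<inter> T = {} then 2 * Kq * (n S * n T) else 0) \<le> y S * y T"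
    proof cases
      case 1
      then have "S \<inter> T \<noteq> {}" "T \<noteq> compl S" using ST by (auto simp: psets_def)
      with 1 show ?thesis by simp
    next
      case 2
      then have "S \<inter> T = {}" "T \<noteq> S" using ST by (auto simp: psets_def)
      with 2 show ?thesis by (simp add: y_def n_def ylab_def algebra_simps)
    next
      case 3
      then show ?thesis by simp
    next
      case 4
      have fin: "finite S" "finite T" using ST finite_subset[of _ "{..<q}"] by (auto simp: psets_def)
      have "S \<union> T \<subset> {..<q}" using 4 ST by (auto simp: psets_def)
      then have "card (S \<union> T) < q" using psubset_card_mono[of "{..<q}" "S \<union> T"] by simp
      then have "card S + card T < q" using card_Un_disjoint[OF fin] 4 by simp
      then have "2 * Kq \<le> wt (card S) * wt (card T)"
        using psets_card ST by (intro wt_noncomplementary) auto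
      then have "2 * Kq * (n S * n T) \<le> y S * y T"
        unfolding yy by (intro mult_right_mono) (auto simp: n0)
      with 4 show ?thesis by auto
    qed
  qed
  then show ?thesis
    unfolding W D diag e1 e2 e3 by (simp add: sum.distrib sum_subtractf)
qed

lemma compl_gap_nonneg:
  assumes "S \<in> psets"
  shows "0 \<le> wt (card S) * wt (card (compl S)) - Kq"
  using wt_complementary_ge[of "card S" "card (compl S)"] psets_card[OF assms] by auto

lemma cost_squared_ge:
  assumes V: "finite V" "\<And>v. v \<in> V \<Longrightarrow> \<Lambda> v \<subseteq> {..<q} \<and> \<Lambda> v \<noteq> {}"
  shows "2 * Kq * card (disjoint_pairs V \<Lambda>) \<le> (cost V \<Lambda>)\<^sup>2"
proof -
  have "0 \<le> (\<Sum>S\<in>psets. (ylab V \<Lambda> S - ylab V \<Lambda> (compl S))\<^sup>2) / 2" by (simp add: sum_nonneg)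
  moreover have "0 \<le> (\<Sum>S\<in>psets. \<Sum>T\<in>psets. if S \<inter> T \<noteq> {} \<and> S \<noteq> T then ylab V \<Lambda> S * ylab V \<Lambda> T else 0)"
    by (intro sum_nonneg) (simp add: ylab_nonneg)
  moreover have "0 \<le> (\<Sum>S\<in>psets. 2 * (wt (card S) * wt (card (compl S)) - Kq) * (nlab V \<Lambda> S * nlab V \<Lambda> (compl S)))"
    by (intro sum_nonneg mult_nonneg_nonneg compl_gap_nonneg) (auto simp: nlab_nonneg)
  ultimately show ?thesis using cost_squared_slack[of V \<Lambda>, OF V] by linarith
qed

lemma cost_nonneg:
  assumes V: "finite V" "\<And>v. v \<in> V \<Longrightarrow> \<Lambda> v \<subseteq> {..<q} \<and> \<Lambda> v \<noteq> {}"
  shows "0 \<le> cost V \<Lambda>"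
  by (simp add: cost_eq[of V \<Lambda>, OF V] sum_nonneg ylab_nonneg)

lemma card_PiE_eq_exp_cost:
  assumes V: "finite V" "\<And>v. v \<in> V \<Longrightarrow> \<Lambda> v \<subseteq> {..<q} \<and> \<Lambda> v \<noteq> {}"
  shows "real (card (Pi\<^sub>E V \<Lambda>)) = real q ^ card V * exp (- cost V \<Lambda>)"
proof -
  have c: "0 < card (\<Lambda> v)" if "v \<in> V" for v
    using V(2)[OF that] finite_subset[of "\<Lambda> v" "{..<q}"] by (auto simp: card_gt_0_iff)
  have "exp (- cost V \<Lambda>) = (\<Prod>v\<in>V. exp (- wt (card (\<Lambda> v))))"
    using V(1) by (simp add: cost_def exp_sum sum_negf[symmetric])
  also have "\<dots> = (\<Prod>v\<in>V. real (card (\<Lambda> v)) / q)"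
    using c q3 by (intro prod.cong refl) (simp add: wt_def exp_minus)
  finally show ?thesis using V(1) q3 by (simp add: card_PiE prod_dividef)
qed

text \<open>Near equality makes all three slack sums tiny. Take a list \<open>S\<close> of largest
  total weight. The first sum forces its complement to have nearly the same weight. Every other list
  meets one of these two, so the second sum makes it light. The third sum and \<open>wt_gap\<close>
  force \<open>S\<close> or its complement to be a single color.\<close>

lemma labelling_stability:
  fixes \<epsilon> :: real
  assumes "0 < \<epsilon>"
  shows "\<exists>e::real>0. \<forall>V (\<Lambda> :: 'a \<Rightarrow> nat set) (s::real). finite V \<and> (\<forall>v\<in>V. \<Lambda> v \<subseteq> {..<q} \<and> \<Lambda> v \<noteq> {}) \<and> 0 < s \<and>
     cost V \<Lambda> \<le> (cq + e) * s \<and> 2 * (1 - e) * s\<^sup>2 \<le> real (card (disjoint_pairs V \<Lambda>)) \<longrightarrow>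
    (\<exists>i<q. \<bar>real (card {v\<in>V. \<Lambda> v = {i}}) - sa * s\<bar> \<le> \<epsilon> * s \<and>
      \<bar>real (card {v\<in>V. \<Lambda> v = {..<q} - {i}}) - sb * s\<bar> \<le> \<epsilon> * s \<and>
      real (card {v\<in>V. \<Lambda> v \<notin> {{i}, {..<q} - {i}, {..<q}}}) \<le> \<epsilon> * s)"
proof -
  obtain \<gamma> where \<gamma>: "0 < \<gamma>" "\<And>x y. 2 \<le> x \<Longrightarrow> 2 \<le> y \<Longrightarrow> x + y = q \<Longrightarrow> Kq + \<gamma> \<le> wt x * wt y"
    using wt_gap by blast
  \<comment> \<open>The total weight will be at least \<open>cq * s / 2\<close>, so the heaviest of
    at most \<open>2 ^ q\<close> lists carries at least \<open>2 * \<tau> * s\<close>.\<close>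
  define \<tau> where "\<tau> = cq / 2 ^ (q + 2)"
  have \<tau>: "0 < \<tau>" using cq_pos by (simp add: \<tau>_def)
  define \<eta> where "\<eta> = (\<lambda>e::real. 2 * cq * e + e\<^sup>2 + cq\<^sup>2 * e)"
  \<comment> \<open>\<open>F\<close> collects all errors in the two heavy weights. Weights become
    vertex counts on division by at least \<open>lq\<close>, hence the later condition
    \<open>F e < \<epsilon> * lq\<close>.\<close>
  define F where "F = (\<lambda>e. (cq + 1) * e + 2 ^ q * \<eta> e / \<tau> + sqrt (\<eta> e))"
  have l1: "((\<lambda>e. sqrt (\<eta> e)) \<longlongrightarrow> 0) (at_right 0)"
    unfolding \<eta>_def by (auto intro!: tendsto_eq_intros)
  have l2: "(\<eta> \<longlongrightarrow> 0) (at_right 0)"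
    unfolding \<eta>_def by (auto intro!: tendsto_eq_intros)
  have l3: "(F \<longlongrightarrow> 0) (at_right 0)"
    unfolding F_def \<eta>_def using \<tau> by (auto intro!: tendsto_eq_intros)
  have "eventually (\<lambda>e. sqrt (\<eta> e) < \<tau> \<and> \<eta> e < 2 * \<gamma> * (\<tau> / Lq)\<^sup>2 \<and> F e < \<epsilon> * lq \<and> 0 < e \<and> e < 1/2) (at_right 0)"
    using assms \<gamma>(1) \<tau> Lq_pos lq_pos
    by (intro eventually_conj order_tendstoD(2)[OF l1] order_tendstoD(2)[OF l2] order_tendstoD(2)[OF l3])
       (auto simp: eventually_at_right_less intro: eventually_at_rightI[of 0 "1/2"])
  then obtain e where e: "sqrt (\<eta> e) < \<tau>" "\<eta> e < 2 * \<gamma> * (\<tau> / Lq)\<^sup>2" "F e < \<epsilon> * lq" "0 < e" "e < 1/2"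
    using eventually_happens' trivial_limit_at_right_real by blast
  have \<eta>0: "0 \<le> \<eta> e" using e cq_pos by (simp add: \<eta>_def)
  show ?thesis
  proof (intro exI[of _ e] conjI allI impI e(4))
    fix V :: "'a set" and \<Lambda> :: "'a \<Rightarrow> nat set" and s :: real
    assume "finite V \<and> (\<forall>v\<in>V. \<Lambda> v \<subseteq> {..<q} \<and> \<Lambda> v \<noteq> {}) \<and> 0 < s \<and>
     cost V \<Lambda> \<le> (cq + e) * s \<and> 2 * (1 - e) * s\<^sup>2 \<le> real (card (disjoint_pairs V \<Lambda>))"
    then have V: "finite V" and L: "\<And>v. v \<in> V \<Longrightarrow> \<Lambda> v \<subseteq> {..<q} \<and> \<Lambda> v \<noteq> {}" and s: "0 < s"
      and Wle: "cost V \<Lambda> \<le> (cq + e) * s" and D: "2 * (1 - e) * s\<^sup>2 \<le> real (card (disjoint_pairs V \<Lambda>))" by auto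
    define y where "y = ylab V \<Lambda>"
    define n where "n = nlab V \<Lambda>"
    define W where "W = cost V \<Lambda>"
    have y0: "0 \<le> y S" if "S \<in> psets" for S using ylab_nonneg[OF that] by (simp add: y_def)
    have n0: "0 \<le> n S" for S by (simp add: n_def nlab_nonneg)
    have W0: "0 \<le> W" unfolding W_def using V L by (rule cost_nonneg)
    have Wsum: "W = (\<Sum>S\<in>psets. y S)" unfolding W_def y_def using V L by (rule cost_eq)
    have KD: "cq\<^sup>2 * (1 - e) * s\<^sup>2 \<le> 2 * Kq * card (disjoint_pairs V \<Lambda>)"
    proof -
      have "cq\<^sup>2 * (1 - e) * s\<^sup>2 = 2 * Kq * (2 * (1 - e) * s\<^sup>2)" using cq_squared by (simp add: power2_eq_square)
      also have "\<dots> \<le> 2 * Kq * card (disjoint_pairs V \<Lambda>)" using D Kq_pos by (intro mult_left_mono) auto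
      finally show ?thesis .
    qed
    have slack: "(\<Sum>S\<in>psets. (y S - y (compl S))\<^sup>2) / 2
      + (\<Sum>S\<in>psets. \<Sum>T\<in>psets. if S \<inter> T \<noteq> {} \<and> S \<noteq> T then y S * y T else 0)
      + (\<Sum>S\<in>psets. 2 * (wt (card S) * wt (card (compl S)) - Kq) * (n S * n (compl S)))
      \<le> \<eta> e * s\<^sup>2"
    proof -
      have "W\<^sup>2 \<le> ((cq + e) * s)\<^sup>2" using Wle W0 unfolding W_def by (rule power_mono)
      then have "W\<^sup>2 - 2 * Kq * card (disjoint_pairs V \<Lambda>) \<le> ((cq + e) * s)\<^sup>2 - cq\<^sup>2 * (1 - e) * s\<^sup>2"
        using KD by linarith
      also have "\<dots> = \<eta> e * s\<^sup>2" by (simp add: \<eta>_def power2_eq_square algebra_simps)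
      finally show ?thesis
        using cost_squared_slack[of V \<Lambda>, OF V L] unfolding y_def n_def W_def by linarith
    qed
    have t1: "0 \<le> (\<Sum>S\<in>psets. (y S - y (compl S))\<^sup>2) / 2" by (simp add: sum_nonneg)
    have t2: "0 \<le> (\<Sum>S\<in>psets. \<Sum>T\<in>psets. if S \<inter> T \<noteq> {} \<and> S \<noteq> T then y S * y T else 0)"
      by (intro sum_nonneg) (simp add: y0)
    have t3: "0 \<le> (\<Sum>S\<in>psets. 2 * (wt (card S) * wt (card (compl S)) - Kq) * (n S * n (compl S)))"
      by (intro sum_nonneg mult_nonneg_nonneg compl_gap_nonneg) (auto simp: n0)
    have Wge: "cq * (1 - e) * s \<le> W"
    proof (rule power2_le_imp_le[OF _ W0])
      have "(cq * (1 - e) * s)\<^sup>2 = (1 - e) * (cq\<^sup>2 * (1 - e) * s\<^sup>2)" by (simp add: power2_eq_square)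
      also have "\<dots> \<le> 1 * (cq\<^sup>2 * (1 - e) * s\<^sup>2)" using e by (intro mult_right_mono) auto
      also have "\<dots> \<le> W\<^sup>2" using KD cost_squared_ge[of V \<Lambda>, OF V L] unfolding W_def by linarith
      finally show "(cq * (1 - e) * s)\<^sup>2 \<le> W\<^sup>2" .
    qed
    have "psets \<noteq> {}"
    proof -
      have "1 \<in> {..<q} - {0}" using q3 by simp
      then have "{0} \<noteq> {..<q}" by blast
      then have "{0} \<in> psets" using q3 by (simp add: psets_def)
      then show ?thesis by blast
    qed
    obtain S where S: "S \<in> psets" "\<And>T. T \<in> psets \<Longrightarrow> y T \<le> y S"
    proof -
      have "Max (y ` psets) \<in> y ` psets" using \<open>psets \<noteq> {}\<close> by (intro Max_in) auto
      then obtain S where "S \<in> psets" "y S = Max (y ` psets)" by auto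
      then show thesis using that[of S] by simp
    qed
    have yS: "2 * \<tau> * s \<le> y S"
    proof -
      have "W \<le> (\<Sum>T\<in>psets. y S)" unfolding Wsum using S(2) by (rule sum_mono)
      also have "\<dots> = card psets * y S" by simp
      also have "\<dots> \<le> 2 ^ q * y S" using card_psets y0[OF S(1)] by (intro mult_right_mono) (auto simp flip: of_nat_power)
      finally have "W \<le> 2 ^ q * y S" .
      moreover have "cq * (1/2) * s \<le> cq * (1 - e) * s" using e cq_pos s by (intro mult_right_mono mult_left_mono) auto
      ultimately have "cq * (1/2) * s \<le> 2 ^ q * y S" using Wge by linarith
      then show ?thesis by (simp add: \<tau>_def field_simps power_add)
    qed
    have S': "compl S \<in> psets" using S psets_compl by blast
    have neq: "compl S \<noteq> S" using S(1) by (auto simp: psets_def)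
    have dS: "\<bar>y S - y (compl S)\<bar> \<le> sqrt (\<eta> e) * s"
    proof -
      have "(\<Sum>T\<in>{S, compl S}. (y T - y (compl T))\<^sup>2) \<le> (\<Sum>T\<in>psets. (y T - y (compl T))\<^sup>2)"
        using S S' by (intro sum_mono2) auto
      moreover have "(\<Sum>T\<in>{S, compl S}. (y T - y (compl T))\<^sup>2) = 2 * (y S - y (compl S))\<^sup>2"
        using neq psets_compl(2)[OF S(1)] by (simp add: power2_commute)
      ultimately have "(y S - y (compl S))\<^sup>2 \<le> \<eta> e * s\<^sup>2" using slack t2 t3 by linarith
      then have "sqrt ((y S - y (compl S))\<^sup>2) \<le> sqrt (\<eta> e * s\<^sup>2)" by (rule real_sqrt_le_mono)
      then show ?thesis using s by (simp add: real_sqrt_mult)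
    qed
    have ycS: "\<tau> * s \<le> y (compl S)"
    proof -
      have "sqrt (\<eta> e) * s \<le> \<tau> * s" using e s by (intro mult_right_mono) auto
      then show ?thesis using dS yS by linarith
    qed
    have yT: "y T \<le> \<eta> e * s / \<tau>" if T: "T \<in> psets - {S, compl S}" for T
    proof -
      \<comment> \<open>The color \<open>x\<close> lies in \<open>S\<close> or in its complement.
        Both are heavy, so one summand of the second slack sum bounds \<open>y T\<close>.\<close>
      obtain x where x: "x \<in> T" "x < q" using T by (auto simp: psets_def)
      obtain S0 where S0: "S0 \<in> {S, compl S}" "S0 \<inter> T \<noteq> {}"
      proof (cases "x \<in> S")
        case True then show thesis using x by (intro that[of S]) auto
      next
        case False then show thesis using x by (intro that[of "compl S"]) auto
      qed
      have "\<tau> * s \<le> 2 * \<tau> * s" using \<tau> s by simp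
      then have yS0: "\<tau> * s \<le> y S0" using S0(1) yS ycS by fastforce
      have "y S0 * y T = (if S0 \<inter> T \<noteq> {} \<and> S0 \<noteq> T then y S0 * y T else 0)" using S0 T by auto
      also have "\<dots> \<le> (\<Sum>T\<in>psets. if S0 \<inter> T \<noteq> {} \<and> S0 \<noteq> T then y S0 * y T else 0)"
        using T S0 S S' y0 by (intro member_le_sum[where f = "\<lambda>T. if S0 \<inter> T \<noteq> {} \<and> S0 \<noteq> T then y S0 * y T else 0"]) auto
      also have "\<dots> \<le> (\<Sum>S\<in>psets. \<Sum>T\<in>psets. if S \<inter> T \<noteq> {} \<and> S \<noteq> T then y S * y T else 0)"
        using S0 S S' y0 by (intro member_le_sum[where f = "\<lambda>S. \<Sum>T\<in>psets. if S \<inter> T \<noteq> {} \<and> S \<noteq> T then y S * y T else 0"] sum_nonneg) auto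
      also have "\<dots> \<le> \<eta> e * s\<^sup>2" using slack t1 t3 by linarith
      finally have "y S0 * y T \<le> \<eta> e * s\<^sup>2" .
      moreover have "\<tau> * s * y T \<le> y S0 * y T" using yS0 y0 T by (intro mult_right_mono) auto
      ultimately have "s * (\<tau> * y T) \<le> s * (\<eta> e * s)" by (simp add: power2_eq_square algebra_simps)
      then have "\<tau> * y T \<le> \<eta> e * s" using s by simp
      then show ?thesis using \<tau> by (simp add: field_simps)
    qed
    define rest where "rest = (\<Sum>T\<in>psets - {S, compl S}. y T)"
    have rest: "rest \<le> 2 ^ q * \<eta> e / \<tau> * s"
    proof -
      have "rest \<le> (\<Sum>T\<in>psets - {S, compl S}. \<eta> e * s / \<tau>)" unfolding rest_def using yT by (rule sum_mono)
      also have "\<dots> = card (psets - {S, compl S}) * (\<eta> e * s / \<tau>)" by simp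
      also have "\<dots> \<le> 2 ^ q * (\<eta> e * s / \<tau>)"
      proof (intro mult_right_mono)
        have "card (psets - {S, compl S}) \<le> 2 ^ q" using card_psets card_mono[of psets "psets - {S, compl S}"] by fastforce
        then show "real (card (psets - {S, compl S})) \<le> 2 ^ q" by (metis of_nat_le_iff of_nat_numeral of_nat_power)
        show "0 \<le> \<eta> e * s / \<tau>" using \<eta>0 s \<tau> by simp
      qed
      finally show ?thesis by simp
    qed
    have rest0: "0 \<le> rest" unfolding rest_def using y0 by (intro sum_nonneg) auto
    have Wsplit: "W = y S + y (compl S) + rest"
    proof -
      have "W = y S + (\<Sum>T\<in>psets - {S}. y T)" unfolding Wsum using S(1) by (intro sum.remove) auto
      also have "(\<Sum>T\<in>psets - {S}. y T) = y (compl S) + (\<Sum>T\<in>psets - {S} - {compl S}. y T)"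
        using S' neq by (intro sum.remove) auto
      also have "psets - {S} - {compl S} = psets - {S, compl S}" by blast
      finally show ?thesis by (simp add: rest_def)
    qed
    define G where "G = F e * s"
    have G: "G = cq * e * s + e * s + 2 ^ q * \<eta> e / \<tau> * s + sqrt (\<eta> e) * s"
      by (simp add: G_def F_def algebra_simps)
    have pos: "0 \<le> cq * e * s" "0 \<le> e * s" "0 \<le> 2 ^ q * \<eta> e / \<tau> * s" "0 \<le> sqrt (\<eta> e) * s"
      using cq_pos e s \<tau> \<eta>0 by auto
    have b: "W \<le> cq * s + e * s" "cq * s - cq * e * s \<le> W" using Wle Wge by (auto simp: W_def algebra_simps)
    have yS_close: "\<bar>y S - cq / 2 * s\<bar> \<le> G" and ycS_close: "\<bar>y (compl S) - cq / 2 * s\<bar> \<le> G"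
      using b dS rest rest0 Wsplit pos unfolding G abs_le_iff by linarith+
    have G\<epsilon>: "G \<le> \<epsilon> * lq * s" unfolding G_def using e s by (intro mult_right_mono) auto
    \<comment> \<open>Otherwise, by \<open>wt_gap\<close>, the summand of \<open>S\<close> in the
      third slack sum alone would exceed the whole slack.\<close>
    have "card S = 1 \<or> card (compl S) = 1"
    proof (rule ccontr)
      assume "\<not> ?thesis"
      then have c2: "2 \<le> card S" "2 \<le> card (compl S)" "card S + card (compl S) = q"
        using psets_card[OF S(1)] psets_card[OF S'] by auto
      have nS: "\<tau> / Lq * s \<le> n T" if "T \<in> {S, compl S}" for T
      proof -
        have T: "T \<in> psets" using that S S' by auto
        have "\<tau> * s \<le> 2 * \<tau> * s" using \<tau> s by simp
        then have "\<tau> * s \<le> y T" using that yS ycS by fastforce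
        also have "y T \<le> n T * Lq" unfolding y_def ylab_def n_def
          using psets_card[OF T] by (intro mult_left_mono wt_le_Lq) (auto simp: nlab_nonneg)
        finally show ?thesis using Lq_pos by (simp add: field_simps)
      qed
      have nn: "\<tau> / Lq * s * (\<tau> / Lq * s) \<le> n S * n (compl S)"
        using \<tau> s Lq_pos n0 by (intro mult_mono nS) auto
      have gg: "2 * \<gamma> \<le> 2 * (wt (card S) * wt (card (compl S)) - Kq)" using \<gamma>(2)[OF c2] by simp
      have "2 * \<gamma> * (\<tau> / Lq * s * (\<tau> / Lq * s)) \<le> 2 * (wt (card S) * wt (card (compl S)) - Kq) * (n S * n (compl S))"
        by (rule mult_mono[OF gg nn]) (use \<gamma>(1) gg \<tau> s Lq_pos in auto)
      also have "\<dots> \<le> (\<Sum>S\<in>psets. 2 * (wt (card S) * wt (card (compl S)) - Kq) * (n S * n (compl S)))"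
        using S(1) compl_gap_nonneg n0
        by (intro member_le_sum[where f = "\<lambda>S. 2 * (wt (card S) * wt (card (compl S)) - Kq) * (n S * n (compl S))"] mult_nonneg_nonneg) auto
      also have "\<dots> \<le> \<eta> e * s\<^sup>2" using slack t1 t2 by linarith
      finally have "2 * \<gamma> * (\<tau> / Lq)\<^sup>2 * s\<^sup>2 \<le> \<eta> e * s\<^sup>2" by (simp add: power2_eq_square algebra_simps)
      then have "2 * \<gamma> * (\<tau> / Lq)\<^sup>2 \<le> \<eta> e" using s by simp
      then show False using e by simp
    qed
    then obtain S1 i where S1: "S1 \<in> {S, compl S}" "S1 = {i}" by (auto simp: card_1_singleton_iff)
    have "S1 \<in> psets" using S1 S S' by auto
    then have i: "i < q" using S1 by (auto simp: psets_def)
    have cc: "{S1, compl S1} = {S, compl S}" using S1(1) psets_compl(2)[OF S(1)] by auto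
    have y1: "\<bar>y {i} - cq / 2 * s\<bar> \<le> G" and y2: "\<bar>y (compl {i}) - cq / 2 * s\<bar> \<le> G"
    proof -
      have "\<bar>y T - cq / 2 * s\<bar> \<le> G" if "T \<in> {S1, compl S1}" for T
        using that yS_close ycS_close unfolding cc by auto
      then show "\<bar>y {i} - cq / 2 * s\<bar> \<le> G" "\<bar>y (compl {i}) - cq / 2 * s\<bar> \<le> G" using S1 by auto
    qed
    have div_close: "\<bar>x - z * s\<bar> \<le> \<epsilon> * s" if "\<bar>x * k - cq / 2 * s\<bar> \<le> G" "k * z = cq / 2" "lq \<le> k" for x z k
    proof -
      have k: "0 < k" using that lq_pos by simp
      have "k * \<bar>x - z * s\<bar> = \<bar>x * k - cq / 2 * s\<bar>"
      proof -
        have "x * k - cq / 2 * s = k * (x - z * s)" unfolding that(2)[symmetric] by (simp add: algebra_simps)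
        then show ?thesis using k by (simp add: abs_mult)
      qed
      also have "\<dots> \<le> \<epsilon> * lq * s" using that(1) G\<epsilon> by simp
      also have "\<dots> = lq * (\<epsilon> * s)" by simp
      also have "\<dots> \<le> k * (\<epsilon> * s)" using that(3) assms s by (intro mult_right_mono) auto
      finally show ?thesis using k by simp
    qed
    have A: "\<bar>real (card {v\<in>V. \<Lambda> v = {i}}) - sa * s\<bar> \<le> \<epsilon> * s"
      using y1 wt_1 sa_Lq lq_less_Lq by (intro div_close[of _ Lq]) (auto simp: y_def ylab_def nlab_def)
    have B: "\<bar>real (card {v\<in>V. \<Lambda> v = compl {i}}) - sb * s\<bar> \<le> \<epsilon> * s"
      using y2 wt_pred sb_lq i by (intro div_close[of _ lq]) (auto simp: y_def ylab_def nlab_def)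
    have C: "real (card {v\<in>V. \<Lambda> v \<notin> {{i}, compl {i}, {..<q}}}) \<le> \<epsilon> * s"
    proof -
      define R where "R = {v\<in>V. \<Lambda> v \<notin> {{i}, compl {i}, {..<q}}}"
      define I where "I = psets - {S, compl S}"
      have I: "finite I" by (simp add: I_def)
      have "R \<subseteq> (\<Union>T\<in>I. {v \<in> V. \<Lambda> v = T})"
      proof
        fix v assume v: "v \<in> R"
        then have "\<Lambda> v \<in> psets" "\<Lambda> v \<notin> {S1, compl S1}" using L S1(2) by (auto simp: psets_def R_def)
        then show "v \<in> (\<Union>T\<in>I. {v \<in> V. \<Lambda> v = T})" using v unfolding cc by (simp add: R_def I_def)
      qed
      then have "card R \<le> card (\<Union>T\<in>I. {v \<in> V. \<Lambda> v = T})" using V I by (intro card_mono) auto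
      also have "\<dots> \<le> (\<Sum>T\<in>I. card {v \<in> V. \<Lambda> v = T})" by (rule card_UN_le[OF I])
      finally have "real (card R) \<le> (\<Sum>T\<in>I. n T)"
        unfolding n_def nlab_def by (metis of_nat_le_iff of_nat_sum)
      then have "lq * card R \<le> lq * (\<Sum>T\<in>psets - {S, compl S}. n T)"
        unfolding I_def using lq_pos by (intro mult_left_mono) auto
      also have "\<dots> \<le> rest"
        unfolding rest_def sum_distrib_left
      proof (rule sum_mono)
        fix T assume "T \<in> psets - {S, compl S}"
        then show "lq * n T \<le> y T" unfolding y_def ylab_def n_def
          using psets_card[of T] mult_right_mono[OF wt_ge_lq[of "card T"] nlab_nonneg[of V \<Lambda> T]]
          by (simp add: mult.commute)
      qed
      also have "\<dots> \<le> G" using rest pos unfolding G by linarith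
      also have "\<dots> \<le> lq * (\<epsilon> * s)" using G\<epsilon> by (simp add: mult.commute mult.left_commute)
      finally have "real (card R) \<le> \<epsilon> * s" using lq_pos by simp
      then show ?thesis unfolding R_def .
    qed
    show "\<exists>i<q. \<bar>real (card {v\<in>V. \<Lambda> v = {i}}) - sa * s\<bar> \<le> \<epsilon> * s \<and>
      \<bar>real (card {v\<in>V. \<Lambda> v = compl {i}}) - sb * s\<bar> \<le> \<epsilon> * s \<and>
      real (card {v\<in>V. \<Lambda> v \<notin> {{i}, compl {i}, {..<q}}}) \<le> \<epsilon> * s"
      using A B C i by blast
  qed
qed

section \<open>Bounds for maximizers\<close>

lemma kappa_eq: "kappa q = 1 / (sa + sb)\<^sup>2"
  by (simp add: kappa_def sa_def sb_def Lq_def lq_def power_int_def divide_inverse power_inverse)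

text \<open>Because \<open>kappa q = 1 / (sa + sb)^2\<close>, the bound on \<open>m\<close> says
  that \<open>n\<close> is at least \<open>sqrt m / sqrt \<kappa>\<close>, and
  \<open>1 / sqrt \<kappa> > sa + sb\<close>. The margin \<open>\<theta> * sqrt m\<close> absorbs
  rounding and all later changes of the two sides. For \<open>\<kappa> <= 0\<close> no positive
  \<open>m\<close> satisfies the bound.\<close>

lemma room_exists:
  fixes \<kappa> :: real
  assumes "\<kappa> < kappa q"
  shows "\<exists>\<theta>::real>0. \<forall>m n. 1 \<le> m \<and> real m \<le> \<kappa> * (real n)\<^sup>2 \<longrightarrow> (sa + sb + \<theta>) * sqrt m \<le> real n"
proof (cases "0 < \<kappa>")
  case False
  have "\<not> (1 \<le> m \<and> real m \<le> \<kappa> * (real n)\<^sup>2)" for m n :: nat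
  proof -
    have "\<kappa> * (real n)\<^sup>2 \<le> 0" using False by (simp add: mult_nonpos_nonneg)
    then show ?thesis by linarith
  qed
  then show ?thesis by (intro exI[of _ 1]) auto
next
  case True
  have s: "0 < sa + sb" using sa_pos sb_pos by simp
  have "sqrt \<kappa> < sqrt (1 / (sa + sb)\<^sup>2)" using assms kappa_eq by (intro real_sqrt_less_mono) simp
  also have "\<dots> = 1 / (sa + sb)" using s by (simp add: real_sqrt_divide)
  finally have k: "sa + sb < 1 / sqrt \<kappa>" using True s by (simp add: field_simps)
  have "(1 / sqrt \<kappa>) * sqrt m \<le> real n" if "real m \<le> \<kappa> * (real n)\<^sup>2" for m n :: nat
  proof -
    have "sqrt m \<le> sqrt (\<kappa> * (real n)\<^sup>2)" using that by (rule real_sqrt_le_mono)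
    then show ?thesis using True by (simp add: real_sqrt_mult field_simps)
  qed
  with k show ?thesis by (intro exI[of _ "1 / sqrt \<kappa> - (sa + sb)"]) auto
qed

lemma real_q_pow: "real q ^ k = exp (k * Lq)"
  using q3 by (simp add: Lq_def exp_of_nat_mult)

lemma real_q1_pow: "real (q - 1) ^ k = exp (k * (Lq - lq))"
proof -
  have "exp (Lq - lq) = real (q - 1)" using q3 by (simp add: Lq_def lq_def exp_diff ln_div of_nat_diff)
  then show ?thesis by (metis exp_of_nat_mult)
qed

lemma product_form:
  fixes a b n :: nat
  assumes "a + b \<le> n"
  shows "real ((q - 1) ^ b * q ^ (n - a - b)) = real q ^ n * exp (- (real a * Lq) - real b * lq)"
proof -
  have "real ((q - 1) ^ b * q ^ (n - a - b)) = exp (real b * (Lq - lq) + (real n - real a - real b) * Lq)"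
    unfolding of_nat_mult of_nat_power real_q_pow real_q1_pow exp_add using assms by (simp add: of_nat_diff)
  also have "real b * (Lq - lq) + (real n - real a - real b) * Lq = real n * Lq + (- (real a * Lq) - real b * lq)" by (simp add: algebra_simps)
  finally show ?thesis by (simp only: real_q_pow exp_add)
qed

lemma maximizer_ge_exp:
  assumes "maximizes_colorings q n m V E" "1 \<le> a" "m \<le> a * b" "a + b \<le> n"
  shows "real q ^ n * exp (Lq - real a * Lq - real b * lq) \<le> num_colorings q V E"
proof -
  have "real q ^ n * exp (Lq - real a * Lq - real b * lq) = exp Lq * (real q ^ n * exp (- (real a * Lq) - real b * lq))"
    by (simp add: exp_add[symmetric] exp_diff exp_minus field_simps)
  also have "\<dots> = real q * real ((q - 1) ^ b * q ^ (n - a - b))"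
    using q3 by (subst product_form[OF assms(4)]) (simp add: Lq_def)
  also have "\<dots> = real (q * (q - 1) ^ b * q ^ (n - a - b))" by simp
  also have "\<dots> \<le> num_colorings q V E" using maximizer_ge[OF assms] by (rule of_nat_mono)
  finally show ?thesis .
qed

text \<open>Rounding both optimal sides up costs at most \<open>Lq + lq\<close> in the exponent, and
  the free choice of the color on the small side returns \<open>Lq\<close>.\<close>

lemma maximizer_lower_bound:
  assumes "maximizes_colorings q n m V E" "1 \<le> m" "2 \<le> \<theta> * sqrt m" "(sa + sb + \<theta>) * sqrt m \<le> real n"
  shows "real q ^ n * exp (- cq * sqrt m - lq) \<le> num_colorings q V E"
proof -
  define s where "s = sqrt m"
  have s: "1 \<le> s" using assms(2) by (simp add: s_def)
  define a where "a = nat \<lceil>sa * s\<rceil>"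
  define b where "b = nat \<lceil>sb * s\<rceil>"
  have "real a = of_int \<lceil>sa * s\<rceil>" "real b = of_int \<lceil>sb * s\<rceil>"
    using sa_pos sb_pos s by (simp_all add: a_def b_def order.trans[of "-1" 0])
  then have a: "sa * s \<le> a" "a \<le> sa * s + 1" and b: "sb * s \<le> b" "b \<le> sb * s + 1"
    using le_of_int_ceiling of_int_ceiling_le_add_one by simp_all
  have "0 < sa * s" using sa_pos s by simp
  then have a1: "1 \<le> a" using a by linarith
  have "real m = (sa * s) * (sb * s)"
  proof -
    have "(sa * s) * (sb * s) = (sa * sb) * (s * s)" by simp
    then show ?thesis by (simp add: sa_sb s_def)
  qed
  also have "\<dots> \<le> real a * real b" using a b sa_pos sb_pos s by (intro mult_mono) auto
  finally have ab: "m \<le> a * b" by (metis of_nat_le_iff of_nat_mult)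
  have "real a + real b \<le> (sa + sb) * s + 2" using a b by (simp add: algebra_simps)
  also have "\<dots> \<le> real n" using assms(3,4) by (simp add: s_def algebra_simps)
  finally have n: "a + b \<le> n" by linarith
  have "- cq * s - lq \<le> Lq - a * Lq - b * lq"
  proof -
    have "a * Lq \<le> (sa * s + 1) * Lq" using a Lq_pos by (intro mult_right_mono) auto
    also have "\<dots> = cq / 2 * s + Lq" using sa_Lq by (simp add: algebra_simps)
    finally have 1: "a * Lq \<le> cq / 2 * s + Lq" .
    have "b * lq \<le> (sb * s + 1) * lq" using b lq_pos by (intro mult_right_mono) auto
    also have "\<dots> = cq / 2 * s + lq" using sb_lq by (simp add: algebra_simps)
    finally show ?thesis using 1 by simp
  qed
  then have "real q ^ n * exp (- cq * s - lq) \<le> real q ^ n * exp (Lq - real a * Lq - real b * lq)"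
    by (intro mult_left_mono) auto
  also have "\<dots> \<le> num_colorings q V E" by (rule maximizer_ge_exp[OF assms(1) a1 ab n])
  finally show ?thesis by (simp add: s_def)
qed

text \<open>At least half of the nonisolated vertices can be deleted so that each of them has a
  neighbour among the rest. Each deleted vertex then has only \<open>q - 1\<close> choices, a factor
  \<open>exp (- lq)\<close>.\<close>

lemma num_colorings_le_nonisolated:
  assumes "nm_graph n m V E"
  shows "real (num_colorings q V E) \<le> real q ^ n * exp (- (lq * card (\<Union>E) / 2))"
proof -
  have V: "finite V" "card V = n" "E \<subseteq> [V]\<^bsup>2\<^esup>" using assms by (auto simp: nm_graph_def)
  have UV: "\<Union>E \<subseteq> V" using V(3) by (auto simp: nsets_def)
  then have fin: "finite (\<Union>E)" using V(1) by (rule finite_subset)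
  have nl: "{x} \<notin> E" for x using V(3) by (auto simp: nsets_def)
  have nb: "\<exists>w. {u, w} \<in> E" if u: "u \<in> \<Union>E" for u
  proof -
    obtain e where e: "e \<in> E" "u \<in> e" using u by blast
    then have "e \<in> [V]\<^bsup>2\<^esup>" using V(3) by blast
    then obtain a b where ab: "e = {a, b}" by (auto simp: nsets_def card_2_iff)
    then have "{a, b} \<in> E" "{b, a} \<in> E" using e(1) by (simp_all add: insert_commute)
    moreover have "u = a \<or> u = b" using e(2) ab by simp
    ultimately show ?thesis by blast
  qed
  obtain X where X: "X \<subseteq> \<Union>E" "card (\<Union>E) \<le> 2 * card X" "\<And>x. x \<in> X \<Longrightarrow> \<exists>w. w \<notin> X \<and> {x, w} \<in> E"
    by (rule half_with_outside_neighbours[OF fin nb nl]) (assumption | blast)+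
  then obtain w where w: "\<And>x. x \<in> X \<Longrightarrow> w x \<notin> X \<and> {x, w x} \<in> E" by metis
  have XV: "X \<subseteq> V" using X UV by blast
  then have cX: "card X \<le> n" "finite X" using V by (auto intro: card_mono finite_subset)
  have "card (list_colorings V E (\<lambda>_. {..<q})) \<le> card (list_colorings (V - X) E (\<lambda>_. {..<q})) * (\<Prod>x\<in>X. q - 1)"
  proof (rule card_list_colorings_delete[where w = w])
    show "w x \<in> V - X \<and> {x, w x} \<in> E" if "x \<in> X" for x using w[OF that] UV by auto
  qed (use V XV in \<open>auto simp: card_Diff_singleton\<close>)
  also have "\<dots> \<le> q ^ (n - card X) * (q - 1) ^ card X"
    using card_list_colorings_le_prod[of "V - X" "\<lambda>_. {..<q}" E] V XV cX
    by (auto simp: card_Diff_subset)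
  \<comment> \<open>The \<open>0\<close> brings the bound into the shape of
    \<open>product_form\<close>, with an empty small side.\<close>
  finally have "num_colorings q V E \<le> (q - 1) ^ card X * q ^ (n - 0 - card X)"
    unfolding num_colorings_def proper_colorings_eq[OF V(3)] by (simp add: mult.commute)
  then have "real (num_colorings q V E) \<le> real ((q - 1) ^ card X * q ^ (n - 0 - card X))" by (rule of_nat_mono)
  also have "\<dots> = real q ^ n * exp (- (card X * lq))" using cX by (subst product_form) auto
  also have "\<dots> \<le> real q ^ n * exp (- (lq * card (\<Union>E) / 2))"
  proof -
    have "real (card (\<Union>E)) / 2 \<le> card X" using X(2) by linarith
    then have "lq * (real (card (\<Union>E)) / 2) \<le> lq * card X" using lq_pos by (intro mult_left_mono) auto
    then show ?thesis using q3 by (simp add: mult.commute)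
  qed
  finally show ?thesis .
qed

definition Cq :: real where "Cq = 2 * (cq + lq) / lq"

lemma Cq_pos: "0 < Cq" using cq_pos lq_pos by (simp add: Cq_def)

text \<open>Comparison of the lower bound with the loss at nonisolated vertices. It supplies the
  hypothesis \<open>u = O (sqrt m)\<close> of the container theorem, so that isolated vertices,
  however many, do no harm.\<close>

lemma maximizer_nonisolated:
  assumes "maximizes_colorings q n m V E" "1 \<le> m" "2 \<le> \<theta> * sqrt m" "(sa + sb + \<theta>) * sqrt m \<le> real n"
  shows "real (card (\<Union>E)) \<le> Cq * sqrt m"
proof -
  have "real q ^ n * exp (- cq * sqrt m - lq) \<le> real q ^ n * exp (- (lq * card (\<Union>E) / 2))"
    using maximizer_lower_bound[OF assms] num_colorings_le_nonisolated[of n m V E] assms(1)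
    unfolding maximizes_colorings_def by linarith
  then have "lq * card (\<Union>E) / 2 \<le> cq * sqrt m + lq" using q3 by simp
  also have "\<dots> \<le> cq * sqrt m + lq * sqrt m" using assms(2) lq_pos by simp
  finally show ?thesis using lq_pos by (simp add: Cq_def field_simps)
qed

lemma card_adjacent:
  assumes "finite V" "E \<subseteq> [V]\<^bsup>2\<^esup>"
  shows "card {(x, y). {x, y} \<in> E} = 2 * card E"
proof -
  have finE: "finite E" using assms finite_imp_finite_nsets finite_subset by metis
  have two: "finite {(x, y). {x, y} = e} \<and> card {(x, y). {x, y} = e} = 2" if "e \<in> E" for e
  proof -
    obtain a b where ab: "e = {a, b}" "a \<noteq> b" using assms(2) \<open>e \<in> E\<close> by (auto simp: nsets_def card_2_iff)
    have "{(x, y). {x, y} = e} = {(a, b), (b, a)}" using ab by (auto simp: doubleton_eq_iff)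
    then show ?thesis using ab by simp
  qed
  have "{(x, y). {x, y} \<in> E} = (\<Union>e\<in>E. {(x, y). {x, y} = e})" by auto
  moreover have "card (\<Union>e\<in>E. {(x, y). {x, y} = e}) = (\<Sum>e\<in>E. card {(x, y). {x, y} = e})"
    using finE two by (intro card_UN_disjoint) auto
  ultimately show ?thesis using two by simp
qed

lemma finite_adjacent:
  assumes "finite V" "E \<subseteq> [V]\<^bsup>2\<^esup>"
  shows "finite {(x, y). {x, y} \<in> E}"
  by (rule finite_subset[of _ "V \<times> V"]) (use assms in \<open>auto simp: nsets_def\<close>)

definition valid_labelling :: "'a set \<Rightarrow> ('a \<Rightarrow> nat set) \<Rightarrow> bool" where
  "valid_labelling V \<Lambda> \<longleftrightarrow> (\<forall>v\<in>V. \<Lambda> v \<subseteq> {..<q} \<and> \<Lambda> v \<noteq> {})"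

lemma valid_labellingD: "valid_labelling V \<Lambda> \<Longrightarrow> v \<in> V \<Longrightarrow> \<Lambda> v \<subseteq> {..<q} \<and> \<Lambda> v \<noteq> {}"
  by (simp add: valid_labelling_def)

text \<open>Of the \<open>2 * card E\<close> ordered pairs of adjacent vertices all but
  \<open>\<epsilon> * card E\<close> have disjoint lists. The second claim is
  \<open>cost_squared_ge\<close>, with \<open>(1 - \<epsilon>)^2 <= 1 - \<epsilon>\<close> in place
  of a square root.\<close>

lemma tight_labelling_cost:
  fixes \<epsilon> :: real
  assumes "finite V" "E \<subseteq> [V]\<^bsup>2\<^esup>" "valid_labelling V \<Lambda>" "0 \<le> \<epsilon>" "\<epsilon> \<le> 1"
    "real (card {(x, y). {x, y} \<in> E \<and> \<Lambda> x \<inter> \<Lambda> y \<noteq> {}}) \<le> \<epsilon> * card E"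
  shows "2 * (1 - \<epsilon>) * card E \<le> real (card (disjoint_pairs V \<Lambda>))"
    and "cq * (1 - \<epsilon>) * sqrt (card E) \<le> cost V \<Lambda>"
proof -
  let ?X = "{(x, y). {x, y} \<in> E}" and ?Y = "{(x, y). {x, y} \<in> E \<and> \<Lambda> x \<inter> \<Lambda> y \<noteq> {}}"
  have fin: "finite ?X" using finite_adjacent assms by blast
  have finD: "finite (disjoint_pairs V \<Lambda>)"
    by (rule finite_subset[of _ "V \<times> V"]) (use assms(1) in \<open>auto simp: disjoint_pairs_def\<close>)
  have sub: "?X - ?Y \<subseteq> disjoint_pairs V \<Lambda>" using assms(2) by (auto simp: disjoint_pairs_def nsets_def)
  have "?Y \<subseteq> ?X" by auto
  then have "card (?X - ?Y) = card ?X - card ?Y" using fin finite_subset by (intro card_Diff_subset) auto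
  moreover have "card (?X - ?Y) \<le> card (disjoint_pairs V \<Lambda>)" using finD sub by (rule card_mono)
  moreover have "card ?X = 2 * card E" by (rule card_adjacent[OF assms(1,2)])
  ultimately have "2 * real (card E) - \<epsilon> * card E \<le> real (card (disjoint_pairs V \<Lambda>))"
    using assms(6) by linarith
  moreover have "0 \<le> \<epsilon> * card E" using assms(4) by simp
  ultimately show D: "2 * (1 - \<epsilon>) * card E \<le> real (card (disjoint_pairs V \<Lambda>))"
    by (simp add: algebra_simps)
  have L: "\<Lambda> v \<subseteq> {..<q} \<and> \<Lambda> v \<noteq> {}" if "v \<in> V" for v using valid_labellingD[OF assms(3) that] .
  show "cq * (1 - \<epsilon>) * sqrt (card E) \<le> cost V \<Lambda>"
  proof (rule power2_le_imp_le)
    show "0 \<le> cost V \<Lambda>" using assms(1) L by (rule cost_nonneg)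
    have "(cq * (1 - \<epsilon>) * sqrt (card E))\<^sup>2 = (cq * cq) * ((1 - \<epsilon>) * ((1 - \<epsilon>) * card E))"
      by (simp add: power2_eq_square)
    also have "\<dots> = (1 - \<epsilon>) * (4 * Kq * (1 - \<epsilon>) * card E)" unfolding cq_squared by simp
    also have "\<dots> \<le> 1 * (4 * Kq * (1 - \<epsilon>) * card E)" using assms(4,5) Kq_pos by (intro mult_right_mono) auto
    also have "\<dots> = 2 * Kq * (2 * (1 - \<epsilon>) * card E)" by simp
    also have "\<dots> \<le> 2 * Kq * card (disjoint_pairs V \<Lambda>)" using D Kq_pos by (intro mult_left_mono) auto
    also have "\<dots> \<le> (cost V \<Lambda>)\<^sup>2" using assms(1) L by (rule cost_squared_ge)
    finally show "(cq * (1 - \<epsilon>) * sqrt (card E))\<^sup>2 \<le> (cost V \<Lambda>)\<^sup>2" .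
  qed
qed

lemma eventually_maximizer_covered:
  fixes \<theta> \<epsilon> :: real
  assumes "0 < \<theta>" "0 < \<epsilon>" "\<epsilon> \<le> 1"
  shows "\<forall>\<^sub>F m in sequentially. \<forall>n V E. (sa + sb + \<theta>) * sqrt m \<le> real n \<and> maximizes_colorings q n m V E \<longrightarrow>
    (\<exists>\<L>. finite \<L> \<and> card \<L> \<le> exp (\<epsilon> * sqrt m) \<and>
    (\<forall>f\<in>proper_colorings q V E. \<exists>\<Lambda>\<in>\<L>. f \<in> Pi\<^sub>E V \<Lambda>) \<and>
    (\<forall>\<Lambda>\<in>\<L>. valid_labelling V \<Lambda> \<and>
       real (card {(x, y). {x, y} \<in> E \<and> \<Lambda> x \<inter> \<Lambda> y \<noteq> {}}) \<le> \<epsilon> * m))"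
proof -
  from colorings_covered_asymp[OF Cq_pos assms(2), of q, where ?'a = nat]
  obtain M where M: "\<forall>m\<ge>M. \<forall>V (E::nat set set). finite V \<and> E \<subseteq> [V]\<^bsup>2\<^esup> \<and> card E = m \<and> card (\<Union>E) \<le> Cq * sqrt m \<longrightarrow>
   (\<exists>\<L>. finite \<L> \<and> card \<L> \<le> exp (\<epsilon> * sqrt m) \<and>
    (\<forall>f\<in>proper_colorings q V E. \<exists>\<Lambda>\<in>\<L>. f \<in> Pi\<^sub>E V \<Lambda>) \<and>
    (\<forall>\<Lambda>\<in>\<L>. (\<forall>v\<in>V. \<Lambda> v \<noteq> {} \<and> \<Lambda> v \<subseteq> {..<q}) \<and>
       card {(x, y). {x, y} \<in> E \<and> \<Lambda> x \<inter> \<Lambda> y \<noteq> {}} \<le> \<epsilon> * m))" by (elim exE)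
  have "\<forall>\<^sub>F m in sequentially. 2 \<le> \<theta> * sqrt (real m)" using assms(1) by real_asymp
  then show ?thesis
    using eventually_ge_at_top[of "max 1 M"]
  proof eventually_elim
    case (elim m)
    show ?case
    proof (intro allI impI)
      fix n V E assume H: "(sa + sb + \<theta>) * sqrt m \<le> real n \<and> maximizes_colorings q n m V E"
      then have V: "finite V" "E \<subseteq> [V]\<^bsup>2\<^esup>" "card E = m" by (auto simp: maximizes_colorings_def nm_graph_def)
      have "real (card (\<Union>E)) \<le> Cq * sqrt m" using H elim by (intro maximizer_nonisolated) auto
      with V have "finite V \<and> E \<subseteq> [V]\<^bsup>2\<^esup> \<and> card E = m \<and> card (\<Union>E) \<le> Cq * sqrt m" by blast
      moreover have "m \<ge> M" using elim by simp
      ultimately have "\<exists>\<L>. finite \<L> \<and> card \<L> \<le> exp (\<epsilon> * sqrt m) \<and>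
        (\<forall>f\<in>proper_colorings q V E. \<exists>\<Lambda>\<in>\<L>. f \<in> Pi\<^sub>E V \<Lambda>) \<and>
        (\<forall>\<Lambda>\<in>\<L>. (\<forall>v\<in>V. \<Lambda> v \<noteq> {} \<and> \<Lambda> v \<subseteq> {..<q}) \<and>
         card {(x, y). {x, y} \<in> E \<and> \<Lambda> x \<inter> \<Lambda> y \<noteq> {}} \<le> \<epsilon> * m)"
        using M by (elim allE impE) assumption+
      then show "\<exists>\<L>. finite \<L> \<and> card \<L> \<le> exp (\<epsilon> * sqrt m) \<and>
        (\<forall>f\<in>proper_colorings q V E. \<exists>\<Lambda>\<in>\<L>. f \<in> Pi\<^sub>E V \<Lambda>) \<and>
        (\<forall>\<Lambda>\<in>\<L>. valid_labelling V \<Lambda> \<and>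
         real (card {(x, y). {x, y} \<in> E \<and> \<Lambda> x \<inter> \<Lambda> y \<noteq> {}}) \<le> \<epsilon> * m)"
        unfolding valid_labelling_def by (simp only: conj_commute[of "_ \<noteq> {}"])
    qed
  qed
qed

lemma card_covered_le:
  assumes "finite V" "finite \<L>" "\<And>\<Lambda>. \<Lambda> \<in> \<L> \<Longrightarrow> valid_labelling V \<Lambda> \<and> w \<le> cost V \<Lambda>"
    "\<And>f. f \<in> F \<Longrightarrow> \<exists>\<Lambda>\<in>\<L>. f \<in> Pi\<^sub>E V \<Lambda>"
  shows "real (card F) \<le> card \<L> * (real q ^ card V * exp (- w))"
proof -
  have fin: "finite (Pi\<^sub>E V \<Lambda>)" if "\<Lambda> \<in> \<L>" for \<Lambda>
    using assms(1) assms(3)[OF that] finite_subset[of _ "{..<q}"] by (intro finite_PiE) (auto simp: valid_labelling_def)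
  have "F \<subseteq> (\<Union>\<Lambda>\<in>\<L>. Pi\<^sub>E V \<Lambda>)" using assms(4) by auto
  then have "card F \<le> card (\<Union>\<Lambda>\<in>\<L>. Pi\<^sub>E V \<Lambda>)" using assms(2) fin by (intro card_mono) auto
  also have "\<dots> \<le> (\<Sum>\<Lambda>\<in>\<L>. card (Pi\<^sub>E V \<Lambda>))" by (rule card_UN_le[OF assms(2)])
  finally have "real (card F) \<le> (\<Sum>\<Lambda>\<in>\<L>. real (card (Pi\<^sub>E V \<Lambda>)))" by (metis of_nat_le_iff of_nat_sum)
  also have "\<dots> \<le> (\<Sum>\<Lambda>\<in>\<L>. real q ^ card V * exp (- w))"
  proof (rule sum_mono)
    fix \<Lambda> assume L: "\<Lambda> \<in> \<L>"
    have "real (card (Pi\<^sub>E V \<Lambda>)) = real q ^ card V * exp (- cost V \<Lambda>)"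
      using assms(1) valid_labellingD[of V \<Lambda>] assms(3)[OF L] by (intro card_PiE_eq_exp_cost) blast+
    also have "\<dots> \<le> real q ^ card V * exp (- w)" using assms(3)[OF L] by (intro mult_left_mono) auto
    finally show "real (card (Pi\<^sub>E V \<Lambda>)) \<le> real q ^ card V * exp (- w)" .
  qed
  finally show ?thesis by simp
qed

lemma eventually_maximizer_upper_bound:
  fixes \<theta> \<epsilon> :: real
  assumes "0 < \<theta>" "0 < \<epsilon>"
  shows "\<forall>\<^sub>F m in sequentially. \<forall>n V E. (sa + sb + \<theta>) * sqrt m \<le> real n \<and> maximizes_colorings q n m V E \<longrightarrow>
    real (num_colorings q V E) \<le> real q ^ n * exp ((- cq + \<epsilon>) * sqrt m)"
proof -
  \<comment> \<open>The number of labellings contributes \<open>e\<close> to the exponent and the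
    defect in their cost contributes \<open>cq * e\<close>; together they must stay below
    \<open>\<epsilon>\<close>.\<close>
  define e where "e = min 1 (\<epsilon> / (1 + cq))"
  have e: "0 < e" "e \<le> 1" using assms cq_pos by (auto simp: e_def)
  have "(1 + cq) * e \<le> (1 + cq) * (\<epsilon> / (1 + cq))" using cq_pos by (intro mult_left_mono) (auto simp: e_def)
  then have e3: "(1 + cq) * e \<le> \<epsilon>" using cq_pos by simp
  show ?thesis
    using eventually_maximizer_covered[OF assms(1) e(1,2)]
  proof eventually_elim
    case (elim m)
    show ?case
    proof (intro allI impI)
      fix n V E assume H: "(sa + sb + \<theta>) * sqrt m \<le> real n \<and> maximizes_colorings q n m V E"
      then have V: "finite V" "E \<subseteq> [V]\<^bsup>2\<^esup>" "card E = m" "card V = n" by (auto simp: maximizes_colorings_def nm_graph_def)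
      obtain \<L> where L: "finite \<L> \<and> card \<L> \<le> exp (e * sqrt m) \<and>
        (\<forall>f\<in>proper_colorings q V E. \<exists>\<Lambda>\<in>\<L>. f \<in> Pi\<^sub>E V \<Lambda>) \<and>
        (\<forall>\<Lambda>\<in>\<L>. valid_labelling V \<Lambda> \<and>
         real (card {(x, y). {x, y} \<in> E \<and> \<Lambda> x \<inter> \<Lambda> y \<noteq> {}}) \<le> e * m)"
        using elim[rule_format, OF H] by (elim exE)
      have "real (num_colorings q V E) \<le> card \<L> * (real q ^ card V * exp (- (cq * (1 - e) * sqrt m)))"
        unfolding num_colorings_def
      proof (rule card_covered_le)
        show "valid_labelling V \<Lambda> \<and> cq * (1 - e) * sqrt m \<le> cost V \<Lambda>" if "\<Lambda> \<in> \<L>" for \<Lambda>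
          using tight_labelling_cost(2)[OF V(1,2), of \<Lambda> e] L that V e by auto
      qed (use L V in auto)
      also have "\<dots> \<le> exp (e * sqrt m) * (real q ^ card V * exp (- (cq * (1 - e) * sqrt m)))"
        using L by (intro mult_right_mono) auto
      also have "\<dots> = real q ^ n * exp ((- cq + (1 + cq) * e) * sqrt m)"
        using V(4) by (simp add: exp_add[symmetric] algebra_simps)
      also have "\<dots> \<le> real q ^ n * exp ((- cq + \<epsilon>) * sqrt m)"
        using e3 by (intro mult_left_mono) (auto intro!: mult_right_mono)
      finally show "real (num_colorings q V E) \<le> real q ^ n * exp ((- cq + \<epsilon>) * sqrt m)" .
    qed
  qed
qed

end

lemma card_complete_bipartite_edges_le:
  assumes "finite A" "finite B"
  shows "card (complete_bipartite_edges A B) \<le> card A * card B" "finite (complete_bipartite_edges A B)"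
proof -
  have e: "complete_bipartite_edges A B = (\<lambda>(x, y). {x, y}) ` (A \<times> B)"
    by (auto simp: complete_bipartite_edges_def)
  show "finite (complete_bipartite_edges A B)" unfolding e using assms by simp
  show "card (complete_bipartite_edges A B) \<le> card A * card B"
    unfolding e using card_image_le[of "A \<times> B" "\<lambda>(x, y). {x, y}"] assms by (simp add: card_cartesian_product)
qed

context colouring_params
begin

section \<open>A set that is monochromatic in almost all colorings\<close>

definition lab_A :: "'a set \<Rightarrow> ('a \<Rightarrow> nat set) \<Rightarrow> nat \<Rightarrow> 'a set" where
  "lab_A V \<Lambda> i = {v \<in> V. \<Lambda> v = {i}}"

definition lab_B :: "'a set \<Rightarrow> ('a \<Rightarrow> nat set) \<Rightarrow> nat \<Rightarrow> 'a set" where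
  "lab_B V \<Lambda> i = {v \<in> V. \<Lambda> v = {..<q} - {i}}"

definition near_bipartite :: "'a set set \<Rightarrow> real \<Rightarrow> real \<Rightarrow> 'a set \<Rightarrow> 'a set \<Rightarrow> bool" where
  "near_bipartite E s \<epsilon> A B \<longleftrightarrow> A \<inter> B = {} \<and> finite A \<and> finite B \<and>
    \<bar>real (card A) - sa * s\<bar> \<le> \<epsilon> * s \<and> \<bar>real (card B) - sb * s\<bar> \<le> \<epsilon> * s \<and>
    (1 - \<epsilon>) * s\<^sup>2 \<le> real (card (E \<inter> complete_bipartite_edges A B))"

lemma lab_A_lab_B_disjoint: "lab_A V \<Lambda> i \<inter> lab_B V \<Lambda> i = {}"
  by (auto simp: lab_A_def lab_B_def)

text \<open>Among \<open>{i}\<close>, its complement and the full list, only the first two are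
  disjoint. So an edge that does not join \<open>lab_A\<close> and \<open>lab_B\<close> either has
  intersecting lists or touches a vertex of \<open>O'\<close>, and the latter happens at most
  \<open>card O' * card (\<Union>E)\<close> times.\<close>

lemma tight_labelling_edges:
  fixes V :: "'a set" and i :: nat
  assumes V: "finite V" "E \<subseteq> [V]\<^bsup>2\<^esup>" and val: "valid_labelling V \<Lambda>"
  defines "O' \<equiv> {v\<in>V. \<Lambda> v \<notin> {{i}, {..<q} - {i}, {..<q}}}"
  shows "card E \<le> card {(x, y). {x, y} \<in> E \<and> \<Lambda> x \<inter> \<Lambda> y \<noteq> {}} + card O' * card (\<Union>E)
    + card (E \<inter> complete_bipartite_edges (lab_A V \<Lambda> i) (lab_B V \<Lambda> i))"
proof -
  let ?Y = "{(x, y). {x, y} \<in> E \<and> \<Lambda> x \<inter> \<Lambda> y \<noteq> {}}"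
  let ?f = "\<lambda>(x, y). {x, y}"
  let ?C = "E \<inter> complete_bipartite_edges (lab_A V \<Lambda> i) (lab_B V \<Lambda> i)"
  have finY: "finite ?Y" by (rule finite_subset[OF _ finite_adjacent[OF V]]) auto
  have finO: "finite O'" using V(1) by (simp add: O'_def)
  have UV: "\<Union>E \<subseteq> V" using V(2) by (auto simp: nsets_def)
  have finU: "finite (\<Union>E)" using UV V(1) by (rule finite_subset)
  have finE: "finite E" using V finite_imp_finite_nsets finite_subset by metis
  have "E \<subseteq> ?f ` ?Y \<union> ?f ` (O' \<times> \<Union>E) \<union> ?C"
  proof
    fix e assume e: "e \<in> E"
    then have "e \<in> [V]\<^bsup>2\<^esup>" using V(2) by blast
    then obtain x y where xy: "e = {x, y}" "x \<in> V" "y \<in> V" by (auto simp: nsets_def card_2_iff)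
    have U: "x \<in> \<Union>E" "y \<in> \<Union>E" using e xy by auto
    have L: "\<Lambda> x \<subseteq> {..<q}" "\<Lambda> x \<noteq> {}" "\<Lambda> y \<subseteq> {..<q}" "\<Lambda> y \<noteq> {}"
      using valid_labellingD[OF val] xy by auto
    consider "\<Lambda> x \<inter> \<Lambda> y \<noteq> {}" | "x \<in> O'" | "y \<in> O'" | "\<Lambda> x \<inter> \<Lambda> y = {}" "x \<notin> O'" "y \<notin> O'" by blast
    then show "e \<in> ?f ` ?Y \<union> ?f ` (O' \<times> \<Union>E) \<union> ?C"
    proof cases
      case 1
      then have "(x, y) \<in> ?Y" using e xy by simp
      then have "e \<in> ?f ` ?Y" using xy(1) by (auto intro!: image_eqI[of _ _ "(x, y)"])
      then show ?thesis by blast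
    next
      case 2
      then have "e \<in> ?f ` (O' \<times> \<Union>E)" using U xy by (intro image_eqI[of _ _ "(x, y)"]) auto
      then show ?thesis by blast
    next
      case 3
      then have "e \<in> ?f ` (O' \<times> \<Union>E)" using U xy by (intro image_eqI[of _ _ "(y, x)"]) auto
      then show ?thesis by blast
    next
      case 4
      have "\<Lambda> x \<in> {{i}, {..<q} - {i}, {..<q}}" "\<Lambda> y \<in> {{i}, {..<q} - {i}, {..<q}}"
        using 4 xy by (auto simp: O'_def)
      then have "(\<Lambda> x = {i} \<and> \<Lambda> y = {..<q} - {i}) \<or> (\<Lambda> y = {i} \<and> \<Lambda> x = {..<q} - {i})"
      proof -
        have "\<Lambda> x \<noteq> {..<q}" "\<Lambda> y \<noteq> {..<q}" "\<Lambda> x \<noteq> \<Lambda> y" using 4(1) L by blast+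
        then show ?thesis using \<open>\<Lambda> x \<in> _\<close> \<open>\<Lambda> y \<in> _\<close> by (elim insertE emptyE) simp_all
      qed
      then have "e \<in> complete_bipartite_edges (lab_A V \<Lambda> i) (lab_B V \<Lambda> i)"
        unfolding complete_bipartite_edges_def lab_A_def lab_B_def using xy by blast
      then show ?thesis using e by blast
    qed
  qed
  then have "card E \<le> card (?f ` ?Y \<union> ?f ` (O' \<times> \<Union>E) \<union> ?C)"
    using finY finO finU finE by (intro card_mono) auto
  also have "\<dots> \<le> card (?f ` ?Y) + card (?f ` (O' \<times> \<Union>E)) + card ?C"
    using card_Un_le[of "?f ` ?Y \<union> ?f ` (O' \<times> \<Union>E)" ?C] card_Un_le[of "?f ` ?Y" "?f ` (O' \<times> \<Union>E)"] by linarith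
  also have "card (?f ` ?Y) \<le> card ?Y" by (rule card_image_le[OF finY])
  also have "card (?f ` (O' \<times> \<Union>E)) \<le> card O' * card (\<Union>E)"
    using card_image_le[of "O' \<times> \<Union>E" ?f] finO finU by (simp add: card_cartesian_product)
  finally show ?thesis by simp
qed

text \<open>The two pictures share at least \<open>(1 - 2 * \<epsilon>) * s^2\<close> edges. A
  shared edge joins \<open>A \<inter> A'\<close> with \<open>B \<inter> B'\<close> or, with the
  sides swapped, \<open>A \<inter> B'\<close> with \<open>B \<inter> A'\<close>. With
  \<open>t = (sa + \<epsilon>) * s\<close> and \<open>\<beta> = card (B \<inter> B')\<close> this
  allows at most \<open>t * max \<beta> t\<close> edges. Since \<open>t^2\<close> is too small, the
  maximum must be \<open>\<beta>\<close>.\<close>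

lemma near_bipartite_overlap:
  assumes E: "finite E" "real (card E) = s\<^sup>2" and s: "0 < s"
    and nb: "near_bipartite E s \<epsilon> A B" "near_bipartite E s \<epsilon> A' B'"
    and \<epsilon>: "0 < \<epsilon>" "(sa + \<epsilon>)\<^sup>2 < 1 - 2 * \<epsilon>"
  shows "(1 - 2 * \<epsilon>) / (sa + \<epsilon>) * s \<le> card (B \<inter> B')"
proof -
  define t where "t = (sa + \<epsilon>) * s"
  define \<alpha> where "\<alpha> = real (card (A \<inter> A'))"
  define \<beta> where "\<beta> = real (card (B \<inter> B'))"
  have fin: "finite A" "finite B" "finite A'" "finite B'" using nb by (auto simp: near_bipartite_def)
  have disj: "A' \<inter> B' = {}" using nb by (auto simp: near_bipartite_def)
  have At: "card A \<le> t" "card A' \<le> t" using nb by (auto simp: near_bipartite_def t_def algebra_simps abs_le_iff)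
  let ?C = "E \<inter> complete_bipartite_edges A B" and ?C' = "E \<inter> complete_bipartite_edges A' B'"
  let ?D1 = "complete_bipartite_edges (A \<inter> A') (B \<inter> B')" and ?D2 = "complete_bipartite_edges (A \<inter> B') (B \<inter> A')"
  have "card (?C \<union> ?C') \<le> card E" using E by (intro card_mono) auto
  moreover have "card ?C + card ?C' = card (?C \<union> ?C') + card (?C \<inter> ?C')"
    using E by (intro card_Un_Int) auto
  ultimately have "real (card ?C) + real (card ?C') \<le> s\<^sup>2 + card (?C \<inter> ?C')"
    unfolding E(2)[symmetric] by linarith
  then have 1: "(1 - 2 * \<epsilon>) * s\<^sup>2 \<le> card (?C \<inter> ?C')"
    using nb by (auto simp: near_bipartite_def algebra_simps)
  have "?C \<inter> ?C' \<subseteq> ?D1 \<union> ?D2"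
  proof
    fix e assume "e \<in> ?C \<inter> ?C'"
    then have "e \<in> complete_bipartite_edges A B" "e \<in> complete_bipartite_edges A' B'" by auto
    then obtain x y x' y' where e: "e = {x, y}" "x \<in> A" "y \<in> B" "e = {x', y'}" "x' \<in> A'" "y' \<in> B'"
      unfolding complete_bipartite_edges_def by blast
    then have "(x = x' \<and> y = y') \<or> (x = y' \<and> y = x')" by (auto simp: doubleton_eq_iff)
    then show "e \<in> ?D1 \<union> ?D2" using e by (auto simp: complete_bipartite_edges_def)
  qed
  then have "card (?C \<inter> ?C') \<le> card (?D1 \<union> ?D2)"
    using fin by (intro card_mono finite_UnI card_complete_bipartite_edges_le(2)) auto
  also have "\<dots> \<le> card ?D1 + card ?D2" by (rule card_Un_le)
  also have "\<dots> \<le> card (A \<inter> A') * card (B \<inter> B') + card (A \<inter> B') * card (B \<inter> A')"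
    using fin by (intro add_mono card_complete_bipartite_edges_le(1)) auto
  finally have 2: "real (card (?C \<inter> ?C')) \<le> \<alpha> * \<beta> + real (card (A \<inter> B')) * real (card (B \<inter> A'))"
    unfolding \<alpha>_def \<beta>_def by (metis of_nat_add of_nat_le_iff of_nat_mult)
  have "card (A \<inter> A') + card (A \<inter> B') = card (A \<inter> A' \<union> A \<inter> B')"
    using fin disj by (intro card_Un_disjoint[symmetric]) auto
  also have "\<dots> \<le> card A" using fin by (intro card_mono) auto
  finally have a1: "real (card (A \<inter> B')) \<le> t - \<alpha>" using At unfolding \<alpha>_def by linarith
  have "card (A \<inter> A') + card (B \<inter> A') = card (A \<inter> A' \<union> B \<inter> A')"
    using fin nb(1) by (intro card_Un_disjoint[symmetric]) (auto simp: near_bipartite_def)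
  also have "\<dots> \<le> card A'" using fin by (intro card_mono) auto
  finally have a2: "real (card (B \<inter> A')) \<le> t - \<alpha>" using At unfolding \<alpha>_def by linarith
  have \<alpha>: "0 \<le> \<alpha>" "\<alpha> \<le> t" using a1 unfolding \<alpha>_def by auto
  define M where "M = max \<beta> t"
  have "real (card (A \<inter> B')) * real (card (B \<inter> A')) \<le> (t - \<alpha>) * (t - \<alpha>)"
    using a1 a2 \<alpha> by (intro mult_mono) auto
  then have "(1 - 2 * \<epsilon>) * s\<^sup>2 \<le> \<alpha> * \<beta> + (t - \<alpha>) * (t - \<alpha>)" using 1 2 by linarith
  also have "\<dots> \<le> \<alpha> * M + (t - \<alpha>) * M"
    using \<alpha> by (intro add_mono mult_left_mono) (auto simp: M_def)
  also have "\<dots> = t * M" by (simp add: algebra_simps)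
  finally have *: "(1 - 2 * \<epsilon>) * s\<^sup>2 \<le> t * M" .
  have "t < M"
  proof (rule ccontr)
    assume "\<not> t < M"
    then have "M = t" by (simp add: M_def)
    then have "(1 - 2 * \<epsilon>) * s\<^sup>2 \<le> (sa + \<epsilon>)\<^sup>2 * s\<^sup>2" using * by (simp add: t_def power2_eq_square algebra_simps)
    then show False using \<epsilon>(2) s by simp
  qed
  then have "M = \<beta>" by (auto simp: M_def)
  then have "s * ((1 - 2 * \<epsilon>) * s) \<le> s * ((sa + \<epsilon>) * \<beta>)" using * by (simp add: t_def power2_eq_square algebra_simps)
  then have "(1 - 2 * \<epsilon>) * s \<le> (sa + \<epsilon>) * \<beta>" using s by simp
  then show ?thesis using sa_pos \<epsilon> by (simp add: \<beta>_def field_simps)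
qed

text \<open>The loss in the exponent when a vertex that already lacks one color loses a second
  one.\<close>

definition dq :: real where "dq = ln (real (q - 1) / real (q - 2))"

lemma dq_pos: "0 < dq" unfolding dq_def using q3 by (intro ln_gt_zero) (auto simp: field_simps)

text \<open>The vertices of \<open>N\<close> have the complement of \<open>{i}\<close> as list.
  Losing \<open>j\<close> as well takes each of them from \<open>q - 1\<close> to
  \<open>q - 2\<close> choices.\<close>

lemma card_recoloured_le:
  assumes V: "finite V" and val: "valid_labelling V \<Lambda>" and i: "i < q" and j: "j < q" "j \<noteq> i"
    and N: "N \<subseteq> lab_B V \<Lambda> i" and F: "\<And>f. f \<in> F \<Longrightarrow> f \<in> Pi\<^sub>E V \<Lambda> \<and> (\<forall>u\<in>N. f u \<noteq> j)"
  shows "real (card F) \<le> real q ^ card V * exp (- cost V \<Lambda> - card N * dq)"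
proof -
  define \<Lambda>' where "\<Lambda>' = (\<lambda>u. if u \<in> N then \<Lambda> u - {j} else \<Lambda> u)"
  have NV: "N \<subseteq> V" using N by (auto simp: lab_B_def)
  have fin: "finite (\<Lambda> v)" if "v \<in> V" for v
    using valid_labellingD[OF val that] finite_subset[of "\<Lambda> v" "{..<q}"] by auto
  have "F \<subseteq> Pi\<^sub>E V \<Lambda>'"
  proof
    fix f assume "f \<in> F"
    with F[OF this] show "f \<in> Pi\<^sub>E V \<Lambda>'" by (auto simp: PiE_iff \<Lambda>'_def)
  qed
  moreover have "finite (Pi\<^sub>E V \<Lambda>')" using V fin by (intro finite_PiE) (auto simp: \<Lambda>'_def)
  ultimately have "card F \<le> card (Pi\<^sub>E V \<Lambda>')" by (rule card_mono[rotated])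
  then have le: "real (card F) \<le> (\<Prod>v\<in>V. real (card (\<Lambda>' v)))" using V by (simp add: card_PiE flip: of_nat_prod)
  have split: "(\<Prod>v\<in>V. g v) = (\<Prod>v\<in>V - N. g v) * (\<Prod>v\<in>N. g v)" for g :: "'a \<Rightarrow> real"
    using prod.subset_diff[OF NV V] .
  have N1: "(\<Prod>v\<in>N. real (card (\<Lambda> v))) = real (q - 1) ^ card N"
  proof -
    have "real (card (\<Lambda> v)) = real (q - 1)" if "v \<in> N" for v
    proof -
      have "\<Lambda> v = {..<q} - {i}" using that N by (auto simp: lab_B_def)
      then show ?thesis using i by simp
    qed
    then show ?thesis by simp
  qed
  have N2: "(\<Prod>v\<in>N. real (card (\<Lambda>' v))) = real (q - 2) ^ card N"
  proof -
    have "real (card (\<Lambda>' v)) = real (q - 2)" if "v \<in> N" for v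
    proof -
      have "\<Lambda>' v = {..<q} - {i} - {j}" using that N by (auto simp: lab_B_def \<Lambda>'_def)
      then show ?thesis using i j by (simp add: card_Diff_singleton numeral_2_eq_2)
    qed
    then show ?thesis by simp
  qed
  have "exp dq * real (q - 2) = real (q - 1)" using q3 by (simp add: dq_def)
  then have "real (q - 2) = exp (- dq) * real (q - 1)" by (simp add: exp_minus field_simps)
  then have "real (q - 2) ^ card N = exp (- dq) ^ card N * real (q - 1) ^ card N" by (simp add: power_mult_distrib)
  then have e: "real (q - 2) ^ card N = exp (- (card N * dq)) * real (q - 1) ^ card N"
    using exp_of_nat_mult[of "card N" "- dq"] by simp
  have "(\<Prod>v\<in>V. real (card (\<Lambda>' v))) = (\<Prod>v\<in>V - N. real (card (\<Lambda> v))) * (exp (- (card N * dq)) * real (q - 1) ^ card N)"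
    unfolding split[of "\<lambda>v. real (card (\<Lambda>' v))"] N2 e by (simp add: \<Lambda>'_def)
  also have "\<dots> = exp (- (card N * dq)) * (\<Prod>v\<in>V. real (card (\<Lambda> v)))"
    unfolding split[of "\<lambda>v. real (card (\<Lambda> v))"] N1 by simp
  also have "(\<Prod>v\<in>V. real (card (\<Lambda> v))) = real (card (Pi\<^sub>E V \<Lambda>))" using V by (simp add: card_PiE)
  also have "\<dots> = real q ^ card V * exp (- cost V \<Lambda>)"
    using V valid_labellingD[OF val] by (intro card_PiE_eq_exp_cost) auto
  also have "exp (- (card N * dq)) * (real q ^ card V * exp (- cost V \<Lambda>)) = real q ^ card V * exp (- cost V \<Lambda> - card N * dq)"
    by (simp add: exp_diff exp_minus field_simps)
  finally show ?thesis using le by simp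
qed

text \<open>Labellings of cost above \<open>(cq + e) * s\<close> are negligible all together, as
  there are at most \<open>exp (e1 * s)\<close> of them and \<open>e1 < e\<close>. The cheaper ones
  satisfy \<open>labelling_stability\<close>, so each of them exhibits a nearly complete bipartite
  graph.\<close>

lemma eventually_splits:
  fixes \<theta> \<epsilon> \<delta> :: real
  assumes "0 < \<theta>" "0 < \<epsilon>" "\<epsilon> \<le> 1" "0 < \<delta>"
  shows "\<forall>\<^sub>F m in sequentially. \<forall>n V E. (sa + sb + \<theta>) * sqrt m \<le> real n \<and> maximizes_colorings q n m V E \<longrightarrow>
    (\<exists>\<L>. finite \<L> \<and> real (card \<L>) \<le> exp (\<epsilon> * sqrt m) \<and>
      (\<forall>\<Lambda>\<in>\<L>. valid_labelling V \<Lambda> \<and> cq * (1 - \<epsilon>) * sqrt m \<le> cost V \<Lambda> \<and>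
        (\<exists>i<q. near_bipartite E (sqrt m) \<epsilon> (lab_A V \<Lambda> i) (lab_B V \<Lambda> i))) \<and>
      real (card {f \<in> proper_colorings q V E. \<forall>\<Lambda>\<in>\<L>. f \<notin> Pi\<^sub>E V \<Lambda>}) \<le> \<delta> * real (num_colorings q V E))"
proof -
  \<comment> \<open>There will be at most \<open>\<epsilon>2 * s\<close> exceptional vertices, each
    with at most \<open>Cq * s\<close> edges. This uses up half of the edges that
    \<open>near_bipartite\<close> permits to miss; intersecting lists use the other half.\<close>
  define \<epsilon>2 where "\<epsilon>2 = \<epsilon> / (2 * (1 + Cq))"
  have \<epsilon>2: "0 < \<epsilon>2" "\<epsilon>2 \<le> \<epsilon>" "\<epsilon>2 * Cq \<le> \<epsilon> / 2"
    using assms Cq_pos by (auto simp: \<epsilon>2_def field_simps)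
  from labelling_stability[OF \<epsilon>2(1), where ?'a = nat] obtain e
    where e: "0 < e \<and> (\<forall>V (\<Lambda> :: nat \<Rightarrow> nat set) (s::real). finite V \<and> (\<forall>v\<in>V. \<Lambda> v \<subseteq> {..<q} \<and> \<Lambda> v \<noteq> {}) \<and> 0 < s \<and>
     cost V \<Lambda> \<le> (cq + e) * s \<and> 2 * (1 - e) * s\<^sup>2 \<le> real (card (disjoint_pairs V \<Lambda>)) \<longrightarrow>
    (\<exists>i<q. \<bar>real (card {v\<in>V. \<Lambda> v = {i}}) - sa * s\<bar> \<le> \<epsilon>2 * s \<and>
      \<bar>real (card {v\<in>V. \<Lambda> v = {..<q} - {i}}) - sb * s\<bar> \<le> \<epsilon>2 * s \<and>
      real (card {v\<in>V. \<Lambda> v \<notin> {{i}, {..<q} - {i}, {..<q}}}) \<le> \<epsilon>2 * s))" by (elim exE)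
  define e1 where "e1 = min (\<epsilon> / 2) (e / 2)"
  have e1: "0 < e1" "e1 \<le> \<epsilon> / 2" "e1 \<le> \<epsilon>" "e1 \<le> e" "e1 < e" "e1 \<le> 1" using assms e by (auto simp: e1_def)
  define k where "k = e - e1"
  have k: "0 < k" using e1 by (simp add: k_def)
  define D where "D = \<delta> * exp (- lq)"
  have D: "0 < D" using assms by (simp add: D_def)
  have ev: "\<forall>\<^sub>F m in sequentially. exp (- k * sqrt (real m)) \<le> D" using k D by real_asymp
  have ev2: "\<forall>\<^sub>F m in sequentially. 2 \<le> \<theta> * sqrt (real m)" using assms(1) by real_asymp
  show ?thesis
    using eventually_maximizer_covered[OF assms(1) e1(1) e1(6)] ev ev2 eventually_ge_at_top[of 1]
  proof eventually_elim
    case (elim m)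
    show ?case
    proof (intro allI impI)
      fix n V E assume H: "(sa + sb + \<theta>) * sqrt m \<le> real n \<and> maximizes_colorings q n m V E"
      then have V: "finite V" "E \<subseteq> [V]\<^bsup>2\<^esup>" "card E = m" "card V = n" by (auto simp: maximizes_colorings_def nm_graph_def)
      define s where "s = sqrt m"
      have s: "0 < s" "s\<^sup>2 = m" using elim by (auto simp: s_def)
      have U: "real (card (\<Union>E)) \<le> Cq * s" unfolding s_def using H elim by (intro maximizer_nonisolated) auto
      have P: "real q ^ n * exp (- cq * s - lq) \<le> num_colorings q V E"
        unfolding s_def using H elim by (intro maximizer_lower_bound) auto
      obtain \<L> where L: "finite \<L> \<and> card \<L> \<le> exp (e1 * sqrt m) \<and>
        (\<forall>f\<in>proper_colorings q V E. \<exists>\<Lambda>\<in>\<L>. f \<in> Pi\<^sub>E V \<Lambda>) \<and>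
        (\<forall>\<Lambda>\<in>\<L>. valid_labelling V \<Lambda> \<and>
         real (card {(x, y). {x, y} \<in> E \<and> \<Lambda> x \<inter> \<Lambda> y \<noteq> {}}) \<le> e1 * m)"
        using elim(1)[rule_format, OF H] by (elim exE)
      \<comment> \<open>Low cost means many colorings; only these labellings matter and only these
        are tight enough for stability.\<close>
      define \<L>h where "\<L>h = {\<Lambda> \<in> \<L>. cost V \<Lambda> \<le> (cq + e) * s}"
      have fin: "finite \<L>h" using L by (simp add: \<L>h_def)
      have "card \<L>h \<le> card \<L>" unfolding \<L>h_def using L by (intro card_mono) auto
      then have "real (card \<L>h) \<le> exp (e1 * s)" using L by (simp add: s_def)
      also have "\<dots> \<le> exp (\<epsilon> * s)" using e1 s by simp
      finally have c: "real (card \<L>h) \<le> exp (\<epsilon> * s)" .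
      have heavy: "valid_labelling V \<Lambda> \<and> cq * (1 - \<epsilon>) * s \<le> cost V \<Lambda> \<and>
        (\<exists>i<q. near_bipartite E s \<epsilon> (lab_A V \<Lambda> i) (lab_B V \<Lambda> i))" if "\<Lambda> \<in> \<L>h" for \<Lambda>
      proof -
        have val: "valid_labelling V \<Lambda>" and tight: "real (card {(x, y). {x, y} \<in> E \<and> \<Lambda> x \<inter> \<Lambda> y \<noteq> {}}) \<le> e1 * card E"
          and cost: "cost V \<Lambda> \<le> (cq + e) * s" using that L V(3) by (auto simp: \<L>h_def)
        have e10: "0 \<le> e1" using e1 by simp
        note t = tight_labelling_cost[OF V(1,2) val e10 e1(6) tight]
        have "cq * (1 - \<epsilon>) * s \<le> cq * (1 - e1) * s" using e1 cq_pos s by (intro mult_right_mono mult_left_mono) auto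
        also have "\<dots> \<le> cost V \<Lambda>" using t(2) V(3) by (simp add: s_def)
        finally have 1: "cq * (1 - \<epsilon>) * s \<le> cost V \<Lambda>" .
        have "2 * (1 - e) * s\<^sup>2 \<le> 2 * (1 - e1) * s\<^sup>2" using e1 by (intro mult_right_mono) auto
        then have "2 * (1 - e) * s\<^sup>2 \<le> real (card (disjoint_pairs V \<Lambda>))" using t(1) V(3) s(2) by simp
        then have "\<exists>i<q. \<bar>real (card {v\<in>V. \<Lambda> v = {i}}) - sa * s\<bar> \<le> \<epsilon>2 * s \<and>
          \<bar>real (card {v\<in>V. \<Lambda> v = {..<q} - {i}}) - sb * s\<bar> \<le> \<epsilon>2 * s \<and>
          real (card {v\<in>V. \<Lambda> v \<notin> {{i}, {..<q} - {i}, {..<q}}}) \<le> \<epsilon>2 * s"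
          by (intro e[THEN conjunct2, rule_format] conjI V s cost) (use val in \<open>auto simp: valid_labelling_def\<close>)
        then obtain i where i: "i < q" "\<bar>real (card (lab_A V \<Lambda> i)) - sa * s\<bar> \<le> \<epsilon>2 * s"
          "\<bar>real (card (lab_B V \<Lambda> i)) - sb * s\<bar> \<le> \<epsilon>2 * s"
          "real (card {v\<in>V. \<Lambda> v \<notin> {{i}, {..<q} - {i}, {..<q}}}) \<le> \<epsilon>2 * s"
          unfolding lab_A_def lab_B_def by blast
        have \<epsilon>s: "\<epsilon>2 * s \<le> \<epsilon> * s" using \<epsilon>2 s by simp
        define O' where "O' = {v\<in>V. \<Lambda> v \<notin> {{i}, {..<q} - {i}, {..<q}}}"
        define C where "C = E \<inter> complete_bipartite_edges (lab_A V \<Lambda> i) (lab_B V \<Lambda> i)"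
        have "card E \<le> card {(x, y). {x, y} \<in> E \<and> \<Lambda> x \<inter> \<Lambda> y \<noteq> {}} + card O' * card (\<Union>E) + card C"
          unfolding O'_def C_def by (rule tight_labelling_edges[OF V(1,2) val])
        then have "real (card E) \<le> card {(x, y). {x, y} \<in> E \<and> \<Lambda> x \<inter> \<Lambda> y \<noteq> {}} + real (card O') * real (card (\<Union>E)) + card C"
          unfolding of_nat_add[symmetric] of_nat_mult[symmetric] by (rule of_nat_mono)
        also have "real (card O') * real (card (\<Union>E)) \<le> (\<epsilon>2 * s) * (Cq * s)"
          using i(4) U \<epsilon>2 s by (intro mult_mono) (auto simp: O'_def)
        also have "\<dots> = \<epsilon>2 * Cq * s\<^sup>2" by (simp add: power2_eq_square)
        also have "\<dots> \<le> \<epsilon> / 2 * s\<^sup>2" using \<epsilon>2 by (intro mult_right_mono) auto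
        finally have "s\<^sup>2 \<le> e1 * s\<^sup>2 + \<epsilon> / 2 * s\<^sup>2 + card C" using tight s(2) V(3) by simp
        moreover have "e1 * s\<^sup>2 \<le> \<epsilon> / 2 * s\<^sup>2" using e1 by (intro mult_right_mono) auto
        ultimately have "(1 - \<epsilon>) * s\<^sup>2 \<le> card C" by (simp add: algebra_simps)
        then have "near_bipartite E s \<epsilon> (lab_A V \<Lambda> i) (lab_B V \<Lambda> i)"
          using i \<epsilon>s V(1) lab_A_lab_B_disjoint[of V \<Lambda> i]
          unfolding near_bipartite_def C_def by (auto simp: lab_A_def lab_B_def)
        with val 1 i show ?thesis by blast
      qed
      have "real (card {f \<in> proper_colorings q V E. \<forall>\<Lambda>\<in>\<L>h. f \<notin> Pi\<^sub>E V \<Lambda>}) \<le>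
          card (\<L> - \<L>h) * (real q ^ card V * exp (- ((cq + e) * s)))"
      proof (rule card_covered_le)
        show "\<exists>\<Lambda>\<in>\<L> - \<L>h. f \<in> Pi\<^sub>E V \<Lambda>" if "f \<in> {f \<in> proper_colorings q V E. \<forall>\<Lambda>\<in>\<L>h. f \<notin> Pi\<^sub>E V \<Lambda>}" for f
          using that L by blast
      qed (use V L in \<open>auto simp: \<L>h_def\<close>)
      also have "\<dots> \<le> exp (e1 * s) * (real q ^ n * exp (- ((cq + e) * s)))"
      proof -
        have "card (\<L> - \<L>h) \<le> card \<L>" using L by (intro card_mono) auto
        then have "real (card (\<L> - \<L>h)) \<le> exp (e1 * s)" using L by (simp add: s_def)
        then show ?thesis unfolding V(4) by (intro mult_right_mono) auto
      qed
      also have "\<dots> = real q ^ n * exp (- cq * s) * exp (- k * s)"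
        by (simp add: k_def exp_add[symmetric] algebra_simps)
      also have "\<dots> \<le> real q ^ n * exp (- cq * s) * D"
        using elim(2) by (intro mult_left_mono) (auto simp: s_def)
      also have "\<dots> = \<delta> * (real q ^ n * exp (- cq * s - lq))"
        by (simp add: D_def exp_diff exp_minus field_simps)
      also have "\<dots> \<le> \<delta> * real (num_colorings q V E)" using P assms by (intro mult_left_mono) auto
      finally have unc: "real (card {f \<in> proper_colorings q V E. \<forall>\<Lambda>\<in>\<L>h. f \<notin> Pi\<^sub>E V \<Lambda>}) \<le> \<delta> * real (num_colorings q V E)" .
      show "\<exists>\<L>. finite \<L> \<and> real (card \<L>) \<le> exp (\<epsilon> * sqrt m) \<and>
      (\<forall>\<Lambda>\<in>\<L>. valid_labelling V \<Lambda> \<and> cq * (1 - \<epsilon>) * sqrt m \<le> cost V \<Lambda> \<and>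
        (\<exists>i<q. near_bipartite E (sqrt m) \<epsilon> (lab_A V \<Lambda> i) (lab_B V \<Lambda> i))) \<and>
      real (card {f \<in> proper_colorings q V E. \<forall>\<Lambda>\<in>\<L>. f \<notin> Pi\<^sub>E V \<Lambda>}) \<le> \<delta> * real (num_colorings q V E)"
        using fin c heavy unc unfolding s_def by (intro exI[of _ \<L>h] conjI ballI) blast+
    qed
  qed
qed

text \<open>The threshold must satisfy \<open>8 * \<zeta>q < sa\<close>: vertices of too low degree
  for \<open>A\<close> should have at most \<open>card A / 8\<close> neighbours outside
  \<open>A\<close>.\<close>

definition \<zeta>q :: real where "\<zeta>q = sa / 32"

lemma \<zeta>q_pos: "0 < \<zeta>q" using sa_pos by (simp add: \<zeta>q_def)

text \<open>Defined by degrees into a single \<open>B\<close>, and not as a class of some labelling,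
  so that one set serves for all containers at once.\<close>

definition big_nbrs :: "'a set \<Rightarrow> 'a set set \<Rightarrow> real \<Rightarrow> 'a set \<Rightarrow> 'a set" where
  "big_nbrs V E s B = {v \<in> V. \<zeta>q * s \<le> real (card {u \<in> B. {v, u} \<in> E})}"

text \<open>Fix the picture \<open>A0\<close>, \<open>B0\<close> of one labelling. By
  \<open>near_bipartite_overlap\<close> and \<open>c2\<close>, a vertex with
  \<open>\<zeta>q * s\<close> neighbours in \<open>B0\<close> has at least half as many in the large
  side of every other labelling. If its color is not the special one of that labelling, all these
  neighbours lose it. This is a factor \<open>exp (- dq * \<zeta>q * s / 2)\<close>, which by
  \<open>c3\<close> outweighs the number of labellings and the defect in their costs.\<close>

lemma eventually_core:
  fixes \<theta> \<epsilon> \<delta> :: real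
  assumes "0 < \<theta>" "0 < \<epsilon>" "\<epsilon> \<le> 1" "0 < \<delta>" "\<delta> \<le> 1"
    and c1: "(sa + \<epsilon>)\<^sup>2 < 1 - 2 * \<epsilon>" and c2: "(sb + \<epsilon>) - (1 - 2 * \<epsilon>) / (sa + \<epsilon>) \<le> \<zeta>q / 2"
    and c3: "(1 + cq) * \<epsilon> \<le> \<zeta>q * dq / 4"
  shows "\<forall>\<^sub>F m in sequentially. \<forall>n V E. (sa + sb + \<theta>) * sqrt m \<le> real n \<and> maximizes_colorings q n m V E \<longrightarrow>
    (\<exists>A0 B0. A0 \<subseteq> V \<and> B0 \<subseteq> V \<and> near_bipartite E (sqrt m) \<epsilon> A0 B0 \<and>
      real (card {f \<in> proper_colorings q V E. \<not> (\<exists>i<q. \<forall>v\<in>big_nbrs V E (sqrt m) B0. f v = i)})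
        \<le> \<delta> * real (num_colorings q V E))"
proof -
  define k where "k = \<zeta>q * dq / 4"
  have k: "0 < k" using \<zeta>q_pos dq_pos by (simp add: k_def)
  define D where "D = \<delta> / 2 * exp (- lq)"
  have D: "0 < D" using assms by (simp add: D_def)
  have ev: "\<forall>\<^sub>F m in sequentially. (Cq * sqrt (real m) * real q) * exp (- k * sqrt (real m)) \<le> D"
    using k D Cq_pos by real_asymp
  have ev2: "\<forall>\<^sub>F m in sequentially. 2 \<le> \<theta> * sqrt (real m)" using assms(1) by real_asymp
  have \<delta>2: "0 < \<delta> / 2" using assms by simp
  show ?thesis
    using eventually_splits[OF assms(1-3) \<delta>2] ev ev2 eventually_ge_at_top[of 1]
  proof eventually_elim
    case (elim m)
    show ?case
    proof (intro allI impI)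
      fix n V E assume H: "(sa + sb + \<theta>) * sqrt m \<le> real n \<and> maximizes_colorings q n m V E"
      then have V: "finite V" "E \<subseteq> [V]\<^bsup>2\<^esup>" "card E = m" "card V = n" by (auto simp: maximizes_colorings_def nm_graph_def)
      have finE: "finite E" using V finite_imp_finite_nsets finite_subset by metis
      define s where "s = sqrt m"
      have s: "0 < s" "s\<^sup>2 = m" using elim by (auto simp: s_def)
      have U: "real (card (\<Union>E)) \<le> Cq * s" unfolding s_def using H elim by (intro maximizer_nonisolated) auto
      have P: "real q ^ n * exp (- cq * s - lq) \<le> num_colorings q V E"
        unfolding s_def using H elim by (intro maximizer_lower_bound) auto
      have "0 < real q ^ n * exp (- cq * s - lq)" using q3 by simp
      then have P0: "0 < real (num_colorings q V E)" using P by linarith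
      obtain \<L> where L: "finite \<L> \<and> real (card \<L>) \<le> exp (\<epsilon> * sqrt m) \<and>
      (\<forall>\<Lambda>\<in>\<L>. valid_labelling V \<Lambda> \<and> cq * (1 - \<epsilon>) * sqrt m \<le> cost V \<Lambda> \<and>
        (\<exists>i<q. near_bipartite E (sqrt m) \<epsilon> (lab_A V \<Lambda> i) (lab_B V \<Lambda> i))) \<and>
      real (card {f \<in> proper_colorings q V E. \<forall>\<Lambda>\<in>\<L>. f \<notin> Pi\<^sub>E V \<Lambda>}) \<le> \<delta> / 2 * real (num_colorings q V E)"
        using elim(1)[rule_format, OF H] by (elim exE)
      then have finL: "finite \<L>" and cardL: "real (card \<L>) \<le> exp (\<epsilon> * s)"
        and unc: "real (card {f \<in> proper_colorings q V E. \<forall>\<Lambda>\<in>\<L>. f \<notin> Pi\<^sub>E V \<Lambda>}) \<le> \<delta> / 2 * real (num_colorings q V E)"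
        by (auto simp: s_def)
      have "\<forall>\<Lambda>\<in>\<L>. \<exists>i. i < q \<and> near_bipartite E s \<epsilon> (lab_A V \<Lambda> i) (lab_B V \<Lambda> i)" using L by (auto simp: s_def)
      then obtain \<iota> where \<iota>: "\<And>\<Lambda>. \<Lambda> \<in> \<L> \<Longrightarrow> \<iota> \<Lambda> < q \<and> near_bipartite E s \<epsilon> (lab_A V \<Lambda> (\<iota> \<Lambda>)) (lab_B V \<Lambda> (\<iota> \<Lambda>))"
        by (auto dest!: bchoice)
      have "\<L> \<noteq> {}"
      proof
        assume "\<L> = {}"
        then have "real (num_colorings q V E) \<le> \<delta> / 2 * real (num_colorings q V E)"
          using unc by (simp add: num_colorings_def)
        also have "\<dots> \<le> 1 / 2 * real (num_colorings q V E)" using assms P0 by (intro mult_right_mono) auto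
        finally show False using P0 by simp
      qed
      then obtain \<Lambda>0 where L0: "\<Lambda>0 \<in> \<L>" by blast
      define A0 where "A0 = lab_A V \<Lambda>0 (\<iota> \<Lambda>0)"
      define B0 where "B0 = lab_B V \<Lambda>0 (\<iota> \<Lambda>0)"
      have nb0: "near_bipartite E s \<epsilon> A0 B0" using \<iota>[OF L0] by (simp add: A0_def B0_def)
      define A where "A = big_nbrs V E s B0"
      define N where "N = (\<lambda>\<Lambda> v. {u \<in> lab_B V \<Lambda> (\<iota> \<Lambda>). {v, u} \<in> E})"
      have finA: "finite A" using V(1) by (simp add: A_def big_nbrs_def)
      have finB0: "finite B0" using nb0 by (simp add: near_bipartite_def)
      have N: "\<zeta>q / 2 * s \<le> card (N \<Lambda> v)" if \<Lambda>: "\<Lambda> \<in> \<L>" and v: "v \<in> A" for \<Lambda> v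
      proof -
        let ?B = "lab_B V \<Lambda> (\<iota> \<Lambda>)"
        have "(1 - 2 * \<epsilon>) / (sa + \<epsilon>) * s \<le> card (B0 \<inter> ?B)"
          using near_bipartite_overlap[OF finE _ s(1) nb0 conjunct2[OF \<iota>[OF \<Lambda>]] assms(2) c1] V(3) s(2) by simp
        moreover have "card (B0 \<inter> ?B) + card (B0 - ?B) = card B0"
          using card_Int_Diff[OF finB0, of ?B] by simp
        then have "real (card B0) = real (card (B0 \<inter> ?B)) + real (card (B0 - ?B))" by linarith
        moreover have "real (card B0) \<le> (sb + \<epsilon>) * s" using nb0 by (auto simp: near_bipartite_def algebra_simps abs_le_iff)
        ultimately have "real (card (B0 - ?B)) \<le> ((sb + \<epsilon>) - (1 - 2 * \<epsilon>) / (sa + \<epsilon>)) * s"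
          by (simp add: left_diff_distrib)
        also have "\<dots> \<le> \<zeta>q / 2 * s" using c2 s by (intro mult_right_mono) auto
        finally have 1: "real (card (B0 - ?B)) \<le> \<zeta>q / 2 * s" .
        have "finite (lab_B V \<Lambda> (\<iota> \<Lambda>))" using V(1) by (simp add: lab_B_def)
        then have "card {u \<in> B0. {v, u} \<in> E} \<le> card (N \<Lambda> v \<union> (B0 - ?B))"
          using finB0 by (intro card_mono) (auto simp: N_def)
        also have "\<dots> \<le> card (N \<Lambda> v) + card (B0 - ?B)" by (rule card_Un_le)
        finally have "real (card {u \<in> B0. {v, u} \<in> E}) \<le> real (card (N \<Lambda> v)) + real (card (B0 - ?B))" by linarith
        moreover have "\<zeta>q * s \<le> real (card {u \<in> B0. {v, u} \<in> E})" using v by (simp add: A_def big_nbrs_def)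
        ultimately show ?thesis using 1 by linarith
      qed
      \<comment> \<open>A coloring that is covered by \<open>\<Lambda>\<close> but not constant on
        \<open>A\<close> gives some \<open>v\<close> in \<open>A\<close> a color \<open>j\<close>
        other than \<open>\<iota> \<Lambda>\<close>. There are few triples and each accounts for few
        colorings.\<close>
      define F where "F = (\<lambda>(\<Lambda>, v, j). {f \<in> proper_colorings q V E. f \<in> Pi\<^sub>E V \<Lambda> \<and> f v = j \<and> j \<noteq> \<iota> \<Lambda>})"
      define w where "w = real q ^ n * exp (- (cq * (1 - \<epsilon>) * s) - \<zeta>q / 2 * s * dq)"
      have finF: "finite (F p)" for p
        unfolding F_def by (cases p) (auto simp: finite_proper_colorings[OF V(1)])
      have Fle: "real (card (F p)) \<le> w" if p: "p \<in> \<L> \<times> A \<times> {..<q}" for p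
      proof -
        obtain \<Lambda> v j where pe: "p = (\<Lambda>, v, j)" "\<Lambda> \<in> \<L>" "v \<in> A" "j < q" using p by auto
        show ?thesis
        proof (cases "j = \<iota> \<Lambda>")
          case True
          then show ?thesis using pe by (simp add: F_def w_def)
        next
          case False
          have "real (card (F p)) \<le> real q ^ card V * exp (- cost V \<Lambda> - card (N \<Lambda> v) * dq)"
          proof (rule card_recoloured_le[OF V(1), where i = "\<iota> \<Lambda>" and j = j])
            show "f \<in> Pi\<^sub>E V \<Lambda> \<and> (\<forall>u\<in>N \<Lambda> v. f u \<noteq> j)" if "f \<in> F p" for f
            proof -
              have "f \<in> Pi\<^sub>E V \<Lambda>" "f v = j" "f \<in> proper_colorings q V E" using that pe by (auto simp: F_def)
              moreover have "f v \<noteq> f u" if "u \<in> N \<Lambda> v" for u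
                using \<open>f \<in> proper_colorings q V E\<close> that by (auto simp: proper_colorings_def N_def)
              ultimately show ?thesis by metis
            qed
          qed (use pe False L \<iota> in \<open>auto simp: N_def\<close>)
          also have "\<dots> \<le> w"
          proof -
            have "\<zeta>q / 2 * s * dq \<le> card (N \<Lambda> v) * dq" using N pe dq_pos by (intro mult_right_mono) auto
            moreover have "cq * (1 - \<epsilon>) * s \<le> cost V \<Lambda>" using L pe by (simp add: s_def)
            ultimately show ?thesis unfolding w_def V(4) by (intro mult_left_mono) auto
          qed
          finally show ?thesis .
        qed
      qed
      let ?unc = "{f \<in> proper_colorings q V E. \<forall>\<Lambda>\<in>\<L>. f \<notin> Pi\<^sub>E V \<Lambda>}"
      let ?bad = "{f \<in> proper_colorings q V E. \<not> (\<exists>i<q. \<forall>v\<in>A. f v = i)}"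
      have AV: "A \<subseteq> V" by (auto simp: A_def big_nbrs_def)
      have sub: "?bad \<subseteq> ?unc \<union> (\<Union>p\<in>\<L> \<times> A \<times> {..<q}. F p)"
      proof
        fix f assume f: "f \<in> ?bad"
        show "f \<in> ?unc \<union> (\<Union>p\<in>\<L> \<times> A \<times> {..<q}. F p)"
        proof (cases "\<exists>\<Lambda>\<in>\<L>. f \<in> Pi\<^sub>E V \<Lambda>")
          case False
          then show ?thesis using f by auto
        next
          case True
          then obtain \<Lambda> where \<Lambda>: "\<Lambda> \<in> \<L>" "f \<in> Pi\<^sub>E V \<Lambda>" by blast
          then obtain v where v: "v \<in> A" "f v \<noteq> \<iota> \<Lambda>" using f \<iota>[of \<Lambda>] by auto
          have "f v < q" using f v AV by (auto simp: proper_colorings_def)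
          then have "f \<in> F (\<Lambda>, v, f v)" "(\<Lambda>, v, f v) \<in> \<L> \<times> A \<times> {..<q}" using f \<Lambda> v by (auto simp: F_def)
          then show ?thesis by blast
        qed
      qed
      have finI: "finite (\<L> \<times> A \<times> {..<q})" using finL finA by auto
      have "card ?bad \<le> card (?unc \<union> (\<Union>p\<in>\<L> \<times> A \<times> {..<q}. F p))"
        using sub finite_proper_colorings[OF V(1)] finI finF by (intro card_mono) auto
      also have "\<dots> \<le> card ?unc + card (\<Union>p\<in>\<L> \<times> A \<times> {..<q}. F p)" by (rule card_Un_le)
      also have "card (\<Union>p\<in>\<L> \<times> A \<times> {..<q}. F p) \<le> (\<Sum>p\<in>\<L> \<times> A \<times> {..<q}. card (F p))" by (rule card_UN_le[OF finI])
      finally have "real (card ?bad) \<le> real (card ?unc) + (\<Sum>p\<in>\<L> \<times> A \<times> {..<q}. real (card (F p)))"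
        by (simp flip: of_nat_sum of_nat_add)
      also have "(\<Sum>p\<in>\<L> \<times> A \<times> {..<q}. real (card (F p))) \<le> (\<Sum>p\<in>\<L> \<times> A \<times> {..<q}. w)" using Fle by (rule sum_mono)
      also have "\<dots> = real (card \<L>) * (real (card A) * real q) * w" by (simp add: card_cartesian_product)
      also have "\<dots> \<le> exp (\<epsilon> * s) * (Cq * s * real q) * w"
      proof -
        have "A \<subseteq> \<Union>E"
        proof
          fix v assume "v \<in> A"
          then have "\<zeta>q * s \<le> real (card {u \<in> B0. {v, u} \<in> E})" by (simp add: A_def big_nbrs_def)
          moreover have "0 < \<zeta>q * s" using \<zeta>q_pos s by simp
          ultimately have "0 < real (card {u \<in> B0. {v, u} \<in> E})" by linarith
          then have "{u \<in> B0. {v, u} \<in> E} \<noteq> {}" by (metis card.empty less_irrefl of_nat_0)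
          then show "v \<in> \<Union>E" by blast
        qed
        moreover have "\<Union>E \<subseteq> V" using V(2) by (auto simp: nsets_def)
        then have "finite (\<Union>E)" using V(1) by (rule finite_subset)
        ultimately have "card A \<le> card (\<Union>E)" by (intro card_mono)
        then have "real (card A) \<le> Cq * s" using U by simp
        then have "real (card \<L>) * (real (card A) * real q) \<le> exp (\<epsilon> * s) * (Cq * s * real q)"
          using cardL by (intro mult_mono) auto
        then show ?thesis by (rule mult_right_mono) (simp add: w_def)
      qed
      also have "\<dots> \<le> \<delta> / 2 * real (num_colorings q V E)"
      proof -
        have "exp (\<epsilon> * s) * exp (- (cq * (1 - \<epsilon>) * s) - \<zeta>q / 2 * s * dq) = exp (- cq * s) * exp (((1 + cq) * \<epsilon> - \<zeta>q * dq / 2) * s)"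
          by (simp add: exp_add[symmetric] algebra_simps)
        also have "\<dots> \<le> exp (- cq * s) * exp (- k * s)"
        proof -
          have "(1 + cq) * \<epsilon> - \<zeta>q * dq / 2 \<le> - k" using c3 by (simp add: k_def)
          then have "((1 + cq) * \<epsilon> - \<zeta>q * dq / 2) * s \<le> - k * s" using s by (intro mult_right_mono) auto
          then show ?thesis by (intro mult_left_mono) auto
        qed
        finally have 1: "exp (\<epsilon> * s) * exp (- (cq * (1 - \<epsilon>) * s) - \<zeta>q / 2 * s * dq) \<le> exp (- cq * s) * exp (- k * s)" .
        have "exp (\<epsilon> * s) * (Cq * s * real q) * w = (Cq * s * real q * real q ^ n) * (exp (\<epsilon> * s) * exp (- (cq * (1 - \<epsilon>) * s) - \<zeta>q / 2 * s * dq))"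
          unfolding w_def by simp
        also have "\<dots> \<le> (Cq * s * real q * real q ^ n) * (exp (- cq * s) * exp (- k * s))"
          using 1 Cq_pos s by (intro mult_left_mono) auto
        also have "\<dots> = (real q ^ n * exp (- cq * s)) * ((Cq * s * real q) * exp (- k * s))" by simp
        also have "\<dots> \<le> (real q ^ n * exp (- cq * s)) * D"
          using elim(2) by (intro mult_left_mono) (auto simp: s_def)
        also have "\<dots> = \<delta> / 2 * (real q ^ n * exp (- cq * s - lq))"
          by (simp add: D_def exp_diff exp_minus field_simps)
        also have "\<dots> \<le> \<delta> / 2 * real (num_colorings q V E)" using P assms by (intro mult_left_mono) auto
        finally show ?thesis .
      qed
      finally have "real (card ?bad) \<le> \<delta> * real (num_colorings q V E)" using unc by simp
      moreover have "A0 \<subseteq> V" "B0 \<subseteq> V" by (auto simp: A0_def B0_def lab_A_def lab_B_def)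
      ultimately show "\<exists>A0 B0. A0 \<subseteq> V \<and> B0 \<subseteq> V \<and> near_bipartite E (sqrt m) \<epsilon> A0 B0 \<and>
        real (card {f \<in> proper_colorings q V E. \<not> (\<exists>i<q. \<forall>v\<in>big_nbrs V E (sqrt m) B0. f v = i)})
        \<le> \<delta> * real (num_colorings q V E)"
        using nb0 unfolding A_def s_def by blast
    qed
  qed
qed

end

section \<open>Edges outside the bipartite part\<close>

definition nbhd :: "'a set set \<Rightarrow> 'a set \<Rightarrow> 'a set" where
  "nbhd E A = {y. \<exists>x\<in>A. {x, y} \<in> E}"

lemma nbhd_subset: "E \<subseteq> [V]\<^bsup>2\<^esup> \<Longrightarrow> nbhd E A \<subseteq> V"
  by (auto simp: nbhd_def nsets_def)

section \<open>Colorings that are constant on \<open>A\<close>\<close>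

definition colorings_with :: "nat \<Rightarrow> 'a set \<Rightarrow> 'a set set \<Rightarrow> 'a set \<Rightarrow> nat \<Rightarrow> ('a \<Rightarrow> nat) set" where
  "colorings_with q V E A i = {f \<in> proper_colorings q V E. \<forall>v\<in>A. f v = i}"

lemma colorings_with_subset_list_colorings:
  assumes "E \<subseteq> [V]\<^bsup>2\<^esup>" "A \<subseteq> V"
  shows "colorings_with q V E A i \<subseteq> list_colorings V E (forced_lists q i A (nbhd E A))"
proof
  fix f assume f: "f \<in> colorings_with q V E A i"
  then have pc: "f \<in> proper_colorings q V E" and A: "\<And>v. v \<in> A \<Longrightarrow> f v = i"
    by (auto simp: colorings_with_def)
  have "f v \<noteq> i" if v: "v \<in> nbhd E A" for v
  proof -
    obtain x where x: "x \<in> A" "{x, v} \<in> E" using v by (auto simp: nbhd_def)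
    then have "f x \<noteq> f v" using pc unfolding proper_colorings_def by blast
    then show ?thesis using A[OF x(1)] by simp
  qed
  then show "f \<in> list_colorings V E (forced_lists q i A (nbhd E A))"
    using pc A by (auto simp: proper_colorings_def list_colorings_def forced_lists_def PiE_iff)
qed

text \<open>A vertex of \<open>X1\<close> has the full list and loses one color; a vertex of
  \<open>X2\<close> lies in the neighbourhood of \<open>A\<close> and loses a second one.
  \<open>X1\<close> is deleted before \<open>X2\<close> because the neighbours of \<open>X1\<close>
  may lie in \<open>X2\<close>, while those provided for \<open>X2\<close> lie in
  \<open>nbhd E A\<close> and so never in \<open>X1\<close>.\<close>

lemma card_colorings_with_le:
  assumes V: "finite V" "E \<subseteq> [V]\<^bsup>2\<^esup>" and A: "A \<subseteq> V" "A \<inter> nbhd E A = {}" and i: "i < q"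
    and X1: "X1 \<subseteq> V - A - nbhd E A" "\<And>x. x \<in> X1 \<Longrightarrow> \<exists>w. w \<notin> X1 \<and> {x, w} \<in> E"
    and X2: "X2 \<subseteq> nbhd E A" "\<And>x. x \<in> X2 \<Longrightarrow> \<exists>w. w \<in> nbhd E A - X2 \<and> {x, w} \<in> E"
  shows "card (colorings_with q V E A i) \<le>
    (q - 1) ^ (card (nbhd E A) - card X2) * q ^ (card V - card A - card (nbhd E A) - card X1) * (q - 2) ^ card X2 * (q - 1) ^ card X1"
proof -
  let ?B = "nbhd E A"
  let ?\<Lambda> = "forced_lists q i A ?B"
  have BV: "?B \<subseteq> V" using nbhd_subset V(2) by blast
  have finB: "finite ?B" using BV V(1) by (rule finite_subset)
  have X2V: "X2 \<subseteq> V - X1" using X2(1) X1(1) BV by blast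
  have fin: "finite X1" "finite X2"
    using X1(1) X2V V(1) by (auto intro: finite_subset)
  have inV: "x \<in> V \<and> w \<in> V" if "{x, w} \<in> E" for x w using that V(2) by (auto simp: nsets_def)
  obtain w1 where w1: "\<And>x. x \<in> X1 \<Longrightarrow> w1 x \<notin> X1 \<and> {x, w1 x} \<in> E" using X1(2) by metis
  obtain w2 where w2: "\<And>x. x \<in> X2 \<Longrightarrow> w2 x \<in> ?B - X2 \<and> {x, w2 x} \<in> E" using X2(2) by metis
  have "card (colorings_with q V E A i) \<le> card (list_colorings V E ?\<Lambda>)"
    using colorings_with_subset_list_colorings[OF V(2) A(1)] V(1)
    by (intro card_mono finite_list_colorings) auto
  also have "\<dots> \<le> card (list_colorings (V - X1) E ?\<Lambda>) * (\<Prod>x\<in>X1. q - 1)"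
  proof (rule card_list_colorings_delete[where w = w1])
    show "w1 x \<in> V - X1 \<and> {x, w1 x} \<in> E" if "x \<in> X1" for x using w1[OF that] inV by blast
    show "card (?\<Lambda> x - {c}) \<le> q - 1" if x: "x \<in> X1" and c: "c \<in> ?\<Lambda> (w1 x)" for x c
    proof -
      have "?\<Lambda> x = {..<q}" using x X1(1) by (auto simp: forced_lists_def)
      moreover have "c < q" using c i by (auto simp: forced_lists_def split: if_splits)
      ultimately show ?thesis by simp
    qed
  qed (use V X1(1) in auto)
  also have "card (list_colorings (V - X1) E ?\<Lambda>) \<le> card (list_colorings (V - X1 - X2) E ?\<Lambda>) * (\<Prod>x\<in>X2. q - 2)"
  proof (rule card_list_colorings_delete[where w = w2])
    show "w2 x \<in> V - X1 - X2 \<and> {x, w2 x} \<in> E" if "x \<in> X2" for x using w2[OF that] inV X1(1) by blast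
    show "card (?\<Lambda> x - {c}) \<le> q - 2" if x: "x \<in> X2" and c: "c \<in> ?\<Lambda> (w2 x)" for x c
    proof -
      have "x \<in> ?B" "w2 x \<in> ?B" "x \<notin> A" "w2 x \<notin> A" using x X2(1) w2[OF x] A(2) by auto
      then have "?\<Lambda> x = {..<q} - {i}" "c < q" "c \<noteq> i" using c by (auto simp: forced_lists_def)
      then show ?thesis using i by (simp add: card_Diff_singleton numeral_2_eq_2)
    qed
  qed (use V X2V in auto)
  also have "card (list_colorings (V - X1 - X2) E ?\<Lambda>) \<le> (\<Prod>v\<in>V - X1 - X2. card (?\<Lambda> v))"
    using V(1) by (intro card_list_colorings_le_prod) auto
  also have "(\<Prod>v\<in>V - X1 - X2. card (?\<Lambda> v)) = (\<Prod>v\<in>V - X1 - X2. card (forced_lists q i A (?B - X2) v))"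
    by (intro prod.cong refl) (auto simp: forced_lists_def)
  also have "\<dots> = (q - 1) ^ card (?B - X2) * q ^ (card (V - X1 - X2) - card A - card (?B - X2))"
    by (rule prod_card_forced_lists) (use V(1) A X1(1) X2(1) BV i in auto)
  also have "card (V - X1 - X2) = card V - card X1 - card X2"
    using fin X1(1) X2V by (subst card_Diff_subset; (subst card_Diff_subset)?) auto
  also have "card (?B - X2) = card ?B - card X2" using fin X2(1) by (intro card_Diff_subset) auto
  also have "card V - card X1 - card X2 - card A - (card ?B - card X2) = card V - card A - card ?B - card X1"
  proof -
    have "card X2 \<le> card ?B" using finB X2(1) by (rule card_mono)
    then show ?thesis by simp
  qed
  finally show ?thesis by (simp add: mult.assoc)
qed

context colouring_params
begin

lemma real_q2_pow: "real (q - 2) ^ k = exp (k * (Lq - lq - dq))"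
proof -
  have "exp (Lq - lq - dq) = exp (Lq - lq) / exp dq" by (rule exp_diff)
  also have "\<dots> = real (q - 2)" using real_q1_pow[of 1] q3 by (simp add: dq_def)
  finally show ?thesis by (metis exp_of_nat_mult)
qed

text \<open>Through this strict inequality an edge inside the large side costs more than one
  additional vertex on that side.\<close>

lemma lq_less_dq: "lq < dq"
proof -
  have "real q / (real q - 1) < real (q - 1) / real (q - 2)"
    using q3 by (simp add: of_nat_diff divide_simps) (simp add: algebra_simps)
  then show ?thesis unfolding lq_def dq_def using q3 by (intro ln_less_cancel_iff[THEN iffD2]) auto
qed

lemma card_colorings_with_le_exp:
  assumes V: "finite V" "E \<subseteq> [V]\<^bsup>2\<^esup>" and A: "A \<subseteq> V" "A \<inter> nbhd E A = {}" and i: "i < q"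
    and X1: "X1 \<subseteq> V - A - nbhd E A" "\<And>x. x \<in> X1 \<Longrightarrow> \<exists>w. w \<notin> X1 \<and> {x, w} \<in> E"
    and X2: "X2 \<subseteq> nbhd E A" "\<And>x. x \<in> X2 \<Longrightarrow> \<exists>w. w \<in> nbhd E A - X2 \<and> {x, w} \<in> E"
  shows "real (card (colorings_with q V E A i)) \<le>
    real q ^ card V * exp (- (real (card A) * Lq) - real (card (nbhd E A)) * lq - real (card X1) * lq - real (card X2) * dq)"
proof -
  let ?B = "nbhd E A"
  define a b x1 x2 n where "a = card A" and "b = card ?B" and "x1 = card X1" and "x2 = card X2" and "n = card V"
  have BV: "?B \<subseteq> V" using nbhd_subset V(2) by blast
  have fin: "finite ?B" "finite A" "finite X1" using BV A(1) X1(1) V(1) by (auto intro: finite_subset)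
  have x2: "x2 \<le> b" unfolding x2_def b_def using fin(1) X2(1) by (rule card_mono)
  have "a + b + x1 = card (A \<union> ?B \<union> X1)"
    unfolding a_def b_def x1_def using fin A(2) X1(1) by (subst card_Un_disjoint; (subst card_Un_disjoint)?) auto
  also have "\<dots> \<le> n" unfolding n_def using V(1) A(1) BV X1(1) by (intro card_mono) auto
  finally have n: "a + b + x1 \<le> n" .
  have "card (colorings_with q V E A i) \<le> (q - 1) ^ (b - x2) * q ^ (n - a - b - x1) * (q - 2) ^ x2 * (q - 1) ^ x1"
    unfolding a_def b_def x1_def x2_def n_def by (rule card_colorings_with_le[OF assms])
  then have "real (card (colorings_with q V E A i)) \<le> real ((q - 1) ^ (b - x2) * q ^ (n - a - b - x1) * (q - 2) ^ x2 * (q - 1) ^ x1)"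
    by (rule of_nat_mono)
  also have "\<dots> = real (q - 1) ^ (b - x2) * real q ^ (n - a - b - x1) * real (q - 2) ^ x2 * real (q - 1) ^ x1"
    by simp
  also have "\<dots> = exp (real (b - x2) * (Lq - lq) + real (n - a - b - x1) * Lq + real x2 * (Lq - lq - dq) + real x1 * (Lq - lq))"
    unfolding real_q1_pow real_q_pow real_q2_pow exp_add ..
  also have "real (b - x2) * (Lq - lq) + real (n - a - b - x1) * Lq + real x2 * (Lq - lq - dq) + real x1 * (Lq - lq)
    = real n * Lq + (- (real a * Lq) - real b * lq - real x1 * lq - real x2 * dq)"
    using n x2 by (simp add: of_nat_diff algebra_simps)
  also have "exp \<dots> = real q ^ n * exp (- (real a * Lq) - real b * lq - real x1 * lq - real x2 * dq)"
    unfolding exp_add[of "real n * Lq"] real_q_pow ..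
  finally show ?thesis unfolding a_def b_def x1_def x2_def n_def .
qed

text \<open>Vertices of \<open>A0 - A\<close> have at most \<open>\<zeta>q * s\<close> neighbours in
  \<open>B0\<close>, so counting edges forces most of \<open>A0\<close> into \<open>A\<close>. The
  edges not at \<open>A0 - A\<close> end in \<open>B0 \<inter> nbhd E A\<close>, which must
  therefore be large. As \<open>e\<close> tends to \<open>0\<close>, \<open>x\<close> tends to
  \<open>sa\<close> and \<open>z\<close> to \<open>sb\<close>.\<close>

lemma near_bipartite_sizes:
  fixes e s :: real
  assumes V: "finite V" "E \<subseteq> [V]\<^bsup>2\<^esup>" and AB: "A0 \<subseteq> V" "B0 \<subseteq> V" and nb: "near_bipartite E s e A0 B0" and s: "0 < s" and e: "0 < e"
  defines "A \<equiv> big_nbrs V E s B0"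
  defines "x \<equiv> ((1 - e) - (sa + e) * \<zeta>q) / (sb + e - \<zeta>q)"
  defines "z \<equiv> ((1 - e) - (sa + e - x) * (sb + e)) / (sa + e)"
  shows "x * s \<le> card (A0 \<inter> A)" "z * s \<le> card (B0 \<inter> nbhd E A)"
proof -
  have fin: "finite A0" "finite B0" using nb by (auto simp: near_bipartite_def)
  have A0: "real (card A0) \<le> (sa + e) * s" and B0: "real (card B0) \<le> (sb + e) * s"
    and edges: "(1 - e) * s\<^sup>2 \<le> real (card (E \<inter> complete_bipartite_edges A0 B0))"
    using nb by (auto simp: near_bipartite_def abs_le_iff algebra_simps)
  define X where "X = real (card (A0 \<inter> A))"
  have split: "real (card A0) = X + real (card (A0 - A))"
    using card_Int_Diff[OF fin(1), of A] by (simp add: X_def)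
  have \<zeta>: "\<zeta>q < sb" "0 < \<zeta>q" using sa_pos sa_less_1 sb_greater_1 by (auto simp: \<zeta>q_def)
  have deg: "real (card {u \<in> B0. {v, u} \<in> E}) \<le> \<zeta>q * s" if "v \<in> A0 - A" for v
    using that AB by (auto simp: A_def big_nbrs_def)
  let ?S = "\<Union>v\<in>A0 - A. (\<lambda>u. {v, u}) ` {u \<in> B0. {v, u} \<in> E}"
  have "E \<inter> complete_bipartite_edges A0 B0 \<subseteq> complete_bipartite_edges (A0 \<inter> A) B0 \<union> ?S"
  proof
    fix d assume "d \<in> E \<inter> complete_bipartite_edges A0 B0"
    then obtain v u where d: "d = {v, u}" "v \<in> A0" "u \<in> B0" "{v, u} \<in> E" by (auto simp: complete_bipartite_edges_def)
    show "d \<in> complete_bipartite_edges (A0 \<inter> A) B0 \<union> ?S"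
    proof (cases "v \<in> A")
      case True then show ?thesis using d unfolding complete_bipartite_edges_def by blast
    next
      case False then show ?thesis using d by blast
    qed
  qed
  then have "card (E \<inter> complete_bipartite_edges A0 B0) \<le> card (complete_bipartite_edges (A0 \<inter> A) B0 \<union> ?S)"
    using fin by (intro card_mono finite_UnI card_complete_bipartite_edges_le(2)) auto
  also have "\<dots> \<le> card (complete_bipartite_edges (A0 \<inter> A) B0) + card ?S" by (rule card_Un_le)
  also have "card (complete_bipartite_edges (A0 \<inter> A) B0) \<le> card (A0 \<inter> A) * card B0"
    using fin by (intro card_complete_bipartite_edges_le(1)) auto
  also have "card ?S \<le> (\<Sum>v\<in>A0 - A. card ((\<lambda>u. {v, u}) ` {u \<in> B0. {v, u} \<in> E}))"
    using fin by (intro card_UN_le) auto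
  also have "\<dots> \<le> (\<Sum>v\<in>A0 - A. card {u \<in> B0. {v, u} \<in> E})"
    using fin by (intro sum_mono card_image_le) auto
  finally have "card (E \<inter> complete_bipartite_edges A0 B0) \<le> card (A0 \<inter> A) * card B0 + (\<Sum>v\<in>A0 - A. card {u \<in> B0. {v, u} \<in> E})"
    by simp
  then have "real (card (E \<inter> complete_bipartite_edges A0 B0)) \<le> real (card (A0 \<inter> A) * card B0 + (\<Sum>v\<in>A0 - A. card {u \<in> B0. {v, u} \<in> E}))"
    by (rule of_nat_mono)
  also have "\<dots> = X * real (card B0) + (\<Sum>v\<in>A0 - A. real (card {u \<in> B0. {v, u} \<in> E}))" by (simp add: X_def)
  also have "(\<Sum>v\<in>A0 - A. real (card {u \<in> B0. {v, u} \<in> E})) \<le> (\<Sum>v\<in>A0 - A. \<zeta>q * s)" using deg by (rule sum_mono)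
  also have "\<dots> = real (card (A0 - A)) * (\<zeta>q * s)" by simp
  also have "\<dots> \<le> ((sa + e) * s - X) * (\<zeta>q * s)" using split A0 \<zeta> s by (intro mult_right_mono) auto
  also have "X * real (card B0) \<le> X * ((sb + e) * s)" using B0 by (intro mult_left_mono) (auto simp: X_def)
  finally have "(1 - e) * s\<^sup>2 \<le> X * ((sb + e) * s) + ((sa + e) * s - X) * (\<zeta>q * s)" using edges by linarith
  then have "s * ((1 - e) * s) \<le> s * (X * (sb + e - \<zeta>q) + (sa + e) * \<zeta>q * s)" by (simp add: power2_eq_square algebra_simps)
  then have "(1 - e) * s \<le> X * (sb + e - \<zeta>q) + (sa + e) * \<zeta>q * s" using s by simp
  then have "((1 - e) - (sa + e) * \<zeta>q) * s \<le> X * (sb + e - \<zeta>q)" by (simp add: algebra_simps)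
  then show X: "x * s \<le> card (A0 \<inter> A)" using \<zeta> e by (simp add: x_def X_def field_simps)
  define Z where "Z = real (card (B0 \<inter> nbhd E A))"
  have "E \<inter> complete_bipartite_edges A0 B0 \<subseteq> complete_bipartite_edges A0 (B0 \<inter> nbhd E A) \<union> complete_bipartite_edges (A0 - A) B0"
  proof
    fix d assume "d \<in> E \<inter> complete_bipartite_edges A0 B0"
    then obtain v u where d: "d = {v, u}" "v \<in> A0" "u \<in> B0" "{v, u} \<in> E" by (auto simp: complete_bipartite_edges_def)
    show "d \<in> complete_bipartite_edges A0 (B0 \<inter> nbhd E A) \<union> complete_bipartite_edges (A0 - A) B0"
    proof (cases "v \<in> A")
      case True
      then have "u \<in> nbhd E A" using d by (auto simp: nbhd_def)
      then show ?thesis using d unfolding complete_bipartite_edges_def by blast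
    next
      case False then show ?thesis using d unfolding complete_bipartite_edges_def by blast
    qed
  qed
  then have "card (E \<inter> complete_bipartite_edges A0 B0) \<le> card (complete_bipartite_edges A0 (B0 \<inter> nbhd E A) \<union> complete_bipartite_edges (A0 - A) B0)"
    using fin by (intro card_mono finite_UnI card_complete_bipartite_edges_le(2)) auto
  also have "\<dots> \<le> card (complete_bipartite_edges A0 (B0 \<inter> nbhd E A)) + card (complete_bipartite_edges (A0 - A) B0)" by (rule card_Un_le)
  also have "\<dots> \<le> card A0 * card (B0 \<inter> nbhd E A) + card (A0 - A) * card B0"
    using fin by (intro add_mono card_complete_bipartite_edges_le(1)) auto
  finally have "real (card (E \<inter> complete_bipartite_edges A0 B0)) \<le> real (card A0 * card (B0 \<inter> nbhd E A) + card (A0 - A) * card B0)"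
    by (rule of_nat_mono)
  also have "\<dots> = real (card A0) * Z + real (card (A0 - A)) * real (card B0)" by (simp add: Z_def)
  also have "\<dots> \<le> ((sa + e) * s) * Z + ((sa + e - x) * s) * ((sb + e) * s)"
  proof (intro add_mono mult_mono)
    show "real (card (A0 - A)) \<le> (sa + e - x) * s" using split A0 X by (simp add: X_def algebra_simps)
    then show "0 \<le> (sa + e - x) * s" by (rule order.trans[rotated]) simp
    show "real (card A0) \<le> (sa + e) * s" "real (card B0) \<le> (sb + e) * s" by (fact A0 B0)+
    show "0 \<le> (sa + e) * s" using sa_pos e s by simp
  qed (auto simp: Z_def)
  finally have "(1 - e) * s\<^sup>2 \<le> ((sa + e) * s) * Z + ((sa + e - x) * s) * ((sb + e) * s)" using edges by linarith
  then have "s * ((1 - e) * s) \<le> s * ((sa + e) * Z + ((sa + e - x) * (sb + e)) * s)" by (simp add: power2_eq_square algebra_simps)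
  then have "(1 - e) * s \<le> (sa + e) * Z + ((sa + e - x) * (sb + e)) * s" using s by simp
  then have "((1 - e) - (sa + e - x) * (sb + e)) * s \<le> (sa + e) * Z" by (simp add: algebra_simps)
  then show "z * s \<le> card (B0 \<inter> nbhd E A)" using sa_pos e by (simp add: z_def Z_def field_simps)
qed

lemma num_colorings_good_le:
  assumes V: "finite V" and d: "0 \<le> d" "d < 1"
    and bad: "real (card {f \<in> proper_colorings q V E. \<not> (\<exists>i<q. \<forall>v\<in>A. f v = i)}) \<le> d * real (num_colorings q V E)"
  shows "(1 - d) * real (num_colorings q V E) \<le> (\<Sum>i<q. real (card (colorings_with q V E A i)))"
proof -
  let ?bad = "{f \<in> proper_colorings q V E. \<not> (\<exists>i<q. \<forall>v\<in>A. f v = i)}"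
  have fin: "finite (proper_colorings q V E)" by (rule finite_proper_colorings[OF V])
  have "proper_colorings q V E \<subseteq> ?bad \<union> (\<Union>i<q. colorings_with q V E A i)"
    by (auto simp: colorings_with_def)
  then have "card (proper_colorings q V E) \<le> card (?bad \<union> (\<Union>i<q. colorings_with q V E A i))"
    using fin by (intro card_mono) (auto simp: colorings_with_def)
  also have "\<dots> \<le> card ?bad + card (\<Union>i<q. colorings_with q V E A i)" by (rule card_Un_le)
  also have "\<dots> \<le> card ?bad + (\<Sum>i<q. card (colorings_with q V E A i))"
    by (intro add_left_mono card_UN_le) simp
  finally have "real (num_colorings q V E) \<le> real (card ?bad + (\<Sum>i<q. card (colorings_with q V E A i)))"
    unfolding num_colorings_def by (rule of_nat_mono)
  then show ?thesis using bad by (simp add: algebra_simps)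
qed

text \<open>Counting edges bounds \<open>A\<close> and its neighbourhood from below. The upper
  bounds come from colorings: those constant on \<open>A\<close> number at most
  \<open>q ^ n * exp (Lq - a * Lq - b * lq - r * lq)\<close>, with \<open>r\<close> at least half
  the number of further nonisolated vertices, and the lower bound for maximizers forces
  \<open>a * Lq + b * lq + r * lq <= (cq + e) * s\<close>. As \<open>e\<close> tends to
  \<open>0\<close>, the bounds meet at \<open>sa\<close>, \<open>sb\<close> and
  \<open>0\<close>.\<close>

lemma eventually_structure:
  fixes \<theta> \<epsilon> :: real
  assumes "0 < \<theta>" "0 < \<epsilon>"
  shows "\<forall>\<^sub>F m in sequentially. \<forall>n V E. (sa + sb + \<theta>) * sqrt m \<le> real n \<and> maximizes_colorings q n m V E \<longrightarrow>
    (\<exists>A\<subseteq>V. A \<noteq> {} \<and> A \<inter> nbhd E A = {} \<and> \<bar>real (card A) - sa * sqrt m\<bar> \<le> \<epsilon> * sqrt m \<and>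
      \<bar>real (card (nbhd E A)) - sb * sqrt m\<bar> \<le> \<epsilon> * sqrt m \<and>
      (\<forall>v\<in>V - A. 8 * card {w\<in>V - A. {v, w} \<in> E} \<le> card A) \<and>
      real (num_colorings q V E) \<le> (1 + \<epsilon>) * (\<Sum>i<q. real (card (colorings_with q V E A i))))"
proof -
  define x where "x = (\<lambda>e. ((1 - e) - (sa + e) * \<zeta>q) / (sb + e - \<zeta>q))"
  define z where "z = (\<lambda>e. ((1 - e) - (sa + e - x e) * (sb + e)) / (sa + e))"
  \<comment> \<open>In units of \<open>sqrt m\<close>, the functions \<open>xU\<close>,
    \<open>zU\<close> and \<open>vU\<close> bound from above the sizes of \<open>A\<close>, of its
    neighbourhood and of the set of all other nonisolated vertices. The \<open>2\<close> in
    \<open>vU\<close> is there because only half of the latter are known to lose a color.\<close>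
  define xU where "xU = (\<lambda>e. (cq + e - z e * lq) / Lq)"
  define zU where "zU = (\<lambda>e. (cq + e - x e * Lq) / lq)"
  define vU where "vU = (\<lambda>e. 2 * (cq + e - x e * Lq - z e * lq) / lq)"
  have \<zeta>: "\<zeta>q < sb" "0 < \<zeta>q" using sa_pos sa_less_1 sb_greater_1 by (auto simp: \<zeta>q_def)
  have lx: "(x \<longlongrightarrow> sa) (at_right 0)"
  proof -
    have "(1 - sa * \<zeta>q) / (sb - \<zeta>q) = sa" using \<zeta> sa_sb by (simp add: field_simps)
    then show ?thesis unfolding x_def using \<zeta> by (auto intro!: tendsto_eq_intros)
  qed
  have lz: "(z \<longlongrightarrow> sb) (at_right 0)"
  proof -
    have "1 / sa = sb" using sa_pos sa_sb by (simp add: field_simps)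
    then show ?thesis unfolding z_def using sa_pos by (auto intro!: tendsto_eq_intros lx)
  qed
  have lxU: "(xU \<longlongrightarrow> sa) (at_right 0)"
  proof -
    have "(cq - sb * lq) / Lq = sa" using Lq_pos sa_Lq sb_lq by (simp add: field_simps)
    then show ?thesis unfolding xU_def using Lq_pos by (auto intro!: tendsto_eq_intros lz)
  qed
  have lzU: "(zU \<longlongrightarrow> sb) (at_right 0)"
  proof -
    have "(cq - sa * Lq) / lq = sb" using lq_pos sa_Lq sb_lq by (simp add: field_simps)
    then show ?thesis unfolding zU_def using lq_pos by (auto intro!: tendsto_eq_intros lx)
  qed
  have lvU: "(vU \<longlongrightarrow> 0) (at_right 0)"
  proof -
    have "cq - sa * Lq - sb * lq = 0" using sa_Lq sb_lq by (simp add: field_simps)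
    then show ?thesis unfolding vU_def using lq_pos by (auto intro!: tendsto_eq_intros lx lz)
  qed
  have l8: "((\<lambda>e. x e - 8 * (\<zeta>q + (zU e - z e) + vU e)) \<longlongrightarrow> sa - 8 * \<zeta>q) (at_right 0)"
    by (auto intro!: tendsto_eq_intros lx lz lzU lvU)
  have lc1: "((\<lambda>e. (1 - 2 * e) - (sa + e)\<^sup>2) \<longlongrightarrow> 1 - sa\<^sup>2) (at_right 0)"
    by (auto intro!: tendsto_eq_intros)
  have lc2: "((\<lambda>e. (sb + e) - (1 - 2 * e) / (sa + e)) \<longlongrightarrow> 0) (at_right 0)"
  proof -
    have "1 / sa = sb" using sa_pos sa_sb by (simp add: field_simps)
    then show ?thesis using sa_pos by (auto intro!: tendsto_eq_intros)
  qed
  have lc3: "((\<lambda>e. (1 + cq) * e) \<longlongrightarrow> 0) (at_right 0)" by (auto intro!: tendsto_eq_intros)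
  have sa2: "sa\<^sup>2 < 1" using sa_pos sa_less_1 mult_strict_mono[of sa 1 sa 1] by (simp add: power2_eq_square)
  have "eventually (\<lambda>e. sa - \<epsilon> < x e \<and> sb - \<epsilon> < z e \<and> xU e < sa + \<epsilon> \<and> zU e < sb + \<epsilon> \<and> 0 < x e \<and>
     0 < x e - 8 * (\<zeta>q + (zU e - z e) + vU e) \<and> 0 < (1 - 2 * e) - (sa + e)\<^sup>2 \<and>
     (sb + e) - (1 - 2 * e) / (sa + e) < \<zeta>q / 2 \<and> (1 + cq) * e < \<zeta>q * dq / 4 \<and> 0 < e \<and> e < 1) (at_right 0)"
    using assms \<zeta> dq_pos sa_pos sa2
    by (intro eventually_conj order_tendstoD(1)[OF lx] order_tendstoD(1)[OF lz] order_tendstoD(2)[OF lxU] order_tendstoD(2)[OF lzU]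
        order_tendstoD(1)[OF l8] order_tendstoD(1)[OF lc1] order_tendstoD(2)[OF lc2] order_tendstoD(2)[OF lc3])
       (auto simp: eventually_at_right_less \<zeta>q_def intro: eventually_at_rightI[of 0 1])
  then obtain e where e: "sa - \<epsilon> < x e" "sb - \<epsilon> < z e" "xU e < sa + \<epsilon>" "zU e < sb + \<epsilon>" "0 < x e"
     "0 < x e - 8 * (\<zeta>q + (zU e - z e) + vU e)" "0 < (1 - 2 * e) - (sa + e)\<^sup>2"
     "(sb + e) - (1 - 2 * e) / (sa + e) < \<zeta>q / 2" "(1 + cq) * e < \<zeta>q * dq / 4" "0 < e" "e < 1"
    using eventually_happens' trivial_limit_at_right_real by blast
  define \<delta> where "\<delta> = \<epsilon> / (1 + \<epsilon>)"
  have \<delta>: "0 < \<delta>" "\<delta> < 1" "(1 - \<delta>) * (1 + \<epsilon>) = 1" using assms by (auto simp: \<delta>_def field_simps)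
  define D where "D = lq + Lq - ln (1 - \<delta>)"
  have ev: "\<forall>\<^sub>F m in sequentially. D \<le> e * sqrt (real m)" using e(10) by real_asymp
  have ev2: "\<forall>\<^sub>F m in sequentially. 2 \<le> \<theta> * sqrt (real m)" using assms(1) by real_asymp
  have core: "\<forall>\<^sub>F m in sequentially. \<forall>n V E. (sa + sb + \<theta>) * sqrt m \<le> real n \<and> maximizes_colorings q n m V E \<longrightarrow>
    (\<exists>A0 B0. A0 \<subseteq> V \<and> B0 \<subseteq> V \<and> near_bipartite E (sqrt m) e A0 B0 \<and>
      real (card {f \<in> proper_colorings q V E. \<not> (\<exists>i<q. \<forall>v\<in>big_nbrs V E (sqrt m) B0. f v = i)})
        \<le> \<delta> * real (num_colorings q V E))"
    using assms e \<delta> by (intro eventually_core) auto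
  show ?thesis
    using core ev ev2 eventually_ge_at_top[of 1]
  proof eventually_elim
    case (elim m)
    show ?case
    proof (intro allI impI)
      fix n V E assume H: "(sa + sb + \<theta>) * sqrt m \<le> real n \<and> maximizes_colorings q n m V E"
      then have V: "finite V" "E \<subseteq> [V]\<^bsup>2\<^esup>" "card E = m" "card V = n" by (auto simp: maximizes_colorings_def nm_graph_def)
      define s where "s = sqrt m"
      have s: "0 < s" "s\<^sup>2 = m" using elim by (auto simp: s_def)
      have P: "real q ^ n * exp (- cq * s - lq) \<le> num_colorings q V E"
        unfolding s_def using H elim by (intro maximizer_lower_bound) auto
      have "0 < real q ^ n * exp (- cq * s - lq)" using q3 by simp
      then have P0: "0 < real (num_colorings q V E)" using P by linarith
      obtain A0 B0 where AB: "A0 \<subseteq> V" "B0 \<subseteq> V" "near_bipartite E s e A0 B0"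
        and bad: "real (card {f \<in> proper_colorings q V E. \<not> (\<exists>i<q. \<forall>v\<in>big_nbrs V E s B0. f v = i)}) \<le> \<delta> * real (num_colorings q V E)"
        using elim(1)[rule_format, OF H] unfolding s_def by blast
      define A where "A = big_nbrs V E s B0"
      define B where "B = nbhd E A"
      define a b where "a = real (card A)" and "b = real (card B)"
      have sizes: "x e * s \<le> card (A0 \<inter> A)" "z e * s \<le> card (B0 \<inter> nbhd E A)"
        unfolding x_def z_def A_def by (rule near_bipartite_sizes[OF V(1,2) AB s(1) e(10)])+
      have AV: "A \<subseteq> V" by (auto simp: A_def big_nbrs_def)
      have BV: "B \<subseteq> V" unfolding B_def using V(2) by (rule nbhd_subset)
      have finA: "finite A" and finB: "finite B" using AV BV V(1) by (auto intro: finite_subset)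
      have a_ge: "x e * s \<le> a"
      proof -
        have "card (A0 \<inter> A) \<le> card A" using finA by (intro card_mono) auto
        then show ?thesis using sizes(1) by (simp add: a_def)
      qed
      have b_ge: "z e * s \<le> b"
      proof -
        have "card (B0 \<inter> B) \<le> card B" using finB by (intro card_mono) auto
        then show ?thesis using sizes(2) by (simp add: b_def B_def)
      qed
      have "0 < x e * s" using e s by simp
      then have a0: "A \<noteq> {}" using a_ge by (auto simp: a_def)
      have good: "(1 - \<delta>) * real (num_colorings q V E) \<le> (\<Sum>i<q. real (card (colorings_with q V E A i)))"
        using bad \<delta> by (intro num_colorings_good_le V) (auto simp: A_def)
      have indep: "A \<inter> B = {}"
      \<comment> \<open>An edge inside \<open>A\<close> would leave no coloring constant on
        \<open>A\<close>, yet these make up at least a share \<open>1 - \<delta>\<close> of all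
        colorings.\<close>
      proof (rule ccontr)
        assume "A \<inter> B \<noteq> {}"
        then obtain u v where uv: "u \<in> A" "v \<in> A" "{u, v} \<in> E" by (auto simp: B_def nbhd_def)
        have "colorings_with q V E A i = {}" for i
        proof -
          have "f \<notin> colorings_with q V E A i" for f
          proof
            assume "f \<in> colorings_with q V E A i"
            then have "f u = i" "f v = i" "f u \<noteq> f v"
              using uv unfolding colorings_with_def proper_colorings_def by blast+
            then show False by simp
          qed
          then show ?thesis by blast
        qed
        then have "(1 - \<delta>) * real (num_colorings q V E) \<le> 0" using good by simp
        moreover have "0 < (1 - \<delta>) * real (num_colorings q V E)" using \<delta> P0 by simp
        ultimately show False by simp
      qed
      define V2 where "V2 = \<Union>E - A - B"
      have UV: "\<Union>E \<subseteq> V" using V(2) by (auto simp: nsets_def)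
      have V2V: "V2 \<subseteq> V - A - B" using UV by (auto simp: V2_def)
      have fin2: "finite V2" using V2V V(1) by (auto intro: finite_subset)
      have nl: "{w} \<notin> E" for w using V(2) by (auto simp: nsets_def)
      have nb: "\<exists>w. {u, w} \<in> E" if u: "u \<in> V2" for u
      proof -
        obtain d where d: "d \<in> E" "u \<in> d" using u by (auto simp: V2_def)
        then have "d \<in> [V]\<^bsup>2\<^esup>" using V(2) by blast
        then obtain p r where pr: "d = {p, r}" by (auto simp: nsets_def card_2_iff)
        then have "{p, r} \<in> E" "{r, p} \<in> E" using d(1) by (simp_all add: insert_commute)
        moreover have "u = p \<or> u = r" using d(2) pr by simp
        ultimately show ?thesis by blast
      qed
      obtain X where X: "X \<subseteq> V2" "card V2 \<le> 2 * card X" "\<And>x. x \<in> X \<Longrightarrow> \<exists>w. w \<notin> X \<and> {x, w} \<in> E"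
        by (rule half_with_outside_neighbours[OF fin2 nb nl]) (assumption | blast)+
      define r where "r = real (card X)"
      have Z: "real (card (colorings_with q V E A i)) \<le> real q ^ n * exp (- (a * Lq) - b * lq - r * lq)" if "i < q" for i
        using card_colorings_with_le_exp[OF V(1,2) AV indep[unfolded B_def] that, of X "{}"] X V2V V(4)
        by (simp add: a_def b_def B_def r_def)
      have "(1 - \<delta>) * (real q ^ n * exp (- cq * s - lq)) \<le> (1 - \<delta>) * real (num_colorings q V E)"
        using P \<delta> by (intro mult_left_mono) auto
      also have "\<dots> \<le> (\<Sum>i<q. real (card (colorings_with q V E A i)))" by (rule good)
      also have "\<dots> \<le> (\<Sum>i<q. real q ^ n * exp (- (a * Lq) - b * lq - r * lq))"
        using Z by (intro sum_mono) auto
      also have "\<dots> = real q ^ n * exp (Lq - a * Lq - b * lq - r * lq)"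
      proof -
        have "exp (Lq - a * Lq - b * lq - r * lq) = exp Lq * exp (- (a * Lq) - b * lq - r * lq)"
          by (simp add: exp_add[symmetric])
        moreover have "exp Lq = real q" using q3 by (simp add: Lq_def)
        ultimately show ?thesis by simp
      qed
      finally have "real q ^ n * ((1 - \<delta>) * exp (- cq * s - lq)) \<le> real q ^ n * exp (Lq - a * Lq - b * lq - r * lq)"
        by (simp add: mult.left_commute)
      then have "exp (ln (1 - \<delta>)) * exp (- cq * s - lq) \<le> exp (Lq - a * Lq - b * lq - r * lq)"
        using q3 \<delta> by simp
      then have "ln (1 - \<delta>) + (- cq * s - lq) \<le> Lq - a * Lq - b * lq - r * lq"
        unfolding exp_add[symmetric] by simp
      then have total: "a * Lq + b * lq + r * lq \<le> (cq + e) * s"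
        using elim(2) by (simp add: D_def s_def algebra_simps)
      have r0: "0 \<le> r * lq" using lq_pos by (simp add: r_def)
      have aL: "x e * s * Lq \<le> a * Lq" using a_ge Lq_pos by (intro mult_right_mono) auto
      have bL: "z e * s * lq \<le> b * lq" using b_ge lq_pos by (intro mult_right_mono) auto
      have a_le: "a \<le> xU e * s"
      proof -
        have "a * Lq \<le> (cq + e - z e * lq) * s" using total r0 bL by (simp add: algebra_simps)
        then show ?thesis using Lq_pos by (simp add: xU_def field_simps)
      qed
      have b_le: "b \<le> zU e * s"
      proof -
        have "b * lq \<le> (cq + e - x e * Lq) * s" using total r0 aL by (simp add: algebra_simps)
        then show ?thesis using lq_pos by (simp add: zU_def field_simps)
      qed
      have V2_le: "real (card V2) \<le> vU e * s"
      proof -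
        have "r * lq \<le> (cq + e - x e * Lq - z e * lq) * s" using total aL bL by (simp add: algebra_simps)
        then have "2 * r \<le> vU e * s" using lq_pos by (simp add: vU_def field_simps)
        moreover have "real (card V2) \<le> 2 * r" using X(2) by (simp add: r_def)
        ultimately show ?thesis by simp
      qed
      have mono: "u * s \<le> v * s" if "u < v" for u v :: real using that s by simp
      have 1: "\<bar>a - sa * s\<bar> \<le> \<epsilon> * s"
        using a_ge a_le mono[OF e(1)] mono[OF e(3)] by (simp add: abs_le_iff algebra_simps)
      have 2: "\<bar>b - sb * s\<bar> \<le> \<epsilon> * s"
        using b_ge b_le mono[OF e(2)] mono[OF e(4)] by (simp add: abs_le_iff algebra_simps)
      have 3: "8 * card {w\<in>V - A. {v, w} \<in> E} \<le> card A" if v: "v \<in> V - A" for v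
      proof -
        \<comment> \<open>Outside \<open>A\<close> the neighbours of \<open>v\<close> lie in
          \<open>B0\<close>, in \<open>B - B0\<close> or in \<open>V2\<close>. The first are few
          because \<open>v\<close> is not in \<open>A\<close>; the other two sets are small as a
          whole.\<close>
        have "{w\<in>V - A. {v, w} \<in> E} \<subseteq> {w \<in> B0. {v, w} \<in> E} \<union> (B - B0) \<union> V2"
          by (auto simp: V2_def)
        moreover have "finite B0" using AB V(1) by (auto intro: finite_subset)
        ultimately have "card {w\<in>V - A. {v, w} \<in> E} \<le> card ({w \<in> B0. {v, w} \<in> E} \<union> (B - B0) \<union> V2)"
          using finB fin2 by (intro card_mono) auto
        also have "\<dots> \<le> card {w \<in> B0. {v, w} \<in> E} + card (B - B0) + card V2"
          using card_Un_le[of "{w \<in> B0. {v, w} \<in> E} \<union> (B - B0)" V2] card_Un_le[of "{w \<in> B0. {v, w} \<in> E}" "B - B0"] by linarith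
        finally have "real (card {w\<in>V - A. {v, w} \<in> E}) \<le> real (card {w \<in> B0. {v, w} \<in> E}) + real (card (B - B0)) + real (card V2)"
          by linarith
        moreover have "real (card {w \<in> B0. {v, w} \<in> E}) \<le> \<zeta>q * s" using v by (auto simp: A_def big_nbrs_def)
        moreover have "real (card (B - B0)) \<le> zU e * s - z e * s"
          using card_Int_Diff[OF finB, of B0] sizes(2) b_le by (simp add: b_def B_def Int_commute)
        ultimately have "8 * real (card {w\<in>V - A. {v, w} \<in> E}) \<le> (8 * (\<zeta>q + (zU e - z e) + vU e)) * s"
          using V2_le by (simp add: algebra_simps)
        also have "\<dots> \<le> x e * s" using e(6) s by (intro mult_right_mono) auto
        also have "\<dots> \<le> card A" using a_ge by (simp add: a_def)
        finally show ?thesis by linarith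
      qed
      have 4: "real (num_colorings q V E) \<le> (1 + \<epsilon>) * (\<Sum>i<q. real (card (colorings_with q V E A i)))"
      proof -
        have "real (num_colorings q V E) = (1 + \<epsilon>) * ((1 - \<delta>) * real (num_colorings q V E))"
          using \<delta>(3) by (simp add: mult.assoc[symmetric] mult.commute)
        also have "\<dots> \<le> (1 + \<epsilon>) * (\<Sum>i<q. real (card (colorings_with q V E A i)))"
          using good assms by (intro mult_left_mono) auto
        finally show ?thesis .
      qed
      show "\<exists>A\<subseteq>V. A \<noteq> {} \<and> A \<inter> nbhd E A = {} \<and> \<bar>real (card A) - sa * sqrt m\<bar> \<le> \<epsilon> * sqrt m \<and>
      \<bar>real (card (nbhd E A)) - sb * sqrt m\<bar> \<le> \<epsilon> * sqrt m \<and>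
      (\<forall>v\<in>V - A. 8 * card {w\<in>V - A. {v, w} \<in> E} \<le> card A) \<and>
      real (num_colorings q V E) \<le> (1 + \<epsilon>) * (\<Sum>i<q. real (card (colorings_with q V E A i)))"
        using AV a0 indep 1 2 3 4 unfolding a_def b_def B_def s_def by (intro exI[of _ A] conjI ballI) blast+
    qed
  qed
qed

section \<open>The cost of a few edges outside the bipartite part\<close>

lemma forced_lists_free: "x \<notin> A \<Longrightarrow> x \<notin> B \<Longrightarrow> forced_lists q i A B x = {..<q}"
  by (simp add: forced_lists_def)

lemma forced_lists_less: "i < q \<Longrightarrow> c \<in> forced_lists q i A B x \<Longrightarrow> c < q"
  by (auto simp: forced_lists_def split: if_splits)

lemma card_colorings_with_le_list:
  assumes "finite V" "E \<subseteq> [V]\<^bsup>2\<^esup>" "A \<subseteq> V"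
  shows "card (colorings_with q V E A i) \<le> card (list_colorings V E (forced_lists q i A (nbhd E A)))"
  using colorings_with_subset_list_colorings[OF assms(2,3)] assms(1)
  by (intro card_mono finite_list_colorings) auto

text \<open>Delete \<open>z'\<close> first; as \<open>w\<close> differs from \<open>z'\<close>, it
  is still there when \<open>z\<close> is deleted. So both vertices lose a color even if they are
  adjacent to each other.\<close>

lemma card_colorings_with_le_two:
  assumes V: "finite V" "E \<subseteq> [V]\<^bsup>2\<^esup>" and A: "A \<subseteq> V" "A \<inter> nbhd E A = {}" and i: "i < q"
    and z: "z \<in> V - A - nbhd E A" "z' \<in> V - A - nbhd E A" "z \<noteq> z'"
    and w: "{z', w'} \<in> E" "{z, w} \<in> E" "w \<noteq> z'"
  shows "real (card (colorings_with q V E A i)) \<le>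
    real q ^ card V * exp (- (real (card A) * Lq) - real (card (nbhd E A)) * lq - 2 * lq)"
proof -
  let ?B = "nbhd E A"
  let ?\<Lambda> = "forced_lists q i A ?B"
  have BV: "?B \<subseteq> V" using V(2) by (rule nbhd_subset)
  have inV: "x \<in> V \<and> y \<in> V \<and> x \<noteq> y" if "{x, y} \<in> E" for x y
    using that V(2) by (auto simp: nsets_def card_2_iff doubleton_eq_iff)
  have k: "card (?\<Lambda> x - {c}) \<le> q - 1" if "x \<in> {z, z'}" "c \<in> ?\<Lambda> y" for x y c
  proof -
    have "?\<Lambda> x = {..<q}" using that z by (intro forced_lists_free) auto
    then show ?thesis using forced_lists_less[OF i that(2)] by simp
  qed
  have "card (colorings_with q V E A i) \<le> card (list_colorings V E ?\<Lambda>)"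
    by (rule card_colorings_with_le_list[OF V A(1)])
  also have "\<dots> \<le> card (list_colorings (V - {z'}) E ?\<Lambda>) * (\<Prod>x\<in>{z'}. q - 1)"
    by (rule card_list_colorings_delete[where w = "\<lambda>_. w'"]) (use V z w inV[OF w(1)] k in auto)
  also have "card (list_colorings (V - {z'}) E ?\<Lambda>) \<le> card (list_colorings (V - {z'} - {z}) E ?\<Lambda>) * (\<Prod>x\<in>{z}. q - 1)"
    by (rule card_list_colorings_delete[where w = "\<lambda>_. w"]) (use V z w inV[OF w(2)] k in auto)
  also have "card (list_colorings (V - {z'} - {z}) E ?\<Lambda>) \<le> (\<Prod>v\<in>V - {z'} - {z}. card (?\<Lambda> v))"
    using V(1) by (intro card_list_colorings_le_prod) auto
  also have "\<dots> = (q - 1) ^ card ?B * q ^ (card (V - {z'} - {z}) - card A - card ?B)"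
    by (rule prod_card_forced_lists) (use V(1) A z BV i in auto)
  also have "card (V - {z'} - {z}) = card V - 2" using V(1) z by (simp add: card_Diff_singleton)
  finally have "card (colorings_with q V E A i) \<le> (q - 1) ^ card ?B * q ^ (card V - 2 - card A - card ?B) * (q - 1) * (q - 1)"
    by simp
  then have "real (card (colorings_with q V E A i)) \<le> real ((q - 1) ^ card ?B * q ^ (card V - 2 - card A - card ?B) * (q - 1) * (q - 1))"
    by (rule of_nat_mono)
  also have "\<dots> = real (q - 1) ^ card ?B * real q ^ (card V - 2 - card A - card ?B) * real (q - 1) ^ 2"
    by (simp add: power2_eq_square)
  also have "\<dots> = exp (real (card ?B) * (Lq - lq) + real (card V - 2 - card A - card ?B) * Lq + real 2 * (Lq - lq))"
    unfolding real_q1_pow real_q_pow exp_add ..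
  also have "real (card ?B) * (Lq - lq) + real (card V - 2 - card A - card ?B) * Lq + real 2 * (Lq - lq)
    = real (card V) * Lq + (- (real (card A) * Lq) - real (card ?B) * lq - 2 * lq)"
  proof -
    have fin: "finite A" "finite ?B" by (rule finite_subset[OF A(1) V(1)], rule finite_subset[OF BV V(1)])
    have "card (A \<union> ?B \<union> {z, z'}) = card (A \<union> ?B) + card {z, z'}"
      using fin z by (intro card_Un_disjoint) auto
    also have "card (A \<union> ?B) = card A + card ?B" using fin A(2) by (rule card_Un_disjoint)
    finally have "card A + card ?B + 2 = card (A \<union> ?B \<union> {z, z'})" using z(3) by simp
    also have "\<dots> \<le> card V" using V(1) A(1) BV z by (intro card_mono) auto
    finally have "real (card V - 2 - card A - card ?B) = real (card V) - 2 - real (card A) - real (card ?B)" by linarith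
    then show ?thesis by (simp add: algebra_simps)
  qed
  also have "exp \<dots> = real q ^ card V * exp (- (real (card A) * Lq) - real (card ?B) * lq - 2 * lq)"
    unfolding exp_add[of "real (card V) * Lq"] real_q_pow ..
  finally show ?thesis .
qed

text \<open>Let \<open>z\<close> be adjacent to \<open>w1\<close> and \<open>w2\<close>, and let these two avoid a color. Of the \<open>q (q - 1)^2\<close>
  assignments \<open>(q - 1) ((q - 1) + (q - 2)^2)\<close> are proper, which is a factor \<open>e^(- lq - sgq)\<close>.\<close>

definition sgq :: real where "sgq = ln (real ((q - 1) * (q - 1)) / real ((q - 1) + (q - 2) * (q - 2)))"

lemma sgq_pos: "0 < sgq"
proof -
  obtain k where k: "q = k + 3" using q3 le_Suc_ex by (metis add.commute)
  have "real ((q - 1) + (q - 2) * (q - 2)) < real ((q - 1) * (q - 1))" unfolding k by (simp add: algebra_simps)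
  moreover have "0 < (q - 1) + (q - 2) * (q - 2)" using q3 by simp
  then have "0 < real ((q - 1) + (q - 2) * (q - 2))" by (simp only: of_nat_0_less_iff)
  ultimately show ?thesis unfolding sgq_def by (intro ln_gt_zero) (simp add: field_simps)
qed

text \<open>Delete \<open>z\<close>, then \<open>w2\<close>. If \<open>w1\<close> and
  \<open>w2\<close> have equal colors, \<open>w2\<close> is determined and \<open>z\<close> has
  \<open>q - 1\<close> choices; otherwise both have \<open>q - 2\<close> choices.\<close>

lemma card_colorings_with_le_star:
  assumes V: "finite V" "E \<subseteq> [V]\<^bsup>2\<^esup>" and A: "A \<subseteq> V" "A \<inter> nbhd E A = {}" and i: "i < q"
    and z: "z \<in> V - A - nbhd E A" and w: "w1 \<in> nbhd E A" "w2 \<in> nbhd E A" "w1 \<noteq> w2" "{z, w1} \<in> E" "{z, w2} \<in> E"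
  shows "real (card (colorings_with q V E A i)) \<le>
    real q ^ card V * exp (- (real (card A) * Lq) - real (card (nbhd E A)) * lq - lq - sgq)"
proof -
  let ?B = "nbhd E A"
  let ?\<Lambda> = "forced_lists q i A ?B"
  have BV: "?B \<subseteq> V" using V(2) by (rule nbhd_subset)
  have finB: "finite ?B" using BV V(1) by (rule finite_subset)
  define F where "F = list_colorings V E ?\<Lambda>"
  define N where "N = (q - 1) ^ (card ?B - 1) * q ^ (card V - 1 - card A - card ?B)"
  have finF: "finite F" unfolding F_def using V(1) by (intro finite_list_colorings) auto
  have Fext: "F \<subseteq> extensional V" by (auto simp: F_def list_colorings_def PiE_def)
  have Lz: "?\<Lambda> z = {..<q}" using z by (intro forced_lists_free) auto
  have Lw: "?\<Lambda> w1 = {..<q} - {i}" "?\<Lambda> w2 = {..<q} - {i}" using w A(2) by (auto simp: forced_lists_def)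
  have inV: "z \<in> V" "w1 \<in> V" "w2 \<in> V" "z \<noteq> w1" "z \<noteq> w2" using z w BV by auto
  have mem: "f v \<in> ?\<Lambda> v" if "f \<in> F" "v \<in> V" for f v using that by (auto simp: F_def list_colorings_def)
  have zne: "f z \<noteq> f w1" "f z \<noteq> f w2" if "f \<in> F" for f
    using that inV w by (auto simp: F_def list_colorings_def)
  define G where "G = Pi\<^sub>E (V - {z} - {w2}) ?\<Lambda>"
  have finG: "finite G" unfolding G_def using V(1) by (intro finite_PiE) auto
  have cardG: "card G = N"
  proof -
    have "card G = (\<Prod>v\<in>V - {z} - {w2}. card (?\<Lambda> v))" unfolding G_def using V(1) by (simp add: card_PiE)
    also have "\<dots> = (\<Prod>v\<in>V - {z} - {w2}. card (forced_lists q i A (?B - {w2}) v))"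
      by (intro prod.cong refl) (auto simp: forced_lists_def)
    also have "\<dots> = (q - 1) ^ card (?B - {w2}) * q ^ (card (V - {z} - {w2}) - card A - card (?B - {w2}))"
      by (rule prod_card_forced_lists) (use V(1) A z w BV i in auto)
    also have "card (?B - {w2}) = card ?B - 1" using w finB by simp
    also have "card (V - {z} - {w2}) - card A - (card ?B - 1) = card V - 1 - card A - card ?B"
    proof -
      have "card (V - {z} - {w2}) = card V - 2" using V(1) inV by (simp add: card_Diff_singleton)
      moreover have "1 \<le> card ?B" using w finB by (metis One_nat_def Suc_leI card_gt_0_iff empty_iff)
      ultimately show ?thesis by simp
    qed
    finally show ?thesis by (simp add: N_def)
  qed
  define F1 F2 where "F1 = {f \<in> F. f w1 = f w2}" and "F2 = {f \<in> F. f w1 \<noteq> f w2}"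
  define G1 G2 where "G1 = (\<lambda>f. restrict f (V - {z})) ` F1" and "G2 = (\<lambda>f. restrict f (V - {z})) ` F2"
  have fin12: "finite F1" "finite F2" "finite G1" "finite G2" using finF by (auto simp: F1_def F2_def G1_def G2_def)
  have "card F1 \<le> card G1 * (\<Prod>x\<in>{z}. q - 1)"
  proof (rule card_le_card_extensions[where V = V and R = "\<lambda>g x. {..<q} - {g w1}"])
    show "F1 \<subseteq> extensional V" using Fext by (auto simp: F1_def)
    show "f x \<in> {..<q} - {restrict f (V - {z}) w1}" if "f \<in> F1" "x \<in> {z}" for f x
      using that mem[of f z] zne[of f] inV Lz by (auto simp: F1_def)
    show "finite ({..<q} - {g w1}) \<and> card ({..<q} - {g w1}) \<le> q - 1" if "g \<in> G1" for g x
    proof -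
      obtain f where f: "f \<in> F" "g = restrict f (V - {z})" using \<open>g \<in> G1\<close> by (auto simp: G1_def F1_def)
      then have "g w1 < q" using mem[of f w1] inV Lw by auto
      then show ?thesis by simp
    qed
  qed (use inV fin12 in \<open>auto simp: G1_def\<close>)
  moreover have "card F2 \<le> card G2 * (\<Prod>x\<in>{z}. q - 2)"
  proof (rule card_le_card_extensions[where V = V and R = "\<lambda>g x. {..<q} - {g w1, g w2}"])
    show "F2 \<subseteq> extensional V" using Fext by (auto simp: F2_def)
    show "f x \<in> {..<q} - {restrict f (V - {z}) w1, restrict f (V - {z}) w2}" if "f \<in> F2" "x \<in> {z}" for f x
      using that mem[of f z] zne[of f] inV Lz by (auto simp: F2_def)
    show "finite ({..<q} - {g w1, g w2}) \<and> card ({..<q} - {g w1, g w2}) \<le> q - 2" if "g \<in> G2" for g x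
    proof -
      obtain f where f: "f \<in> F" "f w1 \<noteq> f w2" "g = restrict f (V - {z})" using \<open>g \<in> G2\<close> by (auto simp: G2_def F2_def)
      then have "g w1 < q" "g w2 < q" "g w1 \<noteq> g w2" using mem[of f w1] mem[of f w2] inV Lw by auto
      then show ?thesis by (simp add: card_Diff_subset)
    qed
  qed (use inV fin12 in \<open>auto simp: G2_def\<close>)
  moreover have "card G1 \<le> card G * (\<Prod>x\<in>{w2}. 1)"
  proof (rule card_le_card_extensions[where V = "V - {z}" and R = "\<lambda>g x. {g w1}"])
    show "g x \<in> {restrict g (V - {z} - {w2}) w1}" if "g \<in> G1" "x \<in> {w2}" for g x
      using that inV w by (auto simp: G1_def F1_def)
    show "restrict g (V - {z} - {w2}) \<in> G" if g: "g \<in> G1" for g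
    proof -
      obtain f where f: "f \<in> F" "g = restrict f (V - {z})" using g by (auto simp: G1_def F1_def)
      then show ?thesis using mem[OF f(1)] unfolding G_def restrict_PiE_iff by simp
    qed
  qed (use inV finG in \<open>auto simp: G1_def\<close>)
  moreover have "card G2 \<le> card G * (\<Prod>x\<in>{w2}. q - 2)"
  proof (rule card_le_card_extensions[where V = "V - {z}" and R = "\<lambda>g x. {..<q} - {i} - {g w1}"])
    show "g x \<in> {..<q} - {i} - {restrict g (V - {z} - {w2}) w1}" if g: "g \<in> G2" and x: "x \<in> {w2}" for g x
    proof -
      obtain f where f: "f \<in> F" "f w1 \<noteq> f w2" "g = restrict f (V - {z})" using g by (auto simp: G2_def F2_def)
      then show ?thesis using mem[of f w2] inV w Lw x by auto
    qed
    show "restrict g (V - {z} - {w2}) \<in> G" if g: "g \<in> G2" for g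
    proof -
      obtain f where f: "f \<in> F" "g = restrict f (V - {z})" using g by (auto simp: G2_def F2_def)
      then show ?thesis using mem[OF f(1)] unfolding G_def restrict_PiE_iff by simp
    qed
    show "finite ({..<q} - {i} - {g w1}) \<and> card ({..<q} - {i} - {g w1}) \<le> q - 2" if g: "g \<in> G" for g x
    proof -
      have "g w1 \<in> ?\<Lambda> w1" using g inV w by (auto simp: G_def PiE_iff)
      then show ?thesis using Lw i by (simp add: card_Diff_singleton numeral_2_eq_2)
    qed
  qed (use inV finG in \<open>auto simp: G2_def\<close>)
  ultimately have c: "card F1 \<le> card G1 * (q - 1)" "card F2 \<le> card G2 * (q - 2)" "card G1 \<le> N" "card G2 \<le> N * (q - 2)"
    unfolding cardG by simp_all
  have le: "card F1 \<le> N * (q - 1)" using c(1) mult_le_mono1[OF c(3)] by (rule order.trans)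
  have "card F2 \<le> N * (q - 2) * (q - 2)" using c(2) mult_le_mono1[OF c(4)] by (rule order.trans)
  then have le2: "card F2 \<le> N * ((q - 2) * (q - 2))" by (simp only: mult.assoc)
  have "card (colorings_with q V E A i) \<le> card F"
    unfolding F_def by (rule card_colorings_with_le_list[OF V A(1)])
  also have "F = F1 \<union> F2" by (auto simp: F1_def F2_def)
  also have "card (F1 \<union> F2) \<le> card F1 + card F2" by (rule card_Un_le)
  also have "\<dots> \<le> N * ((q - 1) + (q - 2) * (q - 2))" unfolding add_mult_distrib2 by (rule add_mono[OF le le2])
  finally have "real (card (colorings_with q V E A i)) \<le> real (N * ((q - 1) + (q - 2) * (q - 2)))" by (rule of_nat_mono)
  also have "\<dots> = real N * real ((q - 1) + (q - 2) * (q - 2))" by simp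
  also have "real ((q - 1) + (q - 2) * (q - 2)) = real (q - 1) ^ 2 * exp (- sgq)"
  proof -
    have "0 < (q - 1) + (q - 2) * (q - 2)" "0 < (q - 1) * (q - 1)" using q3 by simp_all
    then have "0 < real ((q - 1) + (q - 2) * (q - 2))" "0 < real ((q - 1) * (q - 1))" by (simp_all only: of_nat_0_less_iff)
    moreover from this have "exp sgq = real ((q - 1) * (q - 1)) / real ((q - 1) + (q - 2) * (q - 2))"
      unfolding sgq_def by (intro exp_ln divide_pos_pos)
    ultimately show ?thesis unfolding exp_minus by (simp only: of_nat_mult power2_eq_square) (simp add: field_simps)
  qed
  also have "real N = real (q - 1) ^ (card ?B - 1) * real q ^ (card V - 1 - card A - card ?B)" by (simp add: N_def)
  also have "\<dots> * (real (q - 1) ^ 2 * exp (- sgq)) =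
    exp (real (card ?B - 1) * (Lq - lq) + real (card V - 1 - card A - card ?B) * Lq + (real 2 * (Lq - lq) + (- sgq)))"
    unfolding real_q1_pow real_q_pow exp_add ..
  also have "real (card ?B - 1) * (Lq - lq) + real (card V - 1 - card A - card ?B) * Lq + (real 2 * (Lq - lq) + (- sgq))
    = real (card V) * Lq + (- (real (card A) * Lq) - real (card ?B) * lq - lq - sgq)"
  proof -
    have finA: "finite A" by (rule finite_subset[OF A(1) V(1)])
    have "card (A \<union> ?B \<union> {z}) = card (A \<union> ?B) + card {z}"
      using finA finB z by (intro card_Un_disjoint) auto
    also have "card (A \<union> ?B) = card A + card ?B" using finA finB A(2) by (rule card_Un_disjoint)
    finally have "card A + card ?B + 1 = card (A \<union> ?B \<union> {z})" by simp
    also have "\<dots> \<le> card V" using V(1) A(1) BV z by (intro card_mono) auto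
    finally have "real (card V - 1 - card A - card ?B) = real (card V) - 1 - real (card A) - real (card ?B)" by linarith
    moreover have "1 \<le> card ?B" using w finB by (metis One_nat_def Suc_leI card_gt_0_iff empty_iff)
    then have "real (card ?B - 1) = real (card ?B) - 1" by (simp add: of_nat_diff)
    ultimately show ?thesis by (simp add: algebra_simps)
  qed
  also have "exp \<dots> = real q ^ card V * exp (- (real (card A) * Lq) - real (card ?B) * lq - lq - sgq)"
    unfolding exp_add[of "real (card V) * Lq"] real_q_pow ..
  finally show ?thesis .
qed

text \<open>The factor \<open>q\<close> for the color of the small side occurs in the lower bound as
  well as in the sum over \<open>i\<close>, and cancels. So the exponents can be compared up to
  \<open>ln (1 + \<epsilon>)\<close>, less than any fixed gap.\<close>

lemma maximizer_compare:
  assumes max: "maximizes_colorings q n m V E" and "1 \<le> a" "m \<le> a * b" "a + b \<le> n" and \<epsilon>: "0 < \<epsilon>"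
    and P: "real (num_colorings q V E) \<le> (1 + \<epsilon>) * (\<Sum>i<q. real (card (colorings_with q V E A i)))"
    and Z: "\<And>i. i < q \<Longrightarrow> real (card (colorings_with q V E A i)) \<le> real q ^ n * exp (- y)"
  shows "y \<le> real a * Lq + real b * lq + ln (1 + \<epsilon>)"
proof -
  have "real q ^ n * exp (Lq - real a * Lq - real b * lq) \<le> num_colorings q V E"
    by (rule maximizer_ge_exp[OF assms(1-4)])
  also have "\<dots> \<le> (1 + \<epsilon>) * (\<Sum>i<q. real (card (colorings_with q V E A i)))" by (rule P)
  also have "\<dots> \<le> (1 + \<epsilon>) * (\<Sum>i<q. real q ^ n * exp (- y))" using Z \<epsilon> by (intro mult_left_mono sum_mono) auto
  also have "\<dots> = real q ^ n * (exp (ln (1 + \<epsilon>)) * (exp Lq * exp (- y)))" using \<epsilon> q3 by (simp add: Lq_def)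
  also have "\<dots> = real q ^ n * exp (ln (1 + \<epsilon>) + (Lq + - y))" unfolding exp_add ..
  finally have "exp (Lq - real a * Lq - real b * lq) \<le> exp (ln (1 + \<epsilon>) + (Lq + - y))"
    using q3 by (simp add: mult_le_cancel_left_pos)
  then show ?thesis unfolding exp_le_cancel_iff by simp
qed

text \<open>A cruder variant for an arbitrary lower bound \<open>exp (- u)\<close>. It serves before
  it is known that the competitor with exact sides fits into \<open>n\<close> vertices.\<close>

lemma exponent_compare:
  assumes lower: "real q ^ n * exp (- u) \<le> num_colorings q V E" and \<epsilon>: "0 < \<epsilon>"
    and P: "real (num_colorings q V E) \<le> (1 + \<epsilon>) * (\<Sum>i<q. real (card (colorings_with q V E A i)))"
    and Z: "\<And>i. i < q \<Longrightarrow> real (card (colorings_with q V E A i)) \<le> real q ^ n * exp (- y)"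
  shows "y \<le> u + Lq + ln (1 + \<epsilon>)"
proof -
  have "real q ^ n * exp (- u) \<le> (1 + \<epsilon>) * (\<Sum>i<q. real (card (colorings_with q V E A i)))"
    using lower P by simp
  also have "\<dots> \<le> (1 + \<epsilon>) * (\<Sum>i<q. real q ^ n * exp (- y))" using Z \<epsilon> by (intro mult_left_mono sum_mono) auto
  also have "\<dots> = real q ^ n * (exp (ln (1 + \<epsilon>)) * (exp Lq * exp (- y)))" using \<epsilon> q3 by (simp add: Lq_def)
  also have "\<dots> = real q ^ n * exp (ln (1 + \<epsilon>) + (Lq + - y))" unfolding exp_add ..
  finally have "exp (- u) \<le> exp (ln (1 + \<epsilon>) + (Lq + - y))"
    using q3 by (simp add: mult_le_cancel_left_pos)
  then show ?thesis unfolding exp_le_cancel_iff by simp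
qed

text \<open>Let \<open>r\<close> be the size of a set containing at least half of the vertices
  incident to edges that avoid \<open>A\<close>, each losing a color to such an edge. Every one of
  them costs at least \<open>lq\<close>, as much as one more vertex in \<open>B\<close>. There are
  at most \<open>r * a / 4\<close> such edges, and about \<open>r / 4\<close> new vertices of
  \<open>B\<close> make room for them, so \<open>r <= 1\<close>. For \<open>r = 1\<close> one new
  vertex balances the cost, and anything but a single edge costs strictly more. A single edge loses
  against the sides \<open>a - 1\<close> and \<open>b + t + 1\<close>, where \<open>t\<close> is
  meant to be the integer part of \<open>Lq / lq\<close>.\<close>

lemma maximizer_bipartite:
  fixes t m n :: nat and \<epsilon> :: real
  assumes max: "maximizes_colorings q n m V E"
    and A: "A \<subseteq> V" "A \<inter> nbhd E A = {}"
    and deg: "\<And>v. v \<in> V - A \<Longrightarrow> 8 * card {w\<in>V - A. {v, w} \<in> E} \<le> card A"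
    and P: "real (num_colorings q V E) \<le> (1 + \<epsilon>) * (\<Sum>i<q. real (card (colorings_with q V E A i)))"
    and lower: "real q ^ n * exp (- cq * sqrt m - lq) \<le> num_colorings q V E"
    and \<epsilon>: "0 < \<epsilon>" "ln (1 + \<epsilon>) < lq" "ln (1 + \<epsilon>) < dq - lq" "ln (1 + \<epsilon>) < sgq" "ln (1 + \<epsilon>) < Lq - real t * lq"
    and ab: "2 \<le> card A" "1 \<le> card (nbhd E A)" "card (nbhd E A) + t + 2 \<le> card A * (t + 1)"
    and room: "card A + card (nbhd E A) + t \<le> n"
      "\<And>k. real (card A) * Lq + real (card (nbhd E A)) * lq + real k * lq \<le> cq * sqrt m + lq + Lq + ln (1 + \<epsilon>) \<Longrightarrow>
         card A + card (nbhd E A) + k \<le> n"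
  shows "E \<subseteq> complete_bipartite_edges A (nbhd E A)" "card A * card (nbhd E A) < m + card A"
proof -
  have V: "finite V" "E \<subseteq> [V]\<^bsup>2\<^esup>" "card E = m" "card V = n" using max by (auto simp: maximizes_colorings_def nm_graph_def)
  define B where "B = nbhd E A"
  define a b where "a = card A" and "b = card B"
  have BV: "B \<subseteq> V" unfolding B_def using V(2) by (rule nbhd_subset)
  have finA: "finite A" and finB: "finite B" by (rule finite_subset[OF A(1) V(1)], rule finite_subset[OF BV V(1)])
  have finE: "finite E" using V finite_imp_finite_nsets finite_subset by metis
  have AB: "A \<inter> B = {}" using A(2) by (simp add: B_def)
  have edge: "\<exists>x y. e = {x, y} \<and> x \<in> V \<and> y \<in> V \<and> x \<noteq> y" if "e \<in> E" for e
  proof -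
    have "e \<in> [V]\<^bsup>2\<^esup>" using V(2) that by blast
    then show ?thesis by (auto simp: nsets_def card_2_iff)
  qed
  have inV: "x \<in> V \<and> y \<in> V \<and> x \<noteq> y" if "{x, y} \<in> E" for x y
    using that V(2) by (auto simp: nsets_def card_2_iff doubleton_eq_iff)
  have sym: "{y, x} \<in> E" if "{x, y} \<in> E" for x y using that by (simp add: insert_commute)
  have nl: "{w} \<notin> E" for w using V(2) by (auto simp: nsets_def)
  have nbr: "\<exists>w. {u, w} \<in> E" if "u \<in> \<Union>E" for u
  proof -
    obtain d where d: "d \<in> E" "u \<in> d" using \<open>u \<in> \<Union>E\<close> by auto
    obtain p r where pr: "d = {p, r}" using edge[OF d(1)] by blast
    then have "{p, r} \<in> E" "{r, p} \<in> E" using d(1) by (simp_all add: insert_commute)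
    moreover have "u = p \<or> u = r" using d(2) pr by simp
    ultimately show ?thesis by blast
  qed
  have comp: "y \<le> real a' * Lq + real b' * lq + ln (1 + \<epsilon>)"
    if "1 \<le> a'" "m \<le> a' * b'" "a' + b' \<le> n"
      "\<And>i. i < q \<Longrightarrow> real (card (colorings_with q V E A i)) \<le> real q ^ n * exp (- y)" for a' b' y
    by (rule maximizer_compare[OF max that(1-3) \<epsilon>(1) P that(4)])
  define V2 where "V2 = \<Union>E - A - B"
  define B' where "B' = {y \<in> B. \<exists>w\<in>B. {y, w} \<in> E}"
  have UV: "\<Union>E \<subseteq> V" using V(2) by (auto simp: nsets_def)
  have V2V: "V2 \<subseteq> V - A - B" using UV by (auto simp: V2_def)
  have fin2: "finite V2" "finite B'" using V2V V(1) finB by (auto simp: B'_def intro: finite_subset)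
  have V2nbr: "w \<notin> A" if "u \<in> V2" "{u, w} \<in> E" for u w
  proof
    assume "w \<in> A"
    then have "u \<in> B" using sym[OF that(2)] by (auto simp: B_def nbhd_def)
    then show False using that by (simp add: V2_def)
  qed
  obtain X1 where X1: "X1 \<subseteq> V2" "card V2 \<le> 2 * card X1" "\<And>x. x \<in> X1 \<Longrightarrow> \<exists>w. w \<notin> X1 \<and> {x, w} \<in> E"
  proof (rule half_with_outside_neighbours[OF fin2(1), of E])
    show "\<exists>w. {u, w} \<in> E" if "u \<in> V2" for u using that by (intro nbr) (simp add: V2_def)
  qed (use nl in blast)+
  \<comment> \<open>Using only edges inside \<open>B\<close> guarantees that the neighbour outside
    \<open>X2\<close> is again a vertex of \<open>B\<close>.\<close>
  define EB where "EB = {e \<in> E. e \<subseteq> B}"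
  obtain X2 where X2: "X2 \<subseteq> B'" "card B' \<le> 2 * card X2" "\<And>x. x \<in> X2 \<Longrightarrow> \<exists>w. w \<notin> X2 \<and> {x, w} \<in> EB"
  proof (rule half_with_outside_neighbours[OF fin2(2), of EB])
    show "\<exists>w. {u, w} \<in> EB" if "u \<in> B'" for u using that by (auto simp: B'_def EB_def)
  qed (use nl in \<open>auto simp: EB_def\<close>)
  have Z: "real (card (colorings_with q V E A i)) \<le>
      real q ^ n * exp (- (real a * Lq + real b * lq + real (card X1) * lq + real (card X2) * dq))" if "i < q" for i
  proof -
    have "\<exists>w. w \<in> B - X2 \<and> {x, w} \<in> E" if "x \<in> X2" for x using X2(3)[OF that] by (auto simp: EB_def)
    moreover have "X1 \<subseteq> V - A - nbhd E A" using X1(1) V2V unfolding B_def by blast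
    moreover have "X2 \<subseteq> nbhd E A" using X2(1) unfolding B'_def B_def by blast
    ultimately have "real (card (colorings_with q V E A i)) \<le>
      real q ^ n * exp (- (real a * Lq) - real b * lq - real (card X1) * lq - real (card X2) * dq)"
      using card_colorings_with_le_exp[OF V(1,2) A \<open>i < q\<close>, of X1 X2] X1(3) V(4)
      by (simp add: a_def b_def B_def)
    then show ?thesis by (simp add: algebra_simps)
  qed
  define r where "r = card X1 + card X2"
  have Zr: "real (card (colorings_with q V E A i)) \<le> real q ^ n * exp (- (real a * Lq + real b * lq + real r * lq))"
    if "i < q" for i
  proof -
    have "real (card X2) * lq \<le> real (card X2) * dq" using lq_less_dq by (intro mult_left_mono) auto
    then have "real q ^ n * exp (- (real a * Lq + real b * lq + real (card X1) * lq + real (card X2) * dq))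
      \<le> real q ^ n * exp (- (real a * Lq + real b * lq + real r * lq))"
      by (intro mult_left_mono) (auto simp: r_def algebra_simps)
    then show ?thesis using Z[OF that] by linarith
  qed
  have roomr: "a + b + r \<le> n"
  proof -
    have u: "- (cq * sqrt m + lq) = - cq * sqrt m - lq" by simp
    have "real q ^ n * exp (- (cq * sqrt m + lq)) \<le> num_colorings q V E" unfolding u by (rule lower)
    from exponent_compare[OF this \<epsilon>(1) P Zr]
    have "real a * Lq + real b * lq + real r * lq \<le> cq * sqrt m + lq + Lq + ln (1 + \<epsilon>)" by simp
    then show ?thesis using room(2)[of r] by (simp add: a_def b_def B_def)
  qed
  define H where "H = {e \<in> E. e \<inter> A = {}}"
  have finH: "finite H" using finE by (simp add: H_def)
  let ?W = "V2 \<union> B'"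
  have Hcover: "\<exists>v w. e = {v, w} \<and> v \<in> ?W \<and> w \<in> V - A \<and> {v, w} \<in> E" if eH: "e \<in> H" for e
  proof -
    have eE: "e \<in> E" using eH by (simp add: H_def)
    obtain x y where xy: "e = {x, y}" "x \<in> V" "y \<in> V" using edge[OF eE] by blast
    have e: "e \<in> E" "x \<notin> A" "y \<notin> A" using eH xy by (auto simp: H_def)
    have "x \<in> V2 \<or> x \<in> B" "y \<in> V2 \<or> y \<in> B" using e xy by (auto simp: V2_def)
    then consider "x \<in> V2" | "y \<in> V2" | "x \<in> B" "y \<in> B" by blast
    then show ?thesis
    proof cases
      case 1
      then show ?thesis using xy e by blast
    next
      case 2
      then show ?thesis using xy e by (intro exI[of _ y] exI[of _ x]) (auto simp: insert_commute)
    next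
      case 3
      then have "x \<in> B'" using xy e by (auto simp: B'_def)
      then show ?thesis using xy e by blast
    qed
  qed
  \<comment> \<open>Every edge of \<open>H\<close> touches one of at most \<open>2 * r\<close>
    vertices, and each of these has at most \<open>a / 8\<close> neighbours outside
    \<open>A\<close>.\<close>
  have cardH: "4 * card H \<le> r * a"
  proof -
    let ?S = "\<Union>v\<in>?W. (\<lambda>w. {v, w}) ` {w \<in> V - A. {v, w} \<in> E}"
    have "H \<subseteq> ?S" using Hcover by blast
    then have "card H \<le> card ?S" using fin2 V(1) by (intro card_mono) auto
    also have "\<dots> \<le> (\<Sum>v\<in>?W. card ((\<lambda>w. {v, w}) ` {w \<in> V - A. {v, w} \<in> E}))"
      using fin2 by (intro card_UN_le) auto
    also have "\<dots> \<le> (\<Sum>v\<in>?W. card {w \<in> V - A. {v, w} \<in> E})"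
      using V(1) by (intro sum_mono card_image_le) auto
    finally have "8 * card H \<le> (\<Sum>v\<in>?W. 8 * card {w \<in> V - A. {v, w} \<in> E})" by (simp add: sum_distrib_left[symmetric])
    also have "\<dots> \<le> (\<Sum>v\<in>?W. a)"
    proof (rule sum_mono)
      fix v assume "v \<in> ?W"
      then have "v \<in> V - A" using V2V BV AB by (auto simp: B'_def)
      then show "8 * card {w \<in> V - A. {v, w} \<in> E} \<le> a" unfolding a_def by (rule deg)
    qed
    also have "\<dots> = card ?W * a" by simp
    also have "\<dots> \<le> (2 * r) * a"
    proof -
      have "card ?W \<le> card V2 + card B'" by (rule card_Un_le)
      also have "\<dots> \<le> 2 * r" using X1(2) X2(2) by (simp add: r_def)
      finally show ?thesis by simp
    qed
    finally show ?thesis by (simp add: mult.commute)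
  qed
  have Esub: "E \<subseteq> H \<union> complete_bipartite_edges A B"
  proof
    fix e assume e: "e \<in> E"
    show "e \<in> H \<union> complete_bipartite_edges A B"
    proof (cases "e \<inter> A = {}")
      case True then show ?thesis using e by (simp add: H_def)
    next
      case False
      then obtain x y where "e = {x, y}" "x \<in> A" using edge[OF e] by (auto simp: insert_commute)
      then have "y \<in> B" using e by (auto simp: B_def nbhd_def)
      then show ?thesis using \<open>e = {x, y}\<close> \<open>x \<in> A\<close> unfolding complete_bipartite_edges_def by blast
    qed
  qed
  have m_le: "m \<le> card H + a * b"
  proof -
    have "card E \<le> card (H \<union> complete_bipartite_edges A B)"
      using Esub finH finA finB card_complete_bipartite_edges_le(2) by (intro card_mono) blast+
    also have "\<dots> \<le> card H + card (complete_bipartite_edges A B)" by (rule card_Un_le)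
    also have "card (complete_bipartite_edges A B) \<le> a * b" unfolding a_def b_def using finA finB by (rule card_complete_bipartite_edges_le(1))
    finally show ?thesis using V(3) by simp
  qed
  have a1: "1 \<le> a" using ab by (simp add: a_def)
  have r1: "r \<le> 1"
  proof -
    \<comment> \<open>This is \<open>r / 4\<close> rounded up. The comparison yields
      \<open>r - j < 1\<close>, hence \<open>r <= j\<close>, which is possible only for
      \<open>r <= 1\<close>.\<close>
    define j where "j = (r + 3) div 4"
    have j: "r \<le> 4 * j" "j \<le> r" by (auto simp: j_def)
    have "4 * card H \<le> (4 * j) * a" using cardH mult_le_mono1[OF j(1), of a] by (rule order.trans)
    then have "card H \<le> j * a" by (simp only: mult.assoc)
    then have "m \<le> a * (b + j)" using m_le by (simp add: algebra_simps)
    moreover have "a + (b + j) \<le> n" using roomr j by simp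
    ultimately have "real a * Lq + real b * lq + real r * lq \<le> real a * Lq + real (b + j) * lq + ln (1 + \<epsilon>)"
      using a1 Zr by (intro comp) auto
    then have "(real r - real j) * lq < 1 * lq" using \<epsilon>(2) by (simp add: algebra_simps)
    then have "real r - real j < 1" using lq_pos by (simp only: mult_less_cancel_right_pos)
    then have "r \<le> j" by linarith
    then show ?thesis unfolding j_def by linarith
  qed
  have "H = {}"
  proof (rule ccontr)
    assume "H \<noteq> {}"
    then have H1: "1 \<le> card H" using finH by (simp add: Suc_leI card_gt_0_iff)
    have "r \<noteq> 0"
    proof
      assume "r = 0"
      then have "4 * card H \<le> 0" using cardH by simp
      then show False using H1 by simp
    qed
    then have r: "r = 1" using r1 by simp
    have cardHa: "card H \<le> a" using cardH r by simp
    \<comment> \<open>The competitor has sides \<open>a\<close> and \<open>b + 1\<close>: the at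
      most \<open>a\<close> edges of \<open>H\<close> are replaced by one new vertex.\<close>
    have one: "y \<le> real a * Lq + real b * lq + lq + ln (1 + \<epsilon>)"
      if "\<And>i. i < q \<Longrightarrow> real (card (colorings_with q V E A i)) \<le> real q ^ n * exp (- y)" for y
    proof -
      have "m \<le> a * (b + 1)" using m_le cardHa by (simp add: distrib_left)
      moreover have "a + (b + 1) \<le> n" using roomr r by simp
      ultimately have "y \<le> real a * Lq + real (b + 1) * lq + ln (1 + \<epsilon>)"
        using a1 that by (intro comp)
      then show ?thesis by (simp add: algebra_simps)
    qed
    have X2e: "X2 = {}"
    proof (rule ccontr)
      assume "X2 \<noteq> {}"
      moreover have "finite X2" using X2(1) fin2 finite_subset by blast
      ultimately have "card X2 \<noteq> 0" by simp
      then have "card X2 = 1" "card X1 = 0" using r by (auto simp: r_def)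
      then have "real a * Lq + real b * lq + dq \<le> real a * Lq + real b * lq + lq + ln (1 + \<epsilon>)"
        using Z by (intro one) simp
      then show False using \<epsilon>(3) by simp
    qed
    then have "B' = {}" using X2(2) fin2 by simp
    have Htouch: "\<exists>v w. e = {v, w} \<and> v \<in> V2 \<and> {v, w} \<in> E" if "e \<in> H" for e
      using Hcover[OF that] \<open>B' = {}\<close> by blast
    have "V2 \<noteq> {}" using Htouch \<open>H \<noteq> {}\<close> by blast
    have "card X1 = 1" using r X2e by (simp add: r_def)
    then have cV2: "card V2 \<le> 2" using X1(2) by simp
    have "card H \<le> 1"
    proof (rule ccontr)
      assume "\<not> card H \<le> 1"
      then have H2: "2 \<le> card H" by simp
      show False
      proof (cases "card V2 = 2")
        case True
        then obtain z1 z2 where z12: "V2 = {z1, z2}" "z1 \<noteq> z2" by (auto simp: card_2_iff)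
        \<comment> \<open>Some extra edge is not the one between the two outside vertices, so both
          of them lose a color, at a cost of \<open>2 * lq\<close>.\<close>
        have "\<not> H \<subseteq> {{z1, z2}}"
        proof
          assume "H \<subseteq> {{z1, z2}}"
          then have "card H \<le> card {{z1, z2}}" by (intro card_mono) auto
          then show False using H2 by simp
        qed
        then obtain e where e: "e \<in> H" "e \<noteq> {z1, z2}" by blast
        then obtain z w where zw: "e = {z, w}" "z \<in> V2" "{z, w} \<in> E" using Htouch by blast
        then obtain z' where z': "z' \<in> V2" "z' \<noteq> z" "{z, z'} = {z1, z2}" using z12 by (auto simp: insert_commute)
        have "w \<noteq> z'" using e(2) zw(1) z'(3) by auto
        obtain w' where w': "{z', w'} \<in> E" using nbr[of z'] z'(1) by (auto simp: V2_def)
        have "real (card (colorings_with q V E A i)) \<le> real q ^ n * exp (- (real a * Lq + real b * lq + 2 * lq))" if "i < q" for i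
          using card_colorings_with_le_two[OF V(1,2) A that, of z z' w' w] zw z' w' V2V \<open>w \<noteq> z'\<close> V(4)
          by (auto simp: a_def b_def B_def algebra_simps)
        then have "real a * Lq + real b * lq + 2 * lq \<le> real a * Lq + real b * lq + lq + ln (1 + \<epsilon>)" by (rule one)
        then show False using \<epsilon>(2) by simp
      next
        case False
        then have "card V2 = 1" using cV2 \<open>V2 \<noteq> {}\<close> fin2 by (metis One_nat_def Suc_1 card_0_eq le_SucE le_zero_eq)
        then obtain z where z: "V2 = {z}" by (auto simp: card_1_singleton_iff)
        \<comment> \<open>With one outside vertex \<open>z\<close> all extra edges run from
          \<open>z\<close> to \<open>B\<close>; two of them already cost
          \<open>lq + sgq\<close>.\<close>
        have star: "\<exists>w\<in>B. e = {z, w} \<and> {z, w} \<in> E" if e: "e \<in> H" for e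
        proof -
          obtain v w where vw: "e = {v, w}" "v \<in> V2" "{v, w} \<in> E" using Htouch[OF e] by blast
          then have vz: "v = z" using z by simp
          have "w \<in> \<Union>E" using vw(3) by blast
          moreover have "w \<notin> A" using V2nbr vw by blast
          moreover have "w \<noteq> z" using inV[OF vw(3)] vz by simp
          ultimately have "w \<in> B" using z by (auto simp: V2_def)
          then show ?thesis using vw vz by blast
        qed
        obtain e1 e2 where e12: "e1 \<in> H" "e2 \<in> H" "e1 \<noteq> e2"
          using H2 by (metis One_nat_def Suc_1 Suc_le_eq card_le_Suc0_iff_eq finH not_less)
        obtain w1 where w1: "w1 \<in> B" "e1 = {z, w1}" "{z, w1} \<in> E" using star[OF e12(1)] by blast
        obtain w2 where w2: "w2 \<in> B" "e2 = {z, w2}" "{z, w2} \<in> E" using star[OF e12(2)] by blast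
        have "w1 \<noteq> w2" using e12(3) w1(2) w2(2) by blast
        have neg: "- (real a * Lq + real b * lq + lq + sgq) = - (real a * Lq) - real b * lq - lq - sgq" by simp
        have "real (card (colorings_with q V E A i)) \<le> real q ^ n * exp (- (real a * Lq + real b * lq + lq + sgq))" if "i < q" for i
          unfolding neg
          using card_colorings_with_le_star[OF V(1,2) A that, of z w1 w2] z w1 w2 V2V \<open>w1 \<noteq> w2\<close> V(4)
          by (auto simp: a_def b_def B_def)
        then have "real a * Lq + real b * lq + lq + sgq \<le> real a * Lq + real b * lq + lq + ln (1 + \<epsilon>)" by (rule one)
        then show False using \<epsilon>(4) by simp
      qed
    qed
    then have "m \<le> a * b + 1" using m_le by simp
    \<comment> \<open>One vertex of \<open>A\<close> is traded for \<open>t + 1\<close> vertices of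
      \<open>B\<close>. The product changes by \<open>a * (t + 1) - (b + t + 1)\<close>, which is at
      least \<open>1\<close>, and the cost grows by \<open>(t + 1) * lq - Lq\<close>, less than the
      \<open>lq\<close> that the extra edge costs.\<close>
    also have "a * b + 1 \<le> (a - 1) * (b + t + 1)"
    proof -
      obtain a0 where "a = Suc a0" using a1 by (metis Suc_diff_1 Suc_le_lessD One_nat_def)
      then show ?thesis using ab(3) by (simp add: a_def[symmetric] b_def[symmetric] B_def[symmetric] algebra_simps)
    qed
    finally have "real a * Lq + real b * lq + real r * lq \<le> real (a - 1) * Lq + real (b + t + 1) * lq + ln (1 + \<epsilon>)"
      using ab(1) room(1) Zr by (intro comp) (auto simp: a_def b_def B_def)
    then have "Lq - real t * lq \<le> ln (1 + \<epsilon>)" using a1 r by (simp add: of_nat_diff algebra_simps)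
    then show False using \<epsilon>(5) by simp
  qed
  then show sub: "E \<subseteq> complete_bipartite_edges A (nbhd E A)" using Esub by (simp add: B_def)
  \<comment> \<open>Otherwise the sides \<open>a\<close> and \<open>b - 1\<close> would have room
    for all \<open>m\<close> edges and save \<open>lq\<close>.\<close>
  have "a * b < m + a"
  proof (rule ccontr)
    assume "\<not> a * b < m + a"
    moreover have "1 \<le> b" using ab(2) by (simp add: b_def B_def)
    ultimately have "m \<le> a * (b - 1)" by (simp add: algebra_simps)
    then have "real a * Lq + real b * lq + real r * lq \<le> real a * Lq + real (b - 1) * lq + ln (1 + \<epsilon>)"
      using a1 roomr Zr by (intro comp) auto
    then have "real r * lq + lq \<le> ln (1 + \<epsilon>)" using \<open>1 \<le> b\<close> by (simp add: of_nat_diff algebra_simps)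
    moreover have "0 \<le> real r * lq" using lq_pos by simp
    ultimately show False using \<epsilon>(2) by linarith
  qed
  then show "card A * card (nbhd E A) < m + card A" by (simp add: a_def b_def B_def)
qed

end

section \<open>The set of missing pairs\<close>

lemma prod_blocks:
  fixes k q :: nat
  assumes "finite V" "A \<subseteq> V" "B \<subseteq> V" "A \<inter> B = {}" "Y \<subseteq> B"
  shows "(\<Prod>v\<in>V. if v \<in> A \<union> Y then 1 else if v \<in> B then k else q) =
    k ^ (card B - card Y) * q ^ (card V - card A - card B)"
proof -
  let ?g = "\<lambda>v. if v \<in> A \<union> Y then 1 else if v \<in> B then k else q"
  have fin: "finite A" "finite B" using assms by (auto intro: finite_subset)
  then have "finite Y" using assms(5) finite_subset by blast
  note fin = fin this
  have "(\<Prod>v\<in>V. ?g v) = (\<Prod>v\<in>V - (A \<union> B). ?g v) * (\<Prod>v\<in>A \<union> B. ?g v)"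
    using assms by (intro prod.subset_diff) auto
  also have "(\<Prod>v\<in>A \<union> B. ?g v) = (\<Prod>v\<in>A. ?g v) * (\<Prod>v\<in>B. ?g v)"
    using fin assms by (intro prod.union_disjoint) auto
  also have "(\<Prod>v\<in>A. ?g v) = 1" by (intro prod.neutral) auto
  also have "(\<Prod>v\<in>B. ?g v) = (\<Prod>v\<in>B - Y. ?g v) * (\<Prod>v\<in>Y. ?g v)"
    using fin assms by (intro prod.subset_diff) auto
  also have "(\<Prod>v\<in>Y. ?g v) = 1" by (intro prod.neutral) auto
  also have "(\<Prod>v\<in>B - Y. ?g v) = (\<Prod>v\<in>B - Y. k)" using assms by (intro prod.cong) auto
  also have "(\<Prod>v\<in>V - (A \<union> B). ?g v) = (\<Prod>v\<in>V - (A \<union> B). q)" using assms by (intro prod.cong) auto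
  finally have "(\<Prod>v\<in>V. ?g v) = q ^ card (V - (A \<union> B)) * k ^ card (B - Y)" by simp
  moreover have "card (V - (A \<union> B)) = card V - card A - card B"
    using fin assms by (simp add: card_Diff_subset card_Un_disjoint)
  moreover have "card (B - Y) = card B - card Y" using fin assms by (simp add: card_Diff_subset)
  ultimately show ?thesis by (simp only: mult.commute)
qed

lemma card_PiE_blocks_le:
  assumes "finite V" "A \<subseteq> V" "B \<subseteq> V" "A \<inter> B = {}" "Y \<subseteq> B"
    "\<And>v. v \<in> A \<union> Y \<Longrightarrow> card (\<Lambda> v) \<le> 1" "\<And>v. v \<in> B - Y \<Longrightarrow> card (\<Lambda> v) \<le> k"
    "\<And>v. v \<in> V - A - B \<Longrightarrow> card (\<Lambda> v) \<le> q"
  shows "card (Pi\<^sub>E V \<Lambda>) \<le> k ^ (card B - card Y) * q ^ (card V - card A - card B)"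
proof -
  have "card (Pi\<^sub>E V \<Lambda>) = (\<Prod>v\<in>V. card (\<Lambda> v))" using assms(1) by (rule card_PiE)
  also have "\<dots> \<le> (\<Prod>v\<in>V. if v \<in> A \<union> Y then 1 else if v \<in> B then k else q)"
    using assms(6-8) by (intro prod_mono) auto
  finally show ?thesis by (simp only: prod_blocks[OF assms(1-5)])
qed

lemma card_PiE_blocks_eq:
  assumes "finite V" "A \<subseteq> V" "B \<subseteq> V" "A \<inter> B = {}" "Y \<subseteq> B"
    "\<And>v. v \<in> A \<union> Y \<Longrightarrow> card (\<Lambda> v) = 1" "\<And>v. v \<in> B - Y \<Longrightarrow> card (\<Lambda> v) = k"
    "\<And>v. v \<in> V - A - B \<Longrightarrow> card (\<Lambda> v) = q"
  shows "card (Pi\<^sub>E V \<Lambda>) = k ^ (card B - card Y) * q ^ (card V - card A - card B)"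
proof -
  have "card (Pi\<^sub>E V \<Lambda>) = (\<Prod>v\<in>V. card (\<Lambda> v))" using assms(1) by (rule card_PiE)
  also have "\<dots> = (\<Prod>v\<in>V. if v \<in> A \<union> Y then 1 else if v \<in> B then k else q)"
    using assms(6-8) by (intro prod.cong) auto
  finally show ?thesis by (simp only: prod_blocks[OF assms(1-5)])
qed

definition missing_pairs :: "'a set set \<Rightarrow> 'a set \<Rightarrow> 'a set \<Rightarrow> ('a \<times> 'a) set" where
  "missing_pairs E A B = {(x, y). x \<in> A \<and> y \<in> B \<and> {x, y} \<notin> E}"

definition mono_pairs :: "'a set \<Rightarrow> 'a set \<Rightarrow> ('a \<Rightarrow> nat) \<Rightarrow> ('a \<times> 'a) set" where
  "mono_pairs A B f = {(x, y). x \<in> A \<and> y \<in> B \<and> f x = f y}"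

definition is_biclique :: "('a \<times> 'a) set \<Rightarrow> bool" where
  "is_biclique S \<longleftrightarrow> S \<noteq> {} \<and> S = fst ` S \<times> snd ` S"

lemma card_ordered_pairs_distinct: "card {(c, d). c < q \<and> d < q \<and> c \<noteq> (d::nat)} = q * (q - 1)"
proof -
  have "{(c, d). c < q \<and> d < q \<and> c \<noteq> (d::nat)} = (SIGMA c:{..<q}. {..<q} - {c})" by auto
  then show ?thesis by (simp add: card_SigmaI)
qed

text \<open>Colorings whose set of monochromatic pairs is exactly \<open>S\<close>. If they use two colors on \<open>A\<close>,
  then \<open>S\<close> must be a biclique; the other ones are negligible.\<close>

lemma card_mono_fiber_le:
  assumes V: "finite V" and AB: "A \<subseteq> V" "B \<subseteq> V" "A \<inter> B = {}" and S: "S \<noteq> {}" "S \<subseteq> A \<times> B" "card S < card A"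
  shows "card {f \<in> V \<rightarrow>\<^sub>E {..<q}. mono_pairs A B f = S} \<le>
    ((if is_biclique S then q * (q - 1) * (q - 2) ^ (card B - card (snd ` S)) else 0) + q ^ card A * (q - 3) ^ (card B - card (snd ` S)))
      * q ^ (card V - card A - card B)"
proof -
  define X where "X = fst ` S"
  define Y where "Y = snd ` S"
  define F where "F = {f \<in> V \<rightarrow>\<^sub>E {..<q}. mono_pairs A B f = S}"
  define r where "r = q ^ (card V - card A - card B)"
  have XY: "X \<subseteq> A" "Y \<subseteq> B" using S(2) by (auto simp: X_def Y_def)
  have finA: "finite A" and finB: "finite B" using AB V by (auto intro: finite_subset)
  have finS: "finite S" using S(2) finA finB by (auto intro: finite_subset)
  \<comment> \<open>Here \<open>card S < card A\<close> enters: some vertex of \<open>A\<close> is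
    in no monochromatic pair, which forces a second color on \<open>A\<close>.\<close>
  have S_card_fst: "\<not> A \<subseteq> X"
  proof
    assume "A \<subseteq> X"
    then have "card A \<le> card X" using finS by (intro card_mono) (auto simp: X_def)
    also have "\<dots> \<le> card S" unfolding X_def using finS by (rule card_image_le)
    finally show False using S(3) by simp
  qed
  have mono: "(x, y) \<in> S \<longleftrightarrow> x \<in> A \<and> y \<in> B \<and> f x = f y" if "f \<in> F" for f x y
    using that by (auto simp: F_def mono_pairs_def)
  have frange: "f v < q" if "f \<in> F" "v \<in> V" for f v using that by (auto simp: F_def)
  \<comment> \<open>The pattern with two colors on \<open>A\<close>: color \<open>c\<close> on
    \<open>X\<close> and \<open>Y\<close>, color \<open>d\<close> on the rest of \<open>A\<close>,
    and neither of them on the rest of \<open>B\<close>.\<close>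
  define M where "M = (\<lambda>(c, d) v. if v \<in> X \<union> Y then {c} else if v \<in> A then {d} else if v \<in> B then {..<q} - {c} - {d} else {..<q::nat})"
  define I where "I = {(c, d). c < q \<and> d < q \<and> c \<noteq> d}"
  have finI: "finite I" unfolding I_def by (rule finite_subset[of _ "{..<q} \<times> {..<q}"]) auto
  have two: "is_biclique S \<and> (\<exists>p\<in>I. f \<in> Pi\<^sub>E V (M p))" if f: "f \<in> F" "card (f ` A) \<le> 2" for f
  proof -
    obtain x0 y0 where xy0: "(x0, y0) \<in> S" using S(1) by auto
    define c where "c = f x0"
    have c: "x0 \<in> A" "y0 \<in> B" "f y0 = c" using xy0 mono[OF f(1)] by (auto simp: c_def)
    have inX: "x \<in> X" if "x \<in> A" "y \<in> B" "f x = f y" for x y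
    proof -
      have "(x, y) \<in> S" using that mono[OF f(1)] by blast
      then show ?thesis unfolding X_def by force
    qed
    obtain x1 where x1: "x1 \<in> A" "x1 \<notin> X" using S_card_fst by blast
    define d where "d = f x1"
    have cd: "d \<noteq> c" using inX[OF x1(1) c(2)] x1(2) c by (auto simp: d_def)
    have fA: "f x = c \<or> f x = d" if "x \<in> A" for x
    proof (rule ccontr)
      assume "\<not> ?thesis"
      then have "card {f x, c, d} = 3" using cd by auto
      moreover have "card {f x, c, d} \<le> card (f ` A)"
        using that c x1 finA by (intro card_mono) (auto simp: c_def d_def)
      ultimately show False using f(2) by simp
    qed
    have fY: "f y = c" if y: "y \<in> Y" for y
    proof (rule ccontr)
      assume "f y \<noteq> c"
      obtain x where x: "(x, y) \<in> S" using y by (auto simp: Y_def)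
      then have x': "x \<in> A" "y \<in> B" "f x = f y" using mono[OF f(1)] by auto
      then have "f y = d" using fA[of x] \<open>f y \<noteq> c\<close> by auto
      then show False using inX[OF x1(1) x'(2)] x1(2) by (simp add: d_def)
    qed
    have SX: "S = {x \<in> A. f x = c} \<times> Y"
    proof (intro set_eqI iffI)
      fix p assume p: "p \<in> S"
      obtain x y where xy: "p = (x, y)" by (cases p)
      have "y \<in> Y" using p xy unfolding Y_def by force
      then show "p \<in> {x \<in> A. f x = c} \<times> Y" using p xy mono[OF f(1)] fY by auto
    next
      fix p assume p: "p \<in> {x \<in> A. f x = c} \<times> Y"
      obtain x y where xy: "p = (x, y)" by (cases p)
      then show "p \<in> S" using p XY fY[of y] mono[OF f(1), of x y] by auto
    qed
    have "y0 \<in> Y" using xy0 unfolding Y_def by force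
    then have "fst ` ({x \<in> A. f x = c} \<times> Y) = {x \<in> A. f x = c}" by force
    then have X: "X = {x \<in> A. f x = c}" unfolding X_def SX[symmetric] .
    have "S = X \<times> Y" using SX unfolding X .
    then have bic: "is_biclique S" unfolding is_biclique_def X_def[symmetric] Y_def[symmetric] using S(1) by blast
    have fB: "f y \<noteq> c \<and> f y \<noteq> d" if y: "y \<in> B" "y \<notin> Y" for y
    proof -
      have "(x, y) \<notin> S" for x using y(2) unfolding Y_def by force
      then have "f x \<noteq> f y" if "x \<in> A" for x using mono[OF f(1), of x y] y that by blast
      from this[OF c(1)] this[OF x1(1)] show ?thesis by (auto simp: c_def d_def)
    qed
    have "f v \<in> M (c, d) v" if v: "v \<in> V" for v
      using fY fA[of v] fB[of v] X frange[OF f(1) v] by (auto simp: M_def)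
    then have "f \<in> Pi\<^sub>E V (M (c, d))" using f(1) by (auto simp: F_def PiE_iff)
    moreover have "(c, d) \<in> I" using frange[OF f(1)] cd c x1 AB by (auto simp: I_def c_def d_def)
    ultimately show ?thesis using bic by blast
  qed
  define F2 F3 where "F2 = {f \<in> F. card (f ` A) \<le> 2}" and "F3 = {f \<in> F. \<not> card (f ` A) \<le> 2}"
  have M_card: "card (Pi\<^sub>E V (M p)) \<le> (q - 2) ^ (card B - card Y) * r" if p: "p \<in> I" for p
    unfolding r_def
  proof (rule card_PiE_blocks_le[OF V AB XY(2)])
    obtain c d where cd: "p = (c, d)" "c < q" "d < q" "c \<noteq> d" using p by (auto simp: I_def)
    show "card (M p v) \<le> 1" if "v \<in> A \<union> Y" for v using that by (auto simp: M_def cd)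
    show "card (M p v) \<le> q - 2" if v: "v \<in> B - Y" for v
    proof -
      have "v \<notin> X \<union> Y" "v \<notin> A" "v \<in> B" using v AB(3) XY by auto
      then have "M p v = {..<q} - {c} - {d}" by (simp add: M_def cd)
      then show ?thesis using cd by (simp add: card_Diff_singleton numeral_2_eq_2)
    qed
    show "card (M p v) \<le> q" if v: "v \<in> V - A - B" for v
    proof -
      have "v \<notin> X \<union> Y" "v \<notin> A" "v \<notin> B" using v XY by auto
      then show ?thesis by (simp add: M_def cd)
    qed
  qed
  have c2: "card F2 \<le> (if is_biclique S then q * (q - 1) * (q - 2) ^ (card B - card Y) else 0) * r"
  proof (cases "is_biclique S")
    case False
    then have "F2 = {}" using two by (auto simp: F2_def)
    then show ?thesis by simp
  next
    case True
    have "F2 \<subseteq> (\<Union>p\<in>I. Pi\<^sub>E V (M p))" using two by (auto simp: F2_def)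
    moreover have "finite (\<Union>p\<in>I. Pi\<^sub>E V (M p))"
      using finI V by (auto intro!: finite_PiE simp: M_def split: if_splits)
    ultimately have "card F2 \<le> card (\<Union>p\<in>I. Pi\<^sub>E V (M p))" by (rule card_mono[rotated])
    also have "\<dots> \<le> (\<Sum>p\<in>I. card (Pi\<^sub>E V (M p)))" by (rule card_UN_le[OF finI])
    also have "\<dots> \<le> (\<Sum>p\<in>I. (q - 2) ^ (card B - card Y) * r)" using M_card by (rule sum_mono)
    also have "\<dots> = q * (q - 1) * (q - 2) ^ (card B - card Y) * r"
      by (simp add: I_def card_ordered_pairs_distinct mult.assoc)
    finally show ?thesis using True by simp
  qed
  define g where "g = (\<lambda>y. SOME x. (x, y) \<in> S)"
  have g: "(g y, y) \<in> S" if y: "y \<in> Y" for y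
  proof -
    obtain x where "(x, y) \<in> S" using y by (auto simp: Y_def)
    then show ?thesis unfolding g_def by (rule someI)
  qed
  \<comment> \<open>The pattern with at least three colors on \<open>A\<close>:
    \<open>\<phi>\<close> is the coloring of \<open>A\<close>, counted crudely by
    \<open>q ^ card A\<close>. A vertex of \<open>Y\<close> copies the color of its partner under
    \<open>g\<close>, and the rest of \<open>B\<close> has at most \<open>q - 3\<close> colors
    left.\<close>
  define N where "N = (\<lambda>\<phi> v. if v \<in> A then {\<phi> v} else if v \<in> Y then {\<phi> (g v)} else if v \<in> B then {..<q} - \<phi> ` A else {..<q::nat})"
  define J where "J = {\<phi> \<in> A \<rightarrow>\<^sub>E {..<q}. \<not> card (\<phi> ` A) \<le> 2}"
  have finJ: "finite J"
    by (rule finite_subset[of _ "A \<rightarrow>\<^sub>E {..<q}"]) (use finA in \<open>auto simp: J_def intro!: finite_PiE\<close>)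
  have three: "\<exists>\<phi>\<in>J. f \<in> Pi\<^sub>E V (N \<phi>)" if f: "f \<in> F" "\<not> card (f ` A) \<le> 2" for f
  proof -
    define \<phi> where "\<phi> = restrict f A"
    have im: "\<phi> ` A = f ` A" by (auto simp: \<phi>_def)
    have "\<phi> \<in> J" using f frange[OF f(1)] AB by (auto simp: J_def im) (auto simp: \<phi>_def)
    moreover have "f v \<in> N \<phi> v" if v: "v \<in> V" for v
    proof -
      consider "v \<in> A" | "v \<in> Y" | "v \<in> B" "v \<notin> Y" | "v \<notin> A" "v \<notin> B" by blast
      then show ?thesis
      proof cases
        case 1 then show ?thesis by (simp add: N_def \<phi>_def)
      next
        case 2
        then have "g v \<in> A" "f (g v) = f v" "v \<notin> A" using g[OF 2] mono[OF f(1)] XY AB(3) by auto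
        then show ?thesis using 2 by (simp add: N_def \<phi>_def)
      next
        case 3
        have "(x, v) \<notin> S" for x using 3(2) unfolding Y_def by force
        then have "f x \<noteq> f v" if "x \<in> A" for x using mono[OF f(1), of x v] 3 that by blast
        then have "f v \<notin> f ` A" by (metis imageE)
        then show ?thesis using 3 AB(3) frange[OF f(1) v] by (auto simp: N_def im)
      next
        case 4
        then show ?thesis using XY frange[OF f(1) v] by (auto simp: N_def)
      qed
    qed
    then have "f \<in> Pi\<^sub>E V (N \<phi>)" using f(1) by (auto simp: F_def PiE_iff)
    ultimately show ?thesis by blast
  qed
  have N_card: "card (Pi\<^sub>E V (N \<phi>)) \<le> (q - 3) ^ (card B - card Y) * r" if \<phi>: "\<phi> \<in> J" for \<phi>
    unfolding r_def
  proof (rule card_PiE_blocks_le[OF V AB XY(2)])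
    show "card (N \<phi> v) \<le> 1" if "v \<in> A \<union> Y" for v using that by (auto simp: N_def)
    show "card (N \<phi> v) \<le> q - 3" if v: "v \<in> B - Y" for v
    proof -
      have "v \<notin> A" "v \<in> B" "v \<notin> Y" using v AB(3) by auto
      then have "N \<phi> v = {..<q} - \<phi> ` A" by (simp add: N_def)
      moreover have "card ({..<q} - \<phi> ` A) = q - card (\<phi> ` A)"
        using \<phi> finA by (subst card_Diff_subset) (auto simp: J_def)
      moreover have "3 \<le> card (\<phi> ` A)" using \<phi> by (simp add: J_def)
      ultimately show ?thesis by simp
    qed
    show "card (N \<phi> v) \<le> q" if v: "v \<in> V - A - B" for v
    proof -
      have "v \<notin> A" "v \<notin> Y" "v \<notin> B" using v XY by auto
      then show ?thesis by (simp add: N_def)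
    qed
  qed
  have c3: "card F3 \<le> q ^ card A * (q - 3) ^ (card B - card Y) * r"
  proof -
    have "F3 \<subseteq> (\<Union>\<phi>\<in>J. Pi\<^sub>E V (N \<phi>))" using three by (auto simp: F3_def)
    moreover have "finite (\<Union>\<phi>\<in>J. Pi\<^sub>E V (N \<phi>))"
      using finJ V by (auto intro!: finite_PiE simp: N_def)
    ultimately have "card F3 \<le> card (\<Union>\<phi>\<in>J. Pi\<^sub>E V (N \<phi>))" by (rule card_mono[rotated])
    also have "\<dots> \<le> (\<Sum>\<phi>\<in>J. card (Pi\<^sub>E V (N \<phi>)))" by (rule card_UN_le[OF finJ])
    also have "\<dots> \<le> (\<Sum>\<phi>\<in>J. (q - 3) ^ (card B - card Y) * r)" using N_card by (rule sum_mono)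
    also have "\<dots> = card J * ((q - 3) ^ (card B - card Y) * r)" by simp
    also have "\<dots> \<le> q ^ card A * ((q - 3) ^ (card B - card Y) * r)"
    proof (rule mult_le_mono1)
      have "card J \<le> card (A \<rightarrow>\<^sub>E {..<q})" unfolding J_def using finA by (intro card_mono finite_PiE) auto
      then show "card J \<le> q ^ card A" using finA by (simp add: card_PiE)
    qed
    finally show ?thesis by (simp add: mult.assoc)
  qed
  have "F = F2 \<union> F3" by (auto simp: F2_def F3_def)
  then have "card F \<le> card F2 + card F3" by (simp add: card_Un_le)
  also have "\<dots> \<le> (if is_biclique S then q * (q - 1) * (q - 2) ^ (card B - card Y) else 0) * r + q ^ card A * (q - 3) ^ (card B - card Y) * r"
    by (rule add_mono[OF c2 c3])
  finally show ?thesis unfolding F_def[symmetric] Y_def[symmetric] r_def[symmetric] by (simp only: add_mult_distrib)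
qed

lemma mem_complete_bipartite_edges:
  "e \<in> complete_bipartite_edges A B \<longleftrightarrow> (\<exists>x\<in>A. \<exists>y\<in>B. e = {x, y})"
  by (auto simp: complete_bipartite_edges_def)

lemma missing_pairs_subset: "missing_pairs E A B \<subseteq> A \<times> B"
  by (auto simp: missing_pairs_def)

text \<open>The monochromatic pairs of a proper coloring are missing pairs. If there are none, the
  coloring is proper for the whole complete bipartite graph; otherwise it lies in the fiber of a
  nonempty subset.\<close>

lemma num_colorings_le_sum_fibers:
  assumes V: "finite V" and AB: "A \<subseteq> V" "B \<subseteq> V" "A \<inter> B = {}"
    and E: "E \<subseteq> complete_bipartite_edges A B" and small: "card (missing_pairs E A B) < card A"
  shows "num_colorings q V E \<le> num_colorings q V (complete_bipartite_edges A B) +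
    (\<Sum>S\<in>Pow (missing_pairs E A B) - {{}}.
      ((if is_biclique S then q * (q - 1) * (q - 2) ^ (card B - card (snd ` S)) else 0) + q ^ card A * (q - 3) ^ (card B - card (snd ` S)))
      * q ^ (card V - card A - card B))"
proof -
  define M where "M = missing_pairs E A B"
  define K where "K = complete_bipartite_edges A B"
  define F where "F = (\<lambda>S. {f \<in> V \<rightarrow>\<^sub>E {..<q}. mono_pairs A B f = S})"
  define I where "I = Pow M - {{}}"
  have "finite A" "finite B" using AB V by (auto intro: finite_subset)
  then have finM: "finite M" unfolding M_def by (intro finite_subset[OF missing_pairs_subset]) simp
  have finI: "finite I" using finM by (simp add: I_def)
  have finF: "finite (F S)" for S
    by (rule finite_subset[of _ "V \<rightarrow>\<^sub>E {..<q}"]) (use V in \<open>auto simp: F_def intro!: finite_PiE\<close>)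
  have sub: "proper_colorings q V E \<subseteq> proper_colorings q V K \<union> (\<Union>S\<in>I. F S)"
  proof
    fix f assume f: "f \<in> proper_colorings q V E"
    then have fV: "f \<in> V \<rightarrow>\<^sub>E {..<q}" and proper: "\<And>u v. {u, v} \<in> E \<Longrightarrow> f u \<noteq> f v"
      unfolding proper_colorings_def by blast+
    have mono: "mono_pairs A B f \<subseteq> M" using proper by (auto simp: mono_pairs_def M_def missing_pairs_def)
    show "f \<in> proper_colorings q V K \<union> (\<Union>S\<in>I. F S)"
    proof (cases "mono_pairs A B f = {}")
      case True
      have ne: "f x \<noteq> f y" if "x \<in> A" "y \<in> B" for x y
      proof
        assume "f x = f y"
        then have "(x, y) \<in> mono_pairs A B f" using that by (simp add: mono_pairs_def)
        then show False using True by simp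
      qed
      have "f u \<noteq> f v" if uv: "{u, v} \<in> K" for u v
      proof -
        obtain x y where xy: "x \<in> A" "y \<in> B" "{u, v} = {x, y}"
          using uv unfolding K_def mem_complete_bipartite_edges by blast
        then have "(u = x \<and> v = y) \<or> (u = y \<and> v = x)" by (simp add: doubleton_eq_iff)
        then show ?thesis using ne[OF xy(1,2)] by metis
      qed
      then have "f \<in> proper_colorings q V K" using fV unfolding proper_colorings_def by blast
      then show ?thesis by blast
    next
      case False
      then have "mono_pairs A B f \<in> I" "f \<in> F (mono_pairs A B f)" using mono fV by (auto simp: I_def F_def)
      then show ?thesis by blast
    qed
  qed
  have "num_colorings q V E \<le> card (proper_colorings q V K \<union> (\<Union>S\<in>I. F S))"
    unfolding num_colorings_def using sub finite_proper_colorings[OF V] finI finF by (intro card_mono) auto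
  also have "\<dots> \<le> card (proper_colorings q V K) + card (\<Union>S\<in>I. F S)" by (rule card_Un_le)
  also have "\<dots> \<le> card (proper_colorings q V K) + (\<Sum>S\<in>I. card (F S))"
    by (intro add_left_mono card_UN_le finI)
  also have "\<dots> \<le> card (proper_colorings q V K) + (\<Sum>S\<in>I.
      ((if is_biclique S then q * (q - 1) * (q - 2) ^ (card B - card (snd ` S)) else 0) + q ^ card A * (q - 3) ^ (card B - card (snd ` S)))
      * q ^ (card V - card A - card B))"
  proof (intro add_left_mono sum_mono)
    fix S assume S: "S \<in> I"
    have "card S \<le> card M" using S finM by (intro card_mono) (auto simp: I_def)
    then have "card S < card A" using small by (simp add: M_def)
    moreover have "S \<noteq> {}" "S \<subseteq> A \<times> B" using S missing_pairs_subset[of E A B] by (auto simp: I_def M_def)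
    ultimately show "card (F S) \<le> ((if is_biclique S then q * (q - 1) * (q - 2) ^ (card B - card (snd ` S)) else 0) + q ^ card A * (q - 3) ^ (card B - card (snd ` S)))
      * q ^ (card V - card A - card B)"
      unfolding F_def by (intro card_mono_fiber_le[OF V AB])
  qed
  finally show ?thesis unfolding num_colorings_def K_def I_def M_def .
qed

text \<open>For nonempty \<open>X\<close> in \<open>X0\<close> and colors \<open>c\<close>,
  \<open>d\<close>, give \<open>c\<close> to \<open>X\<close> and \<open>y0\<close>, give
  \<open>d\<close> to \<open>A - X\<close>, and let \<open>B - {y0}\<close> avoid both. A vertex of
  \<open>A\<close> outside \<open>X0\<close> always shows \<open>d\<close>, and \<open>y0\<close>
  shows \<open>c\<close>, so \<open>X\<close>, \<open>c\<close> and \<open>d\<close> can be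
  recovered. For a star centered in \<open>B\<close> this attains the main term of the upper
  bound.\<close>

lemma num_colorings_star_ge:
  assumes V: "finite V" and AB: "A \<subseteq> V" "B \<subseteq> V" "A \<inter> B = {}" and q: "2 \<le> q"
    and X0: "X0 \<subseteq> A" "X0 \<noteq> A" and y0: "y0 \<in> B"
  shows "num_colorings q V (complete_bipartite_edges A B) +
      (2 ^ card X0 - 1) * (q * (q - 1)) * ((q - 2) ^ (card B - 1) * q ^ (card V - card A - card B))
    \<le> num_colorings q V (complete_bipartite_edges A B - (\<lambda>x. {x, y0}) ` X0)"
proof -
  define K where "K = complete_bipartite_edges A B"
  define E where "E = K - (\<lambda>x. {x, y0}) ` X0"
  define M where "M = (\<lambda>(X, c, d) v. if v \<in> insert y0 X then {c} else if v \<in> A then {d} else if v \<in> B then {..<q} - {c} - {d} else {..<q::nat})"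
  define D where "D = {(c, d). c < q \<and> d < q \<and> c \<noteq> (d::nat)}"
  define I where "I = (Pow X0 - {{}}) \<times> D"
  have finA: "finite A" using AB V finite_subset by blast
  have finX0: "finite X0" using X0 finA finite_subset by blast
  have finD: "finite D" unfolding D_def by (rule finite_subset[of _ "{..<q} \<times> {..<q}"]) auto
  have finI: "finite I" using finX0 finD by (simp add: I_def)
  have finM: "finite (Pi\<^sub>E V (M p))" for p using V by (cases p) (auto intro!: finite_PiE simp: M_def)
  obtain x1 where x1: "x1 \<in> A" "x1 \<notin> X0" using X0 by blast
  have vals: "f y0 = c \<and> (\<forall>x\<in>X. f x = c) \<and> (\<forall>x\<in>A - X. f x = d) \<and> (\<forall>y\<in>B - {y0}. f y \<noteq> c \<and> f y \<noteq> d) \<and> (\<forall>v\<in>V. f v < q)"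
    if p: "(X, c, d) \<in> I" and f: "f \<in> Pi\<^sub>E V (M (X, c, d))" for X c d f
  proof -
    have p': "X \<subseteq> X0" "c < q" "d < q" "c \<noteq> d" using p by (auto simp: I_def D_def)
    have m: "f v \<in> M (X, c, d) v" if "v \<in> V" for v using f that by auto
    have 1: "f v = c" if "v \<in> insert y0 X" for v
      using m[of v] that p' X0 AB y0 by (auto simp: M_def)
    have 2: "f v = d" if "v \<in> A - X" for v
    proof -
      have "v \<in> V" "v \<noteq> y0" using that AB y0 by auto
      then show ?thesis using m[of v] that by (simp add: M_def)
    qed
    have 3: "f v \<noteq> c \<and> f v \<noteq> d" if "v \<in> B - {y0}" for v
    proof -
      have "v \<in> V" "v \<notin> insert y0 X" "v \<notin> A" "v \<in> B" using that AB p' X0 by auto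
      then show ?thesis using m[of v] by (simp add: M_def)
    qed
    have 4: "f v < q" if "v \<in> V" for v
      using m[OF that] p' by (auto simp: M_def split: if_splits)
    show ?thesis using 1 2 3 4 by blast
  qed
  have subE: "Pi\<^sub>E V (M p) \<subseteq> proper_colorings q V E - proper_colorings q V K" if p: "p \<in> I" for p
  proof
    fix f assume f: "f \<in> Pi\<^sub>E V (M p)"
    obtain X c d where Xcd: "p = (X, c, d)" by (cases p)
    note v = vals[OF p[unfolded Xcd] f[unfolded Xcd]]
    have X: "X \<subseteq> X0" "X \<noteq> {}" "c \<noteq> d" using p by (auto simp: I_def D_def Xcd)
    have ne: "f x \<noteq> f y" if xy: "x \<in> A" "y \<in> B" "{x, y} \<in> E" for x y
    proof (cases "y = y0")
      case True
      then have "x \<notin> X" using xy(3) X(1) by (auto simp: E_def)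
      then show ?thesis using v xy True X(3) by simp
    next
      case False
      then show ?thesis using v xy by (cases "x \<in> X") auto
    qed
    have "f u \<noteq> f w" if uw: "{u, w} \<in> E" for u w
    proof -
      have "{u, w} \<in> K" using uw by (simp add: E_def)
      then obtain x y where xy: "x \<in> A" "y \<in> B" "{u, w} = {x, y}"
        unfolding K_def mem_complete_bipartite_edges by blast
      then have "(u = x \<and> w = y) \<or> (u = y \<and> w = x)" by (simp add: doubleton_eq_iff)
      moreover have "f x \<noteq> f y" using ne xy uw by metis
      ultimately show ?thesis by metis
    qed
    then have 1: "f \<in> proper_colorings q V E" using f v by (auto simp: proper_colorings_def PiE_iff)
    obtain x where "x \<in> X" using X(2) by blast
    then have "{x, y0} \<in> K" "f x = f y0" using X(1) X0(1) y0 v by (auto simp: K_def mem_complete_bipartite_edges)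
    then have "f \<notin> proper_colorings q V K" unfolding proper_colorings_def by blast
    with 1 show "f \<in> proper_colorings q V E - proper_colorings q V K" by simp
  qed
  have disj: "Pi\<^sub>E V (M p) \<inter> Pi\<^sub>E V (M p') = {}" if pp: "p \<in> I" "p' \<in> I" "p \<noteq> p'" for p p'
  proof (rule ccontr)
    assume "Pi\<^sub>E V (M p) \<inter> Pi\<^sub>E V (M p') \<noteq> {}"
    then obtain f where f: "f \<in> Pi\<^sub>E V (M p)" "f \<in> Pi\<^sub>E V (M p')" by blast
    obtain X c d where Xcd: "p = (X, c, d)" by (cases p)
    obtain X' c' d' where Xcd': "p' = (X', c', d')" by (cases p')
    note v = vals[OF pp(1)[unfolded Xcd] f(1)[unfolded Xcd]]
    note v' = vals[OF pp(2)[unfolded Xcd'] f(2)[unfolded Xcd']]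
    have X: "X \<subseteq> X0" "c \<noteq> d" "X' \<subseteq> X0" "c' \<noteq> d'" using pp by (auto simp: I_def D_def Xcd Xcd')
    have vX: "\<forall>x\<in>X. f x = c" "\<forall>x\<in>A - X. f x = d" and vX': "\<forall>x\<in>X'. f x = c'" "\<forall>x\<in>A - X'. f x = d'"
      using v v' by blast+
    have "c = c'" using v v' by blast
    moreover have "x1 \<in> A - X" "x1 \<in> A - X'" using x1 X by auto
    then have "f x1 = d" "f x1 = d'" using vX(2) vX'(2) by blast+
    then have "d = d'" by simp
    moreover have "X = {x \<in> A. f x = c}" using vX X(1,2) X0(1) by auto
    moreover have "X' = {x \<in> A. f x = c'}" using vX' X(3,4) X0(1) by auto
    ultimately have "p = p'" by (simp add: Xcd Xcd')
    then show False using pp(3) by simp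
  qed
  have cardM: "card (Pi\<^sub>E V (M p)) = (q - 2) ^ (card B - 1) * q ^ (card V - card A - card B)" if p: "p \<in> I" for p
  proof -
    obtain X c d where Xcd: "p = (X, c, d)" by (cases p)
    have X: "X \<subseteq> X0" "c < q" "d < q" "c \<noteq> d" using p by (auto simp: I_def D_def Xcd)
    have "card (Pi\<^sub>E V (M p)) = (q - 2) ^ (card B - card {y0}) * q ^ (card V - card A - card B)"
    proof (rule card_PiE_blocks_eq[OF V AB])
      show "{y0} \<subseteq> B" using y0 by simp
      show "card (M p v) = 1" if "v \<in> A \<union> {y0}" for v using that by (auto simp: M_def Xcd)
      show "card (M p v) = q - 2" if "v \<in> B - {y0}" for v
      proof -
        have "v \<notin> insert y0 X" "v \<notin> A" "v \<in> B" using that AB X X0 by auto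
        then have "M p v = {..<q} - {c} - {d}" by (simp add: M_def Xcd)
        then show ?thesis using X by (simp add: card_Diff_singleton numeral_2_eq_2)
      qed
      show "card (M p v) = q" if "v \<in> V - A - B" for v
      proof -
        have "v \<notin> insert y0 X" "v \<notin> A" "v \<notin> B" using that y0 X X0 by auto
        then show ?thesis by (simp add: M_def Xcd)
      qed
    qed
    then show ?thesis by simp
  qed
  have KE: "proper_colorings q V K \<subseteq> proper_colorings q V E"
    unfolding proper_colorings_def E_def by blast
  have "card I = (2 ^ card X0 - 1) * (q * (q - 1))"
    unfolding I_def card_cartesian_product D_def card_ordered_pairs_distinct
    using finX0 by (simp add: card_Diff_subset card_Pow)
  then have "card (\<Union>p\<in>I. Pi\<^sub>E V (M p)) = (2 ^ card X0 - 1) * (q * (q - 1)) * ((q - 2) ^ (card B - 1) * q ^ (card V - card A - card B))"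
    using finI finM disj cardM by (subst card_UN_disjoint) auto
  moreover have "card (\<Union>p\<in>I. Pi\<^sub>E V (M p)) \<le> card (proper_colorings q V E - proper_colorings q V K)"
    using subE finite_proper_colorings[OF V] by (intro card_mono) auto
  moreover have "card (proper_colorings q V E - proper_colorings q V K) = num_colorings q V E - num_colorings q V K"
    unfolding num_colorings_def using KE finite_proper_colorings[OF V] by (intro card_Diff_subset) auto
  moreover have "num_colorings q V K \<le> num_colorings q V E"
    unfolding num_colorings_def using KE finite_proper_colorings[OF V] by (intro card_mono) auto
  ultimately show ?thesis unfolding K_def[symmetric] E_def[symmetric] by linarith
qed

text \<open>A biclique containing \<open>(x, y)\<close> and \<open>(x', y')\<close> also contains
  \<open>(x, y')\<close>. So the subsets of \<open>M\<close> with the first two pairs but not the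
  third are no bicliques, and they are at least one eighth of all subsets. The additional
  \<open>8\<close> stands for the empty set.\<close>

lemma card_bicliques_nonstar:
  assumes fin: "finite M" and p: "(x, y) \<in> M" "(x', y') \<in> M" "x \<noteq> x'" "y \<noteq> y'"
  shows "8 * card {S \<in> Pow M. is_biclique S} + 8 + 2 ^ card M \<le> 8 * 2 ^ card M"
proof -
  define R where "R = M - {(x, y), (x', y'), (x, y')}"
  define T where "T = (\<lambda>S. insert (x, y) (insert (x', y') S)) ` Pow R"
  have "inj_on (\<lambda>S. insert (x, y) (insert (x', y') S)) (Pow R)"
    by (rule inj_on_inverseI[of _ "\<lambda>S. S - {(x, y), (x', y')}"]) (auto simp: R_def)
  then have cT: "card T = 2 ^ card R" using fin by (simp add: T_def card_image card_Pow R_def)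
  have "card M \<le> card (R \<union> {(x, y), (x', y'), (x, y')})" using fin by (intro card_mono) (auto simp: R_def)
  also have "\<dots> \<le> card R + card {(x, y), (x', y'), (x, y')}" by (rule card_Un_le)
  also have "\<dots> \<le> card R + 3" by (simp add: card_insert_if)
  finally have "(2::nat) ^ card M \<le> 2 ^ (card R + 3)" by (intro power_increasing) auto
  then have T8: "2 ^ card M \<le> 8 * card T" by (simp add: cT power_add)
  define C where "C = {S \<in> Pow M. is_biclique S}"
  have "T \<inter> C = {}"
  proof (rule ccontr)
    assume "T \<inter> C \<noteq> {}"
    then obtain S where S: "S \<in> T" "is_biclique S" by (auto simp: C_def)
    then have "(x, y) \<in> S" "(x', y') \<in> S" "(x, y') \<notin> S" using p by (auto simp: T_def R_def)
    moreover have "S = fst ` S \<times> snd ` S" using S(2) by (simp add: is_biclique_def)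
    ultimately show False by (metis SigmaI fst_conv image_eqI snd_conv)
  qed
  moreover have "{} \<notin> T \<union> C" by (auto simp: T_def C_def is_biclique_def)
  moreover have "finite T" "finite C" using fin by (auto simp: T_def C_def R_def)
  ultimately have "card (insert {} (T \<union> C)) = card T + card C + 1" by (simp add: card_Un_disjoint)
  moreover have "insert {} (T \<union> C) \<subseteq> Pow M" using p by (auto simp: T_def C_def R_def)
  then have "card (insert {} (T \<union> C)) \<le> card (Pow M)" using fin by (intro card_mono) auto
  ultimately have "card T + card C + 1 \<le> 2 ^ card M" using fin by (simp add: card_Pow)
  then show ?thesis using T8 unfolding C_def by linarith
qed

text \<open>In a star centered on the \<open>A\<close> side the second coordinates are distinct.
  Hence a subset with at least two elements contributes at most half of \<open>r ^ (b - 1)\<close>,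
  and only the \<open>card M\<close> singletons contribute it fully.\<close>

lemma sum_star_subsets_le:
  fixes r b :: nat
  assumes fin: "finite M" and M: "\<And>p. p \<in> M \<Longrightarrow> fst p = x" and r: "2 \<le> r" and m: "2 \<le> card M" "card M \<le> b"
  shows "8 * (\<Sum>S\<in>Pow M - {{}}. r ^ (b - card (snd ` S))) + 8 * r ^ (b - 1) \<le> 7 * 2 ^ card M * r ^ (b - 1)"
proof -
  define \<mu> where "\<mu> = card M"
  define R where "R = r ^ (b - 1)"
  define I1 where "I1 = {S. S \<subseteq> M \<and> card S = 1}"
  define I where "I = Pow M - {{}}"
  have finI: "finite I" using fin by (simp add: I_def)
  have I1: "I1 \<subseteq> I" by (auto simp: I1_def I_def)
  have cI1: "card I1 = \<mu>" unfolding I1_def \<mu>_def using n_subsets[OF fin, of 1] by simp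
  have cI: "card I = 2 ^ \<mu> - 1" using fin by (simp add: I_def card_Diff_subset card_Pow \<mu>_def)
  have cS: "card (snd ` S) = card S" if "S \<in> I" for S
  proof -
    have "inj_on snd S"
    proof (rule inj_onI)
      fix u v assume uv: "u \<in> S" "v \<in> S" "snd u = snd v"
      have "S \<subseteq> M" using \<open>S \<in> I\<close> by (simp add: I_def)
      then have "fst u = x" "fst v = x" using M[of u] M[of v] uv(1,2) by blast+
      then show "u = v" using uv(3) by (simp add: prod_eq_iff)
    qed
    then show ?thesis by (rule card_image)
  qed
  have term1: "2 * r ^ (b - card (snd ` S)) \<le> 2 * R" if "S \<in> I1" for S
    using that cS[of S] I1 by (auto simp: I1_def R_def)
  have term2: "2 * r ^ (b - card (snd ` S)) \<le> R" if S: "S \<in> I - I1" for S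
  proof -
    have "finite S" using S fin finite_subset by (auto simp: I_def)
    then have "card S \<noteq> 0" "card S \<noteq> 1" "card S \<le> b"
      using S m(2) card_mono[OF fin, of S] by (auto simp: I_def I1_def)
    then have S2: "2 \<le> card S" "card S \<le> b" by auto
    have "2 * r ^ (b - card S) \<le> r * r ^ (b - card S)" using r by simp
    also have "\<dots> = r ^ (Suc (b - card S))" by simp
    also have "\<dots> \<le> r ^ (b - 1)" using S2 r by (intro power_increasing) auto
    finally show ?thesis using cS[of S] S by (simp add: R_def)
  qed
  have "2 * (\<Sum>S\<in>I. r ^ (b - card (snd ` S))) = (\<Sum>S\<in>I. 2 * r ^ (b - card (snd ` S)))" by (simp add: sum_distrib_left)
  also have "\<dots> = (\<Sum>S\<in>I - I1. 2 * r ^ (b - card (snd ` S))) + (\<Sum>S\<in>I1. 2 * r ^ (b - card (snd ` S)))"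
    by (rule sum.subset_diff[OF I1 finI])
  also have "\<dots> \<le> (\<Sum>S\<in>I - I1. R) + (\<Sum>S\<in>I1. 2 * R)" using term1 term2 by (intro add_mono sum_mono)
  also have "\<dots> = (2 ^ \<mu> - 1 - \<mu>) * R + \<mu> * (2 * R)"
    using I1 finI cI cI1 finite_subset[OF I1 finI] by (simp add: card_Diff_subset)
  also have "\<dots> = (2 ^ \<mu> - 1 - \<mu> + 2 * \<mu>) * R" by (simp add: algebra_simps)
  finally have s: "2 * (\<Sum>S\<in>I. r ^ (b - card (snd ` S))) \<le> (2 ^ \<mu> - 1 - \<mu> + 2 * \<mu>) * R" .
  \<comment> \<open>Equality holds for \<open>\<mu> = 2\<close>, so the constant \<open>7/8\<close>
    is exactly what this case permits.\<close>
  have p: "4 * \<mu> + 4 \<le> 3 * 2 ^ \<mu>"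
    using m(1) unfolding \<mu>_def[symmetric] by (induction \<mu> rule: nat_induct_at_least) auto
  then have q: "4 * (2 ^ \<mu> - 1 - \<mu> + 2 * \<mu>) + 8 \<le> 7 * 2 ^ \<mu>"
  proof -
    have "\<mu> + 1 \<le> 2 ^ \<mu>" by (simp add: Suc_leI)
    then obtain N where N: "2 ^ \<mu> = \<mu> + 1 + N" using le_Suc_ex by blast
    show ?thesis using p unfolding N by simp
  qed
  have "8 * (\<Sum>S\<in>I. r ^ (b - card (snd ` S))) + 8 * R = 4 * (2 * (\<Sum>S\<in>I. r ^ (b - card (snd ` S)))) + 8 * R" by simp
  also have "\<dots> \<le> 4 * ((2 ^ \<mu> - 1 - \<mu> + 2 * \<mu>) * R) + 8 * R" using s by (intro add_mono mult_left_mono) auto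
  also have "\<dots> = (4 * (2 ^ \<mu> - 1 - \<mu> + 2 * \<mu>) + 8) * R" by (simp only: add_mult_distrib mult.assoc)
  also have "\<dots> \<le> 7 * 2 ^ \<mu> * R" using q by (rule mult_le_mono1)
  finally show ?thesis unfolding I_def R_def \<mu>_def .
qed

text \<open>A bipartite graph has no triangles, so pairwise intersecting edges have a common
  endpoint.\<close>

lemma disjoint_pairs_or_star:
  obtains (disj) x y x' y' where "(x, y) \<in> M" "(x', y') \<in> M" "x \<noteq> x'" "y \<noteq> y'"
    | (fst) x where "\<And>p. p \<in> M \<Longrightarrow> fst p = x"
    | (snd) y where "\<And>p. p \<in> M \<Longrightarrow> snd p = y"
proof (cases "M = {}")
  case True
  then show thesis using fst by blast
next
  case False
  then obtain x y where xy: "(x, y) \<in> M" by auto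
  show thesis
  proof (cases "(\<forall>p\<in>M. fst p = x) \<or> (\<forall>p\<in>M. snd p = y)")
    case True
    then show thesis using fst snd by blast
  next
    case False
    then obtain x1 y1 x2 y2 where p: "(x1, y1) \<in> M" "x1 \<noteq> x" "(x2, y2) \<in> M" "y2 \<noteq> y" by fastforce
    show thesis
    proof (cases "y1 = y")
      case False
      then show thesis using disj[OF xy p(1)] p by auto
    next
      case y1: True
      show thesis
      proof (cases "x2 = x")
        case False
        then show thesis using disj[OF xy p(3)] p by auto
      next
        case True
        then show thesis using disj[OF p(1) p(3)] p y1 by auto
      qed
    qed
  qed
qed

text \<open>The competitor has equally many missing edges, arranged as a star centered in
  \<open>B\<close>, where all nonempty subsets contribute fully. In any other shape that the
  conclusion forbids, the bicliques reach at most \<open>7/8 * 2 ^ \<mu> - 1\<close> of the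
  \<open>2 ^ \<mu> - 1\<close> full contributions, and by \<open>num\<close> the colorings with more
  than two colors on \<open>A\<close> do not make up for it.\<close>

lemma maximizer_semi_complete:
  assumes max: "maximizes_colorings q n m V E" and q: "3 \<le> q"
    and AB: "A \<subseteq> V" "B \<subseteq> V" "A \<inter> B = {}" and E: "E \<subseteq> complete_bipartite_edges A B"
    and few: "card A * card B < m + card A" and ab: "0 < card A" "card A \<le> card B"
    and num: "8 * (q ^ card A * (q - 3) ^ card B) < q * (q - 1) * (q - 2) ^ (card B - 1)"
  shows "semi_complete_plus_isolated (q \<ge> 4) (card A) (card B) V E"
proof -
  have V: "finite V" "E \<subseteq> [V]\<^bsup>2\<^esup>" "card E = m" "card V = n" using max by (auto simp: maximizes_colorings_def nm_graph_def)
  define K where "K = complete_bipartite_edges A B"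
  define M where "M = missing_pairs E A B"
  define a b \<mu> where "a = card A" and "b = card B" and "\<mu> = card M"
  have finA: "finite A" and finB: "finite B" using AB V by (auto intro: finite_subset)
  have finM: "finite M" unfolding M_def using finA finB by (intro finite_subset[OF missing_pairs_subset]) simp
  have finK: "finite K" unfolding K_def using finA finB by (rule card_complete_bipartite_edges_le(2))
  have inj: "inj_on (\<lambda>(x, y). {x, y}) (A \<times> B)"
    using AB(3) by (fastforce simp: inj_on_def doubleton_eq_iff)
  have KE: "K - E = (\<lambda>(x, y). {x, y}) ` M"
  proof (intro set_eqI iffI)
    fix e assume "e \<in> K - E"
    then have "e \<in> K" "e \<notin> E" by auto
    then obtain x y where xy: "x \<in> A" "y \<in> B" "e = {x, y}" unfolding K_def mem_complete_bipartite_edges by blast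
    then have "(x, y) \<in> M" using \<open>e \<notin> E\<close> by (simp add: M_def missing_pairs_def)
    then show "e \<in> (\<lambda>(x, y). {x, y}) ` M" using xy(3) by (intro image_eqI[of _ _ "(x, y)"]) auto
  next
    fix e assume "e \<in> (\<lambda>(x, y). {x, y}) ` M"
    then show "e \<in> K - E" by (auto simp: M_def missing_pairs_def K_def mem_complete_bipartite_edges)
  qed
  have "card ((\<lambda>(x, y). {x, y}) ` M) = \<mu>"
    unfolding \<mu>_def using inj missing_pairs_subset[of E A B] by (intro card_image) (auto simp: M_def intro: inj_on_subset)
  then have "card (K - E) = \<mu>" by (simp add: KE)
  moreover have "card (K - E) = card K - card E" using E finK finite_subset by (intro card_Diff_subset) (auto simp: K_def)
  moreover have "card E \<le> card K" using E finK by (intro card_mono) (auto simp: K_def)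
  moreover have "card K = a * b" unfolding K_def a_def b_def by (rule card_complete_bipartite_edges[OF AB(3)])
  ultimately have m: "m + \<mu> = a * b" using V(3) by simp
  then have \<mu>: "\<mu> < a" using few by (simp add: a_def b_def)
  have no_gain: False if gain: "8 * (\<Sum>S\<in>{S \<in> Pow M. is_biclique S}. (q - 2) ^ (b - card (snd ` S))) + 8 * (q - 2) ^ (b - 1)
      \<le> 7 * 2 ^ \<mu> * (q - 2) ^ (b - 1)"
  proof -
    define R where "R = (q - 2) ^ (b - 1)"
    define Q where "Q = q * (q - 1)"
    define I where "I = q ^ (card V - a - b)"
    define W where "W = q ^ a * (q - 3) ^ b"
    define s where "s = (\<Sum>S\<in>{S \<in> Pow M. is_biclique S}. (q - 2) ^ (b - card (snd ` S)))"
    obtain X0 where X0: "X0 \<subseteq> A" "card X0 = \<mu>" using obtain_subset_with_card_n[of \<mu> A] \<mu> by (auto simp: a_def)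
    have "X0 \<noteq> A" using X0(2) \<mu> by (auto simp: a_def)
    have "B \<noteq> {}" using ab by auto
    then obtain y0 where y0: "y0 \<in> B" by blast
    define E' where "E' = K - (\<lambda>x. {x, y0}) ` X0"
    have "(\<lambda>x. {x, y0}) ` X0 \<subseteq> K" using X0(1) y0 unfolding K_def complete_bipartite_edges_def by blast
    moreover have "card ((\<lambda>x. {x, y0}) ` X0) = \<mu>"
      using X0 y0 AB(3) by (subst card_image) (auto simp: inj_on_def doubleton_eq_iff)
    ultimately have "card E' = a * b - \<mu>"
      unfolding E'_def using finK \<open>card K = a * b\<close> finite_subset[of "(\<lambda>x. {x, y0}) ` X0" K] by (subst card_Diff_subset) auto
    then have "nm_graph n m V E'"
      using m V complete_bipartite_edges_nsets[OF AB] unfolding nm_graph_def E'_def K_def by auto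
    then have le: "num_colorings q V E' \<le> num_colorings q V E" using max by (simp add: maximizes_colorings_def)
    have "num_colorings q V K + (2 ^ \<mu> - 1) * Q * (R * I) \<le> num_colorings q V E'"
      using num_colorings_star_ge[OF V(1) AB _ X0(1) \<open>X0 \<noteq> A\<close> y0, of q] q
      unfolding E'_def K_def X0(2) Q_def R_def I_def a_def b_def by simp
    also note le
    also have "num_colorings q V E \<le> num_colorings q V K +
      (\<Sum>S\<in>Pow M - {{}}. ((if is_biclique S then Q * (q - 2) ^ (b - card (snd ` S)) else 0) + q ^ a * (q - 3) ^ (b - card (snd ` S))) * I)"
      unfolding K_def M_def Q_def I_def a_def b_def
      using \<mu> by (intro num_colorings_le_sum_fibers[OF V(1) AB E]) (simp add: \<mu>_def M_def a_def)
    also have "\<dots> \<le> num_colorings q V K +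
      (\<Sum>S\<in>Pow M - {{}}. ((if is_biclique S then Q * (q - 2) ^ (b - card (snd ` S)) else 0) + W) * I)"
    proof (intro add_left_mono sum_mono mult_right_mono)
      fix S assume S: "S \<in> Pow M - {{}}"
      then have "S \<subseteq> M" by blast
      then have "finite S" "card S \<le> \<mu>" unfolding \<mu>_def using finite_subset[OF _ finM] card_mono[OF finM] by simp_all
      then have "card (snd ` S) \<le> \<mu>" using card_image_le[of S snd] by linarith
      then have "card (snd ` S) < b" using \<mu> ab by (simp add: a_def b_def)
      then have "(q - 3) ^ (b - card (snd ` S)) \<le> (q - 3) ^ b"
        by (cases "q = 3") (use q in \<open>auto intro!: power_increasing simp: power_0_left\<close>)
      then show "q ^ a * (q - 3) ^ (b - card (snd ` S)) \<le> W" by (simp add: W_def)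
    qed auto
    also have "(\<Sum>S\<in>Pow M - {{}}. ((if is_biclique S then Q * (q - 2) ^ (b - card (snd ` S)) else 0) + W) * I)
      = (Q * s + (2 ^ \<mu> - 1) * W) * I"
    proof -
      have "(\<Sum>S\<in>Pow M - {{}}. if is_biclique S then Q * (q - 2) ^ (b - card (snd ` S)) else 0)
        = (\<Sum>S\<in>{S \<in> Pow M. is_biclique S}. Q * (q - 2) ^ (b - card (snd ` S)))"
        using finM by (intro sum.mono_neutral_cong_right) (auto simp: is_biclique_def)
      moreover have "card (Pow M - {{}}) = 2 ^ \<mu> - 1" using finM by (simp add: card_Diff_subset card_Pow \<mu>_def)
      ultimately show ?thesis
        unfolding sum_distrib_right[symmetric] sum.distrib by (simp add: s_def sum_distrib_left)
    qed
    finally have "(2 ^ \<mu> - 1) * Q * R * I \<le> (Q * s + (2 ^ \<mu> - 1) * W) * I" by (simp add: mult.assoc)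
    moreover have "0 < I" using q by (simp add: I_def)
    ultimately have main: "(2 ^ \<mu> - 1) * (Q * R) \<le> Q * s + (2 ^ \<mu> - 1) * W" by (simp add: mult.assoc)
    have "8 * W < Q * R" using num by (simp add: W_def Q_def R_def a_def b_def)
    moreover have "Q * (8 * s + 8 * R) \<le> Q * (7 * 2 ^ \<mu> * R)"
      using gain unfolding s_def[symmetric] R_def[symmetric] by (rule mult_le_mono2)
    moreover obtain N where N: "2 ^ \<mu> = Suc N" by (metis not0_implies_Suc power_not_zero zero_neq_numeral)
    ultimately show False using main
    proof -
      assume w: "8 * W < Q * R" and g: "Q * (8 * s + 8 * R) \<le> Q * (7 * 2 ^ \<mu> * R)"
      \<comment> \<open>Here \<open>8 * Q * s\<close> is at most \<open>(7 * N - 1) * Q * R\<close>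
        and \<open>8 * N * W\<close> is at most \<open>N * Q * R\<close>, so \<open>main'\<close>
        fails by an eighth of \<open>Q * R\<close>.\<close>
      have main': "N * (Q * R) \<le> Q * s + N * W" using main by (simp add: N)
      have g': "8 * (Q * s) + 8 * (Q * R) \<le> 7 * (N * (Q * R)) + 7 * (Q * R)"
        using g unfolding N by (simp add: algebra_simps)
      have "8 * (N * W) \<le> N * (Q * R)" using w mult_le_mono2[of "8 * W" "Q * R" N] by (simp add: mult.left_commute)
      then show False using main' g' w by linarith
    qed
  qed
  have "\<exists>v\<in>A \<union> B. (\<forall>p\<in>M. v = fst p \<or> v = snd p) \<and> (4 \<le> q \<longrightarrow> v \<in> B)"
  proof (cases rule: disjoint_pairs_or_star[of M])
    case (disj x y x' y')
    have "(\<Sum>S\<in>{S \<in> Pow M. is_biclique S}. (q - 2) ^ (b - card (snd ` S))) \<le> (\<Sum>S\<in>{S \<in> Pow M. is_biclique S}. (q - 2) ^ (b - 1))"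
    proof (intro sum_mono power_increasing)
      fix S assume S: "S \<in> {S \<in> Pow M. is_biclique S}"
      then have "S \<subseteq> M" "S \<noteq> {}" by (auto simp: is_biclique_def)
      then have "finite (snd ` S)" "snd ` S \<noteq> {}" using finite_subset[OF _ finM] by simp_all
      then have "0 < card (snd ` S)" by (simp add: card_gt_0_iff)
      then show "b - card (snd ` S) \<le> b - 1" by simp
    qed (use q in simp)
    then have "8 * (\<Sum>S\<in>{S \<in> Pow M. is_biclique S}. (q - 2) ^ (b - card (snd ` S))) + 8 * (q - 2) ^ (b - 1)
      \<le> (8 * card {S \<in> Pow M. is_biclique S} + 8) * (q - 2) ^ (b - 1)"
      unfolding sum_constant add_mult_distrib by (simp add: mult.assoc)
    also have "\<dots> \<le> (7 * 2 ^ \<mu>) * (q - 2) ^ (b - 1)"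
    proof (rule mult_le_mono1)
      show "8 * card {S \<in> Pow M. is_biclique S} + 8 \<le> 7 * 2 ^ \<mu>"
        using card_bicliques_nonstar[OF finM disj] unfolding \<mu>_def by linarith
    qed
    finally show ?thesis using no_gain by blast
  next
    case (snd y)
    show ?thesis
    proof (cases "M = {}")
      case True
      have "B \<noteq> {}" using ab by auto
      then show ?thesis using True by blast
    next
      case False
      then have "y \<in> B" using snd missing_pairs_subset[of E A B] by (auto simp: M_def)
      then show ?thesis using snd by auto
    qed
  next
    case (fst x)
    \<comment> \<open>A center in \<open>A\<close> is allowed for \<open>q = 3\<close>. For larger
      \<open>q\<close> it is excluded when at least two pairs are missing, while a single missing
      pair can be regarded as centered at its end in \<open>B\<close>.\<close>
    have "q = 3 \<or> 4 \<le> q" "M = {} \<longrightarrow> \<mu> \<le> 1" "\<mu> \<le> 1 \<or> 2 \<le> \<mu>" using q by (auto simp: \<mu>_def)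
    then consider "q = 3" "M \<noteq> {}" | "4 \<le> q" "2 \<le> \<mu>" | "\<mu> \<le> 1" by blast
    then show ?thesis
    proof cases
      case 1
      then have "x \<in> A" using fst missing_pairs_subset[of E A B] by (auto simp: M_def)
      then show ?thesis using fst 1(1) by (intro bexI[of _ x]) auto
    next
      case 2
      have "{S \<in> Pow M. is_biclique S} \<subseteq> Pow M - {{}}" by (auto simp: is_biclique_def)
      then have "(\<Sum>S\<in>{S \<in> Pow M. is_biclique S}. (q - 2) ^ (b - card (snd ` S))) \<le> (\<Sum>S\<in>Pow M - {{}}. (q - 2) ^ (b - card (snd ` S)))"
        using finM by (intro sum_mono2) auto
      moreover have "8 * (\<Sum>S\<in>Pow M - {{}}. (q - 2) ^ (b - card (snd ` S))) + 8 * (q - 2) ^ (b - 1) \<le> 7 * 2 ^ card M * (q - 2) ^ (b - 1)"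
        using 2 \<mu> ab by (intro sum_star_subsets_le[OF finM fst]) (auto simp: \<mu>_def a_def b_def)
      ultimately have "8 * (\<Sum>S\<in>{S \<in> Pow M. is_biclique S}. (q - 2) ^ (b - card (snd ` S))) + 8 * (q - 2) ^ (b - 1)
        \<le> 7 * 2 ^ \<mu> * (q - 2) ^ (b - 1)" unfolding \<mu>_def by linarith
      then show ?thesis using no_gain by blast
    next
      case 3
      show ?thesis
      proof (cases "M = {}")
        case True
        have "B \<noteq> {}" using ab by auto
        then show ?thesis using True by blast
      next
        case False
        then have "card M = 1" using 3 finM by (simp add: \<mu>_def le_Suc_eq)
        then obtain p where p: "M = {p}" by (auto simp: card_1_singleton_iff)
        then have "snd p \<in> B" using missing_pairs_subset[of E A B] by (auto simp: M_def)
        then show ?thesis using p by auto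
      qed
    qed
  qed
  then obtain v where v: "v \<in> A \<union> B" "\<And>p. p \<in> M \<Longrightarrow> v = fst p \<or> v = snd p" "4 \<le> q \<Longrightarrow> v \<in> B" by blast
  have star': "\<forall>e\<in>K - E. v \<in> e"
  proof
    fix e assume "e \<in> K - E"
    then obtain p where p: "p \<in> M" "e = {fst p, snd p}" unfolding KE by (auto simp: case_prod_beta)
    then show "v \<in> e" using v(2)[OF p(1)] by simp
  qed
  have "K - E \<subseteq> K" "E = K - (K - E)" using E unfolding K_def by blast+
  moreover have "card (K - E) < card A" using \<open>card (K - E) = \<mu>\<close> \<mu> by (simp add: a_def)
  ultimately have "A \<subseteq> V \<and> B \<subseteq> V \<and> A \<inter> B = {} \<and> finite A \<and> finite B \<and> card A = card A \<and> card B = card B \<and>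
      K - E \<subseteq> complete_bipartite_edges A B \<and> card (K - E) < card A \<and>
      v \<in> A \<union> B \<and> (\<forall>e\<in>K - E. v \<in> e) \<and> (q \<ge> 4 \<longrightarrow> v \<in> B) \<and> E = complete_bipartite_edges A B - (K - E)"
    using AB finA finB v(1,3) star' unfolding K_def by (intro conjI impI refl) assumption+
  then show ?thesis
    unfolding semi_complete_plus_isolated_def using ab
    by - (rule conjI, assumption, rule conjI, assumption, rule exI[of _ A], rule exI[of _ B], rule exI[of _ "K - E"], rule exI[of _ v])
qed

section \<open>Limits\<close>

text \<open>Let \<open>M k\<close> be a threshold for \<open>\<epsilon> = 1 / (k + 1)\<close>. At
  \<open>m\<close>, use the largest \<open>k <= m\<close> whose threshold has been passed; it tends
  to infinity, so a single null sequence replaces the quantifier over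
  \<open>\<epsilon>\<close>.\<close>

lemma diagonal_rate:
  fixes Q :: "real \<Rightarrow> nat \<Rightarrow> bool"
  assumes "\<And>\<epsilon>. 0 < \<epsilon> \<Longrightarrow> \<forall>\<^sub>F m in sequentially. Q \<epsilon> m"
  obtains \<delta> M where "\<delta> \<longlonglongrightarrow> 0" "\<And>m. M \<le> m \<Longrightarrow> Q (\<delta> m) m"
proof -
  have "\<exists>M. \<forall>m\<ge>M. Q (1 / (real k + 1)) m" for k :: nat
    using assms[of "1 / (real k + 1)"] by (simp add: eventually_sequentially)
  then obtain M where M: "\<And>k m. M k \<le> m \<Longrightarrow> Q (1 / (real k + 1)) m" by metis
  define g where "g = (\<lambda>m. Max {k. k \<le> m \<and> M k \<le> m})"
  have fin: "finite {k. k \<le> m \<and> M k \<le> m}" for m by (rule finite_subset[of _ "{..m}"]) auto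
  have g_ge: "K \<le> g m" if "K \<le> m" "M K \<le> m" for K m
    unfolding g_def using fin that by (intro Max_ge) auto
  have g_M: "M (g m) \<le> m" if "M 0 \<le> m" for m
  proof -
    have "g m \<in> {k. k \<le> m \<and> M k \<le> m}" unfolding g_def using fin that by (intro Max_in) auto
    then show ?thesis by simp
  qed
  have lim: "(\<lambda>m. 1 / (real (g m) + 1)) \<longlonglongrightarrow> 0"
  proof (rule LIMSEQ_I)
    fix r :: real assume r: "0 < r"
    obtain K :: nat where K: "1 / r < real K" using reals_Archimedean2 by blast
    have "norm (1 / (real (g m) + 1) - 0) < r" if "max K (M K) \<le> m" for m
    proof -
      have "real K \<le> real (g m)" using g_ge[of K m] that by simp
      then have "1 / r < real (g m) + 1" using K by simp
      then show ?thesis using r by (simp add: field_simps)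
    qed
    then show "\<exists>no. \<forall>n\<ge>no. norm (1 / (real (g n) + 1) - 0) < r" by blast
  qed
  show thesis
    by (rule that[OF lim, of "M 0"]) (use M g_M in blast)
qed

text \<open>Infinitely many vertex sets are compared, but all values are at most
  \<open>q ^ n\<close>, so the maximum makes sense.\<close>

lemma finite_num_colorings_values:
  "finite {num_colorings q V E | (V :: nat set) E. nm_graph n m V E}"
proof (rule finite_subset)
  show "{num_colorings q V E | (V :: nat set) E. nm_graph n m V E} \<subseteq> {..q ^ n}"
  proof clarify
    fix V :: "nat set" and E assume "nm_graph n m V E"
    then have V: "finite V" "card V = n" by (auto simp: nm_graph_def)
    have "card (proper_colorings q V E) \<le> card (V \<rightarrow>\<^sub>E {..<q})"
      using V by (intro card_mono finite_PiE) (auto simp: proper_colorings_def)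
    then show "num_colorings q V E \<le> q ^ n" using V by (simp add: num_colorings_def card_PiE)
  qed
qed simp

text \<open>The hypothesis says \<open>m <= n choose 2\<close>, so that the maximum is over a
  nonempty set.\<close>

lemma maximizer_exists:
  assumes "2 * m \<le> n * (n - 1)"
  obtains V E where "maximizes_colorings q n m V E" "max_num_colorings q n m = num_colorings q V E"
proof -
  let ?S = "{num_colorings q V E | (V :: nat set) E. nm_graph n m V E}"
  have "m \<le> card ([{..<n}]\<^bsup>2\<^esup>)"
    using assms binomial_eq_nsets[of n 2] by (simp add: choose_two lessThan_atLeast0)
  then obtain E0 where "E0 \<subseteq> [{..<n}]\<^bsup>2\<^esup>" "card E0 = m"
    using obtain_subset_with_card_n by metis
  then have "nm_graph n m {..<n} E0" by (simp add: nm_graph_def)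
  then have "?S \<noteq> {}" by blast
  then have "Max ?S \<in> ?S" by (rule Max_in[OF finite_num_colorings_values])
  then have "\<exists>(V :: nat set) E. Max ?S = num_colorings q V E \<and> nm_graph n m V E" by (rule CollectD)
  then obtain V :: "nat set" and E where VE: "Max ?S = num_colorings q V E" "nm_graph n m V E" by (elim exE conjE)
  have "num_colorings q V' E' \<le> num_colorings q V E" if "nm_graph n m V' E'" for V' :: "nat set" and E'
    unfolding VE(1)[symmetric] by (rule Max_ge[OF finite_num_colorings_values]) (use that in blast)
  then have "maximizes_colorings q n m V E" using VE(2) by (simp add: maximizes_colorings_def)
  then show thesis by (rule that) (simp add: max_num_colorings_def VE(1))
qed

context colouring_params
begin

text \<open>The equation would mean \<open>q * (q - 1) ^ k = q ^ k\<close>. Then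
  \<open>q - 1 > 1\<close> would divide a power of \<open>q\<close>, to which it is coprime.\<close>

lemma Lq_not_multiple: "Lq \<noteq> real k * lq"
proof
  assume "Lq = real k * lq"
  then have "exp Lq = exp lq ^ k" by (simp add: exp_of_nat_mult)
  moreover have "exp Lq = real q" "exp lq = real q / (real q - 1)" using q3 by (auto simp: Lq_def lq_def)
  ultimately have "real q * real (q - 1) ^ k = real q ^ k" using q3 by (simp add: of_nat_diff power_divide field_simps)
  then have e: "q * (q - 1) ^ k = q ^ k" by (metis of_nat_eq_iff of_nat_mult of_nat_power)
  show False
  proof (cases k)
    case 0
    then show False using e q3 by simp
  next
    case (Suc j)
    then have "(q - 1) ^ Suc j = q ^ j" using e q3 by simp
    then have "q - 1 dvd q ^ j" by (metis dvd_triv_left power_Suc)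
    moreover have "coprime (q - 1) q" using q3 by (intro coprime_diff_one_left_nat) simp
    then have "coprime (q - 1) (q ^ j)" by simp
    ultimately have "is_unit (q - 1)" by (metis coprime_common_divisor dvd_refl)
    then show False using q3 by simp
  qed
qed

lemma ratio_floor:
  obtains t :: nat where "real t * lq < Lq" "Lq < real (t + 1) * lq"
proof -
  define t where "t = nat \<lfloor>Lq / lq\<rfloor>"
  have "0 \<le> Lq / lq" using Lq_pos lq_pos by simp
  then have "real t \<le> Lq / lq" "Lq / lq < real t + 1" by (auto simp: t_def)
  then have "real t * lq \<le> Lq" "Lq < real (t + 1) * lq" using lq_pos by (simp_all add: field_simps)
  then show thesis using that[of t] Lq_not_multiple[of t] by linarith
qed

lemma sb_eq: "sb * lq = sa * Lq"
  using sa_Lq sb_lq by (simp add: mult.commute)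

text \<open>On the scale \<open>s = sqrt m\<close>, the exponent \<open>a * Lq\<close> is about
  \<open>cq / 2 * s\<close>, which equals \<open>sb * lq * s\<close>. Against it stands
  \<open>b * g\<close> with \<open>g = ln ((q - 2) / (q - 3)) > lq\<close>, about
  \<open>sb * g * s\<close>, and the difference is linear in \<open>s\<close>. For
  \<open>q = 3\<close> the left side vanishes.\<close>

lemma eventually_third_order_small:
  obtains \<epsilon>0 where "0 < \<epsilon>0" "\<And>\<epsilon>. 0 < \<epsilon> \<Longrightarrow> \<epsilon> < \<epsilon>0 \<Longrightarrow> \<forall>\<^sub>F m in sequentially. \<forall>a b.
    real a \<le> (sa + \<epsilon>) * sqrt m \<and> (sb - \<epsilon>) * sqrt m \<le> real b \<and> 1 \<le> b \<longrightarrow>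
      8 * (q ^ a * (q - 3) ^ b) < q * (q - 1) * (q - 2) ^ (b - 1)"
proof (cases "q = 3")
  case True
  have "8 * (q ^ a * (q - 3) ^ b) < q * (q - 1) * (q - 2) ^ (b - 1)" if "1 \<le> b" for a b
    using that True by (cases b) auto
  then show thesis by (intro that[of 1]) auto
next
  case False
  then have q4: "4 \<le> q" using q3 by simp
  define g where "g = ln (real q - 2) - ln (real q - 3)"
  have "lq < g"
  proof -
    have "real q / (real q - 1) < (real q - 2) / (real q - 3)"
      using q4 by (simp add: divide_simps) (simp add: algebra_simps)
    then have "lq < ln ((real q - 2) / (real q - 3))"
      unfolding lq_def using q4 by (intro ln_less_cancel_iff[THEN iffD2]) auto
    then show ?thesis using q4 by (simp add: g_def ln_div)
  qed
  then have "sb * lq < sb * g" using sb_pos by simp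
  moreover have "sb * lq = cq / 2" using sb_lq by (simp add: mult.commute)
  ultimately have g: "0 < g" "cq / 2 < sb * g" using \<open>lq < g\<close> lq_pos by linarith+
  define h where "h = sb * g - cq / 2"
  have h: "0 < h" using g by (simp add: h_def)
  define \<epsilon>0 where "\<epsilon>0 = h / (2 * (Lq + g))"
  have \<epsilon>0: "0 < \<epsilon>0" using h g Lq_pos by (simp add: \<epsilon>0_def)
  define C where "C = ln 8 + ln (real q - 2)"
  show thesis
  proof (rule that[OF \<epsilon>0])
    fix \<epsilon> assume \<epsilon>: "0 < \<epsilon>" "\<epsilon> < \<epsilon>0"
    then have \<epsilon>h: "\<epsilon> * (Lq + g) \<le> h / 2" using g Lq_pos by (simp add: \<epsilon>0_def field_simps)
    have "\<forall>\<^sub>F m in sequentially. C < h / 2 * sqrt (real m)" using h by real_asymp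
    then show "\<forall>\<^sub>F m in sequentially. \<forall>a b.
      real a \<le> (sa + \<epsilon>) * sqrt m \<and> (sb - \<epsilon>) * sqrt m \<le> real b \<and> 1 \<le> b \<longrightarrow>
      8 * (q ^ a * (q - 3) ^ b) < q * (q - 1) * (q - 2) ^ (b - 1)"
    proof eventually_elim
      case (elim m)
      show ?case
      proof (intro allI impI)
        fix a b :: nat
        assume H: "real a \<le> (sa + \<epsilon>) * sqrt m \<and> (sb - \<epsilon>) * sqrt m \<le> real b \<and> 1 \<le> b"
        define s where "s = sqrt (real m)"
        have "real a * Lq \<le> (sa + \<epsilon>) * s * Lq" using H Lq_pos unfolding s_def by (intro mult_right_mono) auto
        also have "\<dots> = cq / 2 * s + \<epsilon> * Lq * s" using sa_Lq by (simp add: algebra_simps)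
        finally have 1: "real a * Lq \<le> cq / 2 * s + \<epsilon> * Lq * s" .
        have "(sb - \<epsilon>) * s * g \<le> real b * g" using H g unfolding s_def by (intro mult_right_mono) auto
        then have 2: "sb * g * s - \<epsilon> * g * s \<le> real b * g" by (simp add: algebra_simps)
        have "\<epsilon> * (Lq + g) * s \<le> h / 2 * s" using \<epsilon>h by (intro mult_right_mono) (auto simp: s_def)
        then have 3: "\<epsilon> * Lq * s + \<epsilon> * g * s \<le> h / 2 * s" by (simp add: algebra_simps)
        have 4: "sb * g * s = h * s + cq / 2 * s" by (simp add: h_def algebra_simps)
        have "C + real a * Lq < real b * g" using 1 2 3 4 elim unfolding s_def[symmetric] by linarith
        then have "ln 8 + real a * Lq + real b * ln (real q - 3) < (real b - 1) * ln (real q - 2)"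
          by (simp add: C_def g_def algebra_simps)
        also have "(real b - 1) * ln (real q - 2) \<le> ln (real q * (real q - 1)) + (real b - 1) * ln (real q - 2)"
        proof -
          have "1 \<le> real q * (real q - 1)" using q4 mult_mono[of 1 "real q" 1 "real q - 1"] by simp
          then show ?thesis by simp
        qed
        also have "\<dots> = ln (real q * (real q - 1) * (real q - 2) ^ (b - 1))"
        proof -
          have "0 < real q * (real q - 1)" "0 < (real q - 2) ^ (b - 1)" using q4 by auto
          then have "ln (real q * (real q - 1) * (real q - 2) ^ (b - 1)) = ln (real q * (real q - 1)) + ln ((real q - 2) ^ (b - 1))"
            by (rule ln_mult_pos)
          also have "ln ((real q - 2) ^ (b - 1)) = (real b - 1) * ln (real q - 2)"
            using H by (simp add: ln_realpow of_nat_diff)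
          finally show ?thesis by (rule sym)
        qed
        also have "ln 8 + real a * Lq + real b * ln (real q - 3) = ln (8 * (real q ^ a * (real q - 3) ^ b))"
        proof -
          have "0 < real q ^ a" "0 < (real q - 3) ^ b" using q4 by auto
          then show ?thesis using q4 by (simp add: ln_mult_pos ln_realpow Lq_def)
        qed
        finally have "8 * (real q ^ a * (real q - 3) ^ b) < real q * (real q - 1) * (real q - 2) ^ (b - 1)"
          using q4 by (subst (asm) ln_less_cancel_iff) auto
        then have "real (8 * (q ^ a * (q - 3) ^ b)) < real (q * (q - 1) * (q - 2) ^ (b - 1))"
          using q4 by (simp add: of_nat_diff)
        then show "8 * (q ^ a * (q - 3) ^ b) < q * (q - 1) * (q - 2) ^ (b - 1)" by (simp only: of_nat_less_iff)
      qed
    qed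
  qed
qed

lemma eventually_semi_complete:
  fixes \<theta> \<eta> :: real
  assumes "0 < \<theta>" "0 < \<eta>"
  shows "\<forall>\<^sub>F m in sequentially. \<forall>n V E. (sa + sb + \<theta>) * sqrt m \<le> real n \<and> maximizes_colorings q n m V E \<longrightarrow>
    (\<exists>a b. semi_complete_plus_isolated (q \<ge> 4) a b V E \<and>
      \<bar>real a / (sa * sqrt m) - 1\<bar> \<le> \<eta> \<and> \<bar>real b / (sb * sqrt m) - 1\<bar> \<le> \<eta>)"
proof -
  obtain t :: nat where t: "real t * lq < Lq" "Lq < real (t + 1) * lq" by (rule ratio_floor)
  \<comment> \<open>This makes \<open>a * (t + 1)\<close> exceed \<open>b\<close> by a multiple of
    \<open>sqrt m\<close>, as needed for trading one vertex of \<open>A\<close> against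
    \<open>t + 1\<close> vertices of \<open>B\<close>.\<close>
  have st: "sb < sa * (real t + 1)"
  proof -
    have "sb * lq < sa * (real t + 1) * lq"
      using sb_eq t(2) mult_strict_left_mono[of Lq "(real t + 1) * lq" sa] sa_pos by (simp add: mult.assoc add.commute)
    then show ?thesis using lq_pos by simp
  qed
  obtain \<epsilon>0 where \<epsilon>0: "0 < \<epsilon>0" "\<And>\<epsilon>. 0 < \<epsilon> \<Longrightarrow> \<epsilon> < \<epsilon>0 \<Longrightarrow> \<forall>\<^sub>F m in sequentially. \<forall>a b.
    real a \<le> (sa + \<epsilon>) * sqrt m \<and> (sb - \<epsilon>) * sqrt m \<le> real b \<and> 1 \<le> b \<longrightarrow>
      8 * (q ^ a * (q - 3) ^ b) < q * (q - 1) * (q - 2) ^ (b - 1)" by (rule eventually_third_order_small) blast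
  \<comment> \<open>The smallest of the gaps that \<open>ln (1 + e)\<close> must stay below in
    \<open>maximizer_bipartite\<close>. The last one is positive because \<open>Lq\<close> is no
    multiple of \<open>lq\<close>.\<close>
  define G where "G = min (min lq (dq - lq)) (min sgq (Lq - real t * lq))"
  have G: "0 < G" using lq_pos lq_less_dq sgq_pos t by (simp add: G_def)
  have "((\<lambda>e. ln (1 + e)) \<longlongrightarrow> ln (1 + 0)) (at_right (0 :: real))" by (intro tendsto_intros) auto
  then have l1: "((\<lambda>e :: real. ln (1 + e)) \<longlongrightarrow> 0) (at_right 0)" by simp
  have "((\<lambda>e. (sa - e) * (real t + 1) - (sb + e)) \<longlongrightarrow> (sa - 0) * (real t + 1) - (sb + 0)) (at_right 0)"
    by (intro tendsto_intros)
  then have l2: "((\<lambda>e. (sa - e) * (real t + 1) - (sb + e)) \<longlongrightarrow> sa * (real t + 1) - sb) (at_right 0)" by simp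
  have "((\<lambda>e. \<theta> - 2 * e - e * (Lq + lq) / lq) \<longlongrightarrow> \<theta> - 2 * 0 - 0 * (Lq + lq) / lq) (at_right 0)"
    using lq_pos by (intro tendsto_intros) auto
  then have l3: "((\<lambda>e. \<theta> - 2 * e - e * (Lq + lq) / lq) \<longlongrightarrow> \<theta>) (at_right 0)" by simp
  have l4: "((\<lambda>e::real. e) \<longlongrightarrow> 0) (at_right 0)" by (rule tendsto_ident_at)
  have "sa < sb" using sa_less_1 sb_greater_1 by simp
  then have "eventually (\<lambda>e. ln (1 + e) < G \<and> 0 < (sa - e) * (real t + 1) - (sb + e) \<and> 0 < \<theta> - 2 * e - e * (Lq + lq) / lq
      \<and> e < \<eta> * sa \<and> e < \<epsilon>0 \<and> e < sa / 2 \<and> e < (sb - sa) / 2 \<and> 0 < e) (at_right 0)"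
    using G st assms \<epsilon>0(1) sa_pos
    by (intro eventually_conj order_tendstoD(2)[OF l1] order_tendstoD(1)[OF l2] order_tendstoD(1)[OF l3] order_tendstoD(2)[OF l4])
       (auto simp: eventually_at_right_less)
  then obtain e where e: "ln (1 + e) < G" "0 < (sa - e) * (real t + 1) - (sb + e)" "0 < \<theta> - 2 * e - e * (Lq + lq) / lq"
      "e < \<eta> * sa" "e < \<epsilon>0" "e < sa / 2" "e < (sb - sa) / 2" "0 < e"
    using eventually_happens' trivial_limit_at_right_real by blast
  \<comment> \<open>The bounded part of the number of extra vertices. Together with the linear part
    \<open>e * (Lq + lq) / lq * s\<close> and the deviation \<open>2 * e * s\<close> of the two
    sides it must fit into the margin \<open>\<theta> * s\<close>.\<close>
  define D where "D = (lq + Lq + ln (1 + e)) / lq + real t"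
  have ev1: "\<forall>\<^sub>F m in sequentially. 2 \<le> sa / 2 * sqrt (real m)" using sa_pos by real_asymp
  have ev2: "\<forall>\<^sub>F m in sequentially. real t + 2 \<le> ((sa - e) * (real t + 1) - (sb + e)) * sqrt (real m)"
    using e(2) by real_asymp
  have ev3: "\<forall>\<^sub>F m in sequentially. D \<le> (\<theta> - 2 * e - e * (Lq + lq) / lq) * sqrt (real m)"
    using e(3) by real_asymp
  have ev4: "\<forall>\<^sub>F m in sequentially. 2 \<le> \<theta> * sqrt (real m)" using assms(1) by real_asymp
  show ?thesis
    using eventually_structure[OF assms(1) e(8)] \<epsilon>0(2)[OF e(8) e(5)] ev1 ev2 ev3 ev4 eventually_ge_at_top[of 1]
  proof eventually_elim
    case (elim m)
    show ?case
    proof (intro allI impI)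
      fix n V E assume H: "(sa + sb + \<theta>) * sqrt m \<le> real n \<and> maximizes_colorings q n m V E"
      then have max: "maximizes_colorings q n m V E" and room: "(sa + sb + \<theta>) * sqrt m \<le> real n" by auto
      then have V: "E \<subseteq> [V]\<^bsup>2\<^esup>" by (auto simp: maximizes_colorings_def nm_graph_def)
      define s where "s = sqrt (real m)"
      have s: "0 < s" using elim(7) by (simp add: s_def)
      obtain A where A: "A \<subseteq> V \<and> A \<noteq> {} \<and> A \<inter> nbhd E A = {} \<and> \<bar>real (card A) - sa * sqrt m\<bar> \<le> e * sqrt m \<and>
      \<bar>real (card (nbhd E A)) - sb * sqrt m\<bar> \<le> e * sqrt m \<and>
      (\<forall>v\<in>V - A. 8 * card {w\<in>V - A. {v, w} \<in> E} \<le> card A) \<and>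
      real (num_colorings q V E) \<le> (1 + e) * (\<Sum>i<q. real (card (colorings_with q V E A i)))"
        using elim(1)[rule_format, OF H] by (elim exE)
      define a b where "a = card A" and "b = card (nbhd E A)"
      have a: "(sa - e) * s \<le> real a" "real a \<le> (sa + e) * s" and b: "(sb - e) * s \<le> real b" "real b \<le> (sb + e) * s"
        using A by (auto simp: a_def b_def s_def abs_le_iff algebra_simps)
      have half: "sa / 2 * s \<le> (sa - e) * s" "sa / 2 * s \<le> (sb - e) * s"
        using e(6,7) s \<open>sa < sb\<close> by (auto intro!: mult_right_mono)
      have a2: "2 \<le> real a" and b2: "2 \<le> real b" using half a(1) b(1) elim(3) unfolding s_def[symmetric] by linarith+
      have cab: "b + t + 2 \<le> a * (t + 1)"
      proof -
        have "real b + real t + 2 \<le> (sa - e) * (real t + 1) * s"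
          using b(2) elim(4) unfolding s_def[symmetric] by (simp add: algebra_simps)
        also have "\<dots> = (sa - e) * s * (real t + 1)" by simp
        also have "\<dots> \<le> real a * (real t + 1)" using a(1) by (intro mult_right_mono) auto
        finally have "real (b + t + 2) \<le> real (a * (t + 1))" by (simp add: algebra_simps)
        then show ?thesis by (simp only: of_nat_le_iff)
      qed
      have ab_le: "a \<le> b"
      proof -
        have "(sa + e) * s \<le> (sb - e) * s" using e(7) s by (intro mult_right_mono) auto
        then show ?thesis using a(2) b(1) by linarith
      qed
      have roomk: "a + b + k \<le> n"
        if k: "real k \<le> e * (Lq + lq) / lq * s + D" for k
      proof -
        have "real a + real b + real k \<le> (sa + sb + 2 * e + e * (Lq + lq) / lq) * s + D"
          using a(2) b(2) k by (simp add: algebra_simps)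
        also have "\<dots> \<le> (sa + sb + \<theta>) * s" using elim(5) unfolding s_def[symmetric] by (simp add: algebra_simps)
        also have "\<dots> \<le> real n" using room by (simp add: s_def)
        finally show ?thesis by linarith
      qed
      have ln0: "0 \<le> ln (1 + e)" using e(8) by simp
      have rt: "a + b + t \<le> n"
      proof (rule roomk)
        have "0 \<le> e * (Lq + lq) / lq * s" "0 \<le> (lq + Lq + ln (1 + e)) / lq" using e(8) Lq_pos lq_pos s ln0 by simp_all
        then show "real t \<le> e * (Lq + lq) / lq * s + D" by (simp add: D_def)
      qed
      have rk: "a + b + k \<le> n" if k: "real a * Lq + real b * lq + real k * lq \<le> cq * sqrt m + lq + Lq + ln (1 + e)" for k
      proof (rule roomk)
        have "(sa - e) * s * Lq \<le> real a * Lq" "(sb - e) * s * lq \<le> real b * lq"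
          using a(1) b(1) Lq_pos lq_pos by (auto intro!: mult_right_mono)
        moreover have "(sa - e) * s * Lq = cq / 2 * s - e * Lq * s" "(sb - e) * s * lq = cq / 2 * s - e * lq * s"
          using sa_Lq sb_lq by (simp_all add: algebra_simps)
        ultimately have "real k * lq \<le> e * (Lq + lq) * s + (lq + Lq + ln (1 + e))"
          using k distrib_right[of "e * Lq" "e * lq" s] unfolding s_def[symmetric] distrib_left by linarith
        then have "real k \<le> (e * (Lq + lq) * s + (lq + Lq + ln (1 + e))) / lq" using lq_pos by (simp add: pos_le_divide_eq)
        also have "\<dots> = e * (Lq + lq) / lq * s + (lq + Lq + ln (1 + e)) / lq" by (simp add: add_divide_distrib)
        finally show "real k \<le> e * (Lq + lq) / lq * s + D" by (simp add: D_def)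
      qed
      have lower: "real q ^ n * exp (- cq * sqrt m - lq) \<le> num_colorings q V E"
        using elim(6,7) by (intro maximizer_lower_bound[OF max _ _ room]) auto
      have AV: "A \<subseteq> V" and indep: "A \<inter> nbhd E A = {}"
        and deg: "\<And>v. v \<in> V - A \<Longrightarrow> 8 * card {w\<in>V - A. {v, w} \<in> E} \<le> card A"
        and P: "real (num_colorings q V E) \<le> (1 + e) * (\<Sum>i<q. real (card (colorings_with q V E A i)))"
        using A by blast+
      have lnG: "ln (1 + e) < lq" "ln (1 + e) < dq - lq" "ln (1 + e) < sgq" "ln (1 + e) < Lq - real t * lq"
        using e(1) by (auto simp: G_def)
      have a2': "2 \<le> card A" and b1': "1 \<le> card (nbhd E A)" using a2 b2 by (auto simp: a_def b_def)
      have rk': "card A + card (nbhd E A) + k \<le> n"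
        if "real (card A) * Lq + real (card (nbhd E A)) * lq + real k * lq \<le> cq * sqrt m + lq + Lq + ln (1 + e)" for k
        using rk[of k] that unfolding a_def b_def by blast
      note bip = maximizer_bipartite[OF max AV indep _ P lower e(8) lnG a2' b1' cab[unfolded a_def b_def] rt[unfolded a_def b_def]]
      have EAB: "E \<subseteq> complete_bipartite_edges A (nbhd E A)" by (rule bip(1)) (fact deg rk')+
      have few: "card A * card (nbhd E A) < m + card A" by (rule bip(2)) (fact deg rk')+
      have num: "8 * (q ^ a * (q - 3) ^ b) < q * (q - 1) * (q - 2) ^ (b - 1)"
        using a(2) b(1) b1' by (intro elim(2)[rule_format]) (simp add: s_def b_def)
      have "semi_complete_plus_isolated (q \<ge> 4) (card A) (card (nbhd E A)) V E"
        by (rule maximizer_semi_complete[OF max q3 AV nbhd_subset[OF V] indep EAB few _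
            ab_le[unfolded a_def b_def] num[unfolded a_def b_def]]) (use a2' in linarith)
      moreover have "\<bar>real a / (sa * s) - 1\<bar> \<le> \<eta>"
      proof -
        have "0 < sa * s" using sa_pos s by simp
        then have "real a / (sa * s) - 1 = (real a - sa * s) / (sa * s)"
          using sa_pos s by (simp add: diff_divide_distrib)
        then have "\<bar>real a / (sa * s) - 1\<bar> = \<bar>real a - sa * s\<bar> / (sa * s)"
          by (simp only: abs_divide abs_of_pos[OF \<open>0 < sa * s\<close>])
        also have "\<dots> \<le> (e * s) / (sa * s)" using A \<open>0 < sa * s\<close> unfolding a_def s_def by (intro divide_right_mono) auto
        also have "\<dots> \<le> \<eta>" using e(4) s sa_pos by (simp add: field_simps)
        finally show ?thesis .
      qed
      moreover have "\<bar>real b / (sb * s) - 1\<bar> \<le> \<eta>"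
      proof -
        have "0 < sb * s" using sb_pos s by simp
        then have "real b / (sb * s) - 1 = (real b - sb * s) / (sb * s)"
          using sb_pos s by (simp add: diff_divide_distrib)
        then have "\<bar>real b / (sb * s) - 1\<bar> = \<bar>real b - sb * s\<bar> / (sb * s)"
          by (simp only: abs_divide abs_of_pos[OF \<open>0 < sb * s\<close>])
        also have "\<dots> \<le> (e * s) / (sb * s)" using A \<open>0 < sb * s\<close> unfolding b_def s_def by (intro divide_right_mono) auto
        also have "\<dots> \<le> \<eta>"
        proof -
          have "e < \<eta> * sb" using e(4) mult_strict_left_mono[OF \<open>sa < sb\<close> assms(2)] by simp
          then show ?thesis using s sb_pos by (simp add: field_simps)
        qed
        finally show ?thesis .
      qed
      ultimately show "\<exists>a b. semi_complete_plus_isolated (q \<ge> 4) a b V E \<and>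
        \<bar>real a / (sa * sqrt m) - 1\<bar> \<le> \<eta> \<and> \<bar>real b / (sb * sqrt m) - 1\<bar> \<le> \<eta>"
        unfolding a_def b_def s_def by blast
    qed
  qed
qed

lemma two_le_sa_sb: "2 \<le> sa + sb"
proof -
  have "0 \<le> (sb - sa)\<^sup>2" by simp
  then have "4 * (sa * sb) \<le> (sa + sb)\<^sup>2" by (simp add: power2_eq_square algebra_simps)
  then have "2\<^sup>2 \<le> (sa + sb)\<^sup>2" by (simp add: sa_sb)
  then show ?thesis by (rule power2_le_imp_le) (use sa_pos sb_pos in simp)
qed

text \<open>As \<open>sa * sb = 1\<close>, the sum \<open>sa + sb\<close> is at least
  \<open>2\<close>, so \<open>m <= n^2 / 4\<close> and graphs with \<open>n\<close> vertices and
  \<open>m\<close> edges exist.\<close>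

lemma room_imp_edges:
  fixes m n :: nat
  assumes "1 \<le> m" "0 < \<theta>" "(sa + sb + \<theta>) * sqrt m \<le> real n"
  shows "2 * m \<le> n * (n - 1)"
proof -
  have "2 * sqrt m \<le> (sa + sb + \<theta>) * sqrt m" using two_le_sa_sb assms(2) by (intro mult_right_mono) auto
  then have s: "2 * sqrt m \<le> real n" using assms(3) by simp
  moreover have "1 \<le> sqrt m" using assms(1) by simp
  ultimately have "2 \<le> n" by linarith
  have "(2 * sqrt m)\<^sup>2 \<le> (real n)\<^sup>2" using s by (intro power_mono) auto
  then have "real (4 * m) \<le> real (n * n)" by (simp add: power2_eq_square)
  then have "4 * m \<le> n * n" by (simp only: of_nat_le_iff)
  also have "\<dots> \<le> 2 * (n * (n - 1))"
  proof -
    have "n \<le> 2 * (n - 1)" using \<open>2 \<le> n\<close> by linarith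
    then have "n * n \<le> n * (2 * (n - 1))" by (rule mult_le_mono2)
    then show ?thesis by (simp only: mult.left_commute)
  qed
  finally show ?thesis by simp
qed

end

theorem theorem1p2:
  fixes q :: nat and \<kappa> :: real
  assumes "q \<ge> 3" and "\<kappa> < kappa q"
  shows "\<exists>(M::nat) (\<delta> :: nat \<Rightarrow> nat \<Rightarrow> real) (\<eta> :: nat \<Rightarrow> nat \<Rightarrow> real).
    ((\<lambda>(m, n). \<delta> m n) \<longlongrightarrow> 0) (sequentially \<times>\<^sub>F sequentially) \<and>
    ((\<lambda>(m, n). \<eta> m n) \<longlongrightarrow> 0) (sequentially \<times>\<^sub>F sequentially) \<and>
    (\<forall>m n. m \<ge> M \<and> real m \<le> \<kappa> * (real n)\<^sup>2 \<longrightarrow>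
      (\<forall>V E. maximizes_colorings q n m V E \<longrightarrow>
        (\<exists>(a::nat) (b::nat) (\<alpha>::real) (\<beta>::real).
          semi_complete_plus_isolated (q \<ge> 4) a b V E \<and>
          \<bar>\<alpha>\<bar> \<le> \<delta> m n \<and> \<bar>\<beta>\<bar> \<le> \<delta> m n \<and>
          real a = (1 + \<alpha>) * sqrt (real m * ln (real q / (real q - 1)) / ln (real q)) \<and>
          real b = (1 + \<beta>) * sqrt (real m * ln (real q) / ln (real q / (real q - 1))))) \<and>
      real (max_num_colorings q n m) =
        real q ^ n * exp ((- (2 * sqrt (ln (real q / (real q - 1)) * ln (real q))) + \<eta> m n)
                          * sqrt (real m)))"
proof -
  interpret colouring_params q by unfold_locales (rule assms(1))
  obtain \<theta> where \<theta>: "0 < \<theta>" "\<And>m n. 1 \<le> m \<Longrightarrow> real m \<le> \<kappa> * (real n)\<^sup>2 \<Longrightarrow> (sa + sb + \<theta>) * sqrt m \<le> real n"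
    using room_exists[OF assms(2)] by blast
  obtain \<delta> M1 where \<delta>: "\<delta> \<longlonglongrightarrow> 0" and M1: "\<And>m. M1 \<le> m \<Longrightarrow>
    \<forall>n V E. (sa + sb + \<theta>) * sqrt m \<le> real n \<and> maximizes_colorings q n m V E \<longrightarrow>
    (\<exists>a b. semi_complete_plus_isolated (q \<ge> 4) a b V E \<and>
      \<bar>real a / (sa * sqrt m) - 1\<bar> \<le> \<delta> m \<and> \<bar>real b / (sb * sqrt m) - 1\<bar> \<le> \<delta> m)"
    by (rule diagonal_rate[OF eventually_semi_complete[OF \<theta>(1)]], assumption) (rule that, assumption, blast)
  have "\<forall>\<^sub>F m in sequentially. 2 \<le> \<theta> * sqrt (real m)" using \<theta>(1) by real_asymp
  then obtain M2 where M2: "\<And>m. M2 \<le> m \<Longrightarrow> 2 \<le> \<theta> * sqrt (real m)" by (auto simp: eventually_sequentially)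
  define M where "M = max 1 (max M1 M2)"
  define ok where "ok = (\<lambda>m n. M \<le> m \<and> real m \<le> \<kappa> * (real n)\<^sup>2)"
  \<comment> \<open>The claimed formula is solved for \<open>\<eta>\<close>. The value
    \<open>0\<close> where nothing is claimed keeps the limit over all pairs
    \<open>(m, n)\<close>.\<close>
  define \<eta> where "\<eta> = (\<lambda>m n. if ok m n then cq + ln (real (max_num_colorings q n m) / real q ^ n) / sqrt m else 0)"
  have rm: "(sa + sb + \<theta>) * sqrt m \<le> real n" if "ok m n" for m n
    by (rule \<theta>(2)) (use that in \<open>simp_all add: ok_def M_def\<close>)
  have ex: "\<exists>V E. maximizes_colorings q n m V E \<and> max_num_colorings q n m = num_colorings q V E" if "ok m n" for m n
  proof -
    have "2 * m \<le> n * (n - 1)" by (rule room_imp_edges[OF _ \<theta>(1) rm[OF that]]) (use that in \<open>simp add: ok_def M_def\<close>)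
    then show ?thesis by (rule maximizer_exists) blast
  qed
  have low: "real q ^ n * exp (- cq * sqrt m - lq) \<le> real (max_num_colorings q n m)" if mn: "ok m n" for m n
  proof -
    obtain V E where VE: "maximizes_colorings q n m V E" "max_num_colorings q n m = num_colorings q V E" using ex[OF mn] by blast
    show ?thesis unfolding VE(2) using mn M2[of m]
      by (intro maximizer_lower_bound[OF VE(1) _ _ rm[OF mn]]) (auto simp: ok_def M_def)
  qed
  have qn: "0 < real q ^ n" for n using assms(1) by simp
  have \<eta>_low: "- lq / sqrt m \<le> \<eta> m n" if mn: "ok m n" for m n
  proof -
    have s: "0 < sqrt m" using mn by (simp add: ok_def M_def)
    have "exp (- cq * sqrt m - lq) \<le> real (max_num_colorings q n m) / real q ^ n"
      using low[OF mn] qn by (simp add: field_simps)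
    then have "- cq * sqrt m - lq \<le> ln (real (max_num_colorings q n m) / real q ^ n)"
      using exp_gt_zero by (subst ln_ge_iff) (rule less_le_trans)
    then have "(- cq * sqrt m - lq) / sqrt m \<le> ln (real (max_num_colorings q n m) / real q ^ n) / sqrt m"
      using s by (intro divide_right_mono) auto
    moreover have "(- cq * sqrt m - lq) / sqrt m = - cq - lq / sqrt m" using s by (simp add: field_simps)
    ultimately show ?thesis using mn by (simp add: \<eta>_def)
  qed
  have formula: "real (max_num_colorings q n m) = real q ^ n * exp ((- cq + \<eta> m n) * sqrt m)" if mn: "ok m n" for m n
  proof -
    have s: "0 < sqrt m" using mn by (simp add: ok_def M_def)
    have "0 < real q ^ n * exp (- cq * sqrt m - lq)" using qn by simp
    then have P: "0 < real (max_num_colorings q n m)" using low[OF mn] by linarith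
    have "(- cq + \<eta> m n) * sqrt m = ln (real (max_num_colorings q n m) / real q ^ n)"
      using mn s by (simp add: \<eta>_def)
    then show ?thesis using P qn[of n] by simp
  qed
  have up: "\<forall>\<^sub>F m in sequentially. \<forall>n. ok m n \<longrightarrow> \<eta> m n \<le> e" if e: "0 < e" for e
    using eventually_maximizer_upper_bound[OF \<theta>(1) e]
  proof eventually_elim
    case (elim m)
    show ?case
    proof (intro allI impI)
      fix n assume mn: "ok m n"
      obtain V E where VE: "maximizes_colorings q n m V E" "max_num_colorings q n m = num_colorings q V E" using ex[OF mn] by blast
      have s: "0 < sqrt m" using mn by (simp add: ok_def M_def)
      have "real q ^ n * exp ((- cq + \<eta> m n) * sqrt m) \<le> real q ^ n * exp ((- cq + e) * sqrt m)"
        using elim[rule_format, of n V E, OF conjI[OF rm[OF mn] VE(1)]]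
        unfolding VE(2)[symmetric] formula[OF mn] .
      then have "(- cq + \<eta> m n) * sqrt m \<le> (- cq + e) * sqrt m"
        using qn[of n] by (simp add: mult_le_cancel_left_pos)
      then show "\<eta> m n \<le> e" using s by (simp add: mult_le_cancel_right_pos)
    qed
  qed
  have lim_\<delta>: "((\<lambda>(m, n). \<delta> m) \<longlongrightarrow> 0) (sequentially \<times>\<^sub>F (sequentially :: nat filter))"
    using filterlim_compose[OF \<delta> filterlim_fst, of sequentially] by (simp add: case_prod_beta')
  have lim_\<eta>: "((\<lambda>(m, n). \<eta> m n) \<longlongrightarrow> 0) (sequentially \<times>\<^sub>F sequentially)"
  proof (rule tendstoI)
    fix r :: real assume r: "0 < r"
    have ev: "\<forall>\<^sub>F m in sequentially. lq / sqrt (real m) < r" using lq_pos r by real_asymp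
    have "\<forall>\<^sub>F m in sequentially. \<forall>n. \<bar>\<eta> m n\<bar> < r"
      using up[OF half_gt_zero[OF r]] ev
    proof eventually_elim
      case (elim m)
      have "\<bar>\<eta> m n\<bar> < r" for n
      proof (cases "ok m n")
        case True
        then show ?thesis using \<eta>_low[OF True] elim r by (auto simp: abs_less_iff)
      next
        case False
        then show ?thesis using r by (simp add: \<eta>_def)
      qed
      then show ?case by blast
    qed
    \<comment> \<open>The bounds on \<open>\<eta>\<close> are uniform in \<open>n\<close>, so a
      threshold for \<open>m\<close> serves in the product filter.\<close>
    then obtain N where "\<And>m n. N \<le> m \<Longrightarrow> \<bar>\<eta> m n\<bar> < r" unfolding eventually_sequentially by blast
    then show "\<forall>\<^sub>F x in sequentially \<times>\<^sub>F sequentially. dist (case x of (m, n) \<Rightarrow> \<eta> m n) 0 < r"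
      unfolding eventually_prod_sequentially by (intro exI[of _ N]) simp
  qed
  have semi: "\<exists>(a::nat) (b::nat) (\<alpha>::real) (\<beta>::real). semi_complete_plus_isolated (q \<ge> 4) a b V E \<and>
          \<bar>\<alpha>\<bar> \<le> \<delta> m \<and> \<bar>\<beta>\<bar> \<le> \<delta> m \<and>
          real a = (1 + \<alpha>) * sqrt (real m * ln (real q / (real q - 1)) / ln (real q)) \<and>
          real b = (1 + \<beta>) * sqrt (real m * ln (real q) / ln (real q / (real q - 1)))"
    if mn: "ok m n" and max: "maximizes_colorings q n m V E" for m n V E
  proof -
    have "M1 \<le> m" using mn by (simp add: ok_def M_def)
    then obtain a b where ab: "semi_complete_plus_isolated (q \<ge> 4) a b V E"
      "\<bar>real a / (sa * sqrt m) - 1\<bar> \<le> \<delta> m" "\<bar>real b / (sb * sqrt m) - 1\<bar> \<le> \<delta> m"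
      using M1 rm[OF mn] max by blast
    have s: "0 < sqrt m" using mn by (simp add: ok_def M_def)
    have roots: "sqrt (real m * ln (real q / (real q - 1)) / ln (real q)) = sa * sqrt m"
      "sqrt (real m * ln (real q) / ln (real q / (real q - 1))) = sb * sqrt m"
      unfolding sa_def sb_def Lq_def lq_def real_sqrt_mult[symmetric] by (simp_all only: times_divide_eq_right times_divide_eq_left mult.commute)
    have "real a = (1 + (real a / (sa * sqrt m) - 1)) * (sa * sqrt m)" using s sa_pos by simp
    moreover have "real b = (1 + (real b / (sb * sqrt m) - 1)) * (sb * sqrt m)" using s sb_pos by simp
    ultimately show ?thesis
      unfolding roots using ab
      by - (rule exI[of _ a], rule exI[of _ b], rule exI[of _ "real a / (sa * sqrt m) - 1"],
          rule exI[of _ "real b / (sb * sqrt m) - 1"], intro conjI, assumption+)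
  qed
  have cq_eq: "2 * sqrt (ln (real q / (real q - 1)) * ln (real q)) = cq"
    by (simp add: cq_def Kq_def Lq_def lq_def mult.commute)
  show ?thesis
  proof (rule exI[of _ M], rule exI[of _ "\<lambda>m n. \<delta> m"], rule exI[of _ \<eta>], intro conjI allI impI)
    fix m n V E assume "M \<le> m \<and> real m \<le> \<kappa> * (real n)\<^sup>2" and max: "maximizes_colorings q n m V E"
    then have "ok m n" by (simp add: ok_def)
    then show "\<exists>(a::nat) (b::nat) (\<alpha>::real) (\<beta>::real). semi_complete_plus_isolated (q \<ge> 4) a b V E \<and>
          \<bar>\<alpha>\<bar> \<le> \<delta> m \<and> \<bar>\<beta>\<bar> \<le> \<delta> m \<and>
          real a = (1 + \<alpha>) * sqrt (real m * ln (real q / (real q - 1)) / ln (real q)) \<and>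
          real b = (1 + \<beta>) * sqrt (real m * ln (real q) / ln (real q / (real q - 1)))"
      using max by (rule semi)
  next
    fix m n assume "M \<le> m \<and> real m \<le> \<kappa> * (real n)\<^sup>2"
    then have "ok m n" by (simp add: ok_def)
    then show "real (max_num_colorings q n m) =
        real q ^ n * exp ((- (2 * sqrt (ln (real q / (real q - 1)) * ln (real q))) + \<eta> m n) * sqrt (real m))"
      unfolding cq_eq by (rule formula)
  qed (rule lim_\<delta> lim_\<eta>)+
qed

end
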